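(* Let $\delta=hD_{m,n}$, where $h\in R$. Then $\mathrm{Aut}(\delta)\cong G\ltimes(R,+)$, where $G$ is a finite cyclic group.
   Context: Let $a,b,c$ be pairwise coprime positive integers with $\frac1a+\frac1b+\frac1c<1$, let $R=\mathbb{C}[X,Y,Z]/(X^a+Y^b+Z^c)$, and for integers $m,n\geqslant 2$ let $B_{m,n}=R[U,V]/(X^mU-Y^nV-1)$. Let $x,y,z,u,v$ be the images of $X,Y,Z,U,V$ in $B_{m,n}$; $R$ is identified with $\mathbb{C}[x,y,z]\subseteq B_{m,n}$. The canonical locally nilpotent derivation $D_{m,n}$ of $B_{m,n}$ is the $R$-derivation with $D_{m,n}(u)=y^n$, $D_{m,n}(v)=x^m$. For a locally nilpotent derivation $\delta$ of $B_{m,n}$, $\mathrm{Aut}(\delta)$ is the group of $\mathbb{C}$-algebra automorphisms of $B_{m,n}$ commuting with $\delta$. In the semidirect product, $(R,+)$ is the normal factor.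
   Formalization: It is assumed that h ≠ 0; for h = 0 the claim fails, since Aut(0) = Aut(B) contains a torus C* with infinite torsion subgroup, while torsion subgroups of G⋉(R,+) with G finite are finite. *)

theory Defs
  imports "HOL-Algebra.Algebra" "HOL-Algebra.Algebraic_Closure_Type"
begin

section \<open>The rings \<open>R\<close> and \<open>B\<^sub>m\<^sub>,\<^sub>n\<close>\<close>

text \<open>\<open>\<complex>[X,Y,Z]\<close> is the iterated polynomial ring \<open>\<complex>[X][Y][Z]\<close>.\<close>

type_synonym cpoly3 = "complex poly poly poly"

definition polyX :: cpoly3 where "polyX = [:[:[:0, 1:]:]:]"
definition polyY :: cpoly3 where "polyY = [:[:0, 1:]:]"
definition polyZ :: cpoly3 where "polyZ = [:0, 1:]"

definition polyC :: "complex \<Rightarrow> cpoly3" where "polyC k = [:[:[:k:]:]:]"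

definition polyXYZ :: "cpoly3 ring" where "polyXYZ = ring_of_type_algebra"

definition relR :: "nat \<Rightarrow> nat \<Rightarrow> nat \<Rightarrow> cpoly3 set" where
  "relR a b c = PIdl\<^bsub>polyXYZ\<^esub> (polyX ^ a + polyY ^ b + polyZ ^ c)"

definition ringR :: "nat \<Rightarrow> nat \<Rightarrow> nat \<Rightarrow> cpoly3 set ring" where
  "ringR a b c = polyXYZ Quot relR a b c"

definition classR :: "nat \<Rightarrow> nat \<Rightarrow> nat \<Rightarrow> cpoly3 \<Rightarrow> cpoly3 set" where
  "classR a b c p = relR a b c +>\<^bsub>polyXYZ\<^esub> p"

text \<open>For a ring \<open>S\<close>, \<open>S[U,V]\<close> is the iterated polynomial ring \<open>S[U][V]\<close>.\<close>

type_synonym 's poly2 = "nat \<Rightarrow> nat \<Rightarrow> 's"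

definition polyUV :: "'s ring \<Rightarrow> (nat \<Rightarrow> 's, 's poly2) up_ring" where
  "polyUV S = UP (UP S)"

definition constUV :: "'s ring \<Rightarrow> 's \<Rightarrow> 's poly2" where
  "constUV S s = up_ring.monom (UP (UP S)) (up_ring.monom (UP S) s 0) 0"

definition varU :: "'s ring \<Rightarrow> 's poly2" where
  "varU S = up_ring.monom (UP (UP S)) (up_ring.monom (UP S) \<one>\<^bsub>S\<^esub> 1) 0"

definition varV :: "'s ring \<Rightarrow> 's poly2" where
  "varV S = up_ring.monom (UP (UP S)) \<one>\<^bsub>UP S\<^esub> 1"

definition relB :: "nat \<Rightarrow> nat \<Rightarrow> nat \<Rightarrow> nat \<Rightarrow> nat \<Rightarrow> cpoly3 set poly2 set" where
  "relB a b c m n = (let R = ringR a b c; P = polyUV R in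
     PIdl\<^bsub>P\<^esub> (constUV R (classR a b c (polyX ^ m)) \<otimes>\<^bsub>P\<^esub> varU R
            \<ominus>\<^bsub>P\<^esub> constUV R (classR a b c (polyY ^ n)) \<otimes>\<^bsub>P\<^esub> varV R
            \<ominus>\<^bsub>P\<^esub> \<one>\<^bsub>P\<^esub>))"

definition ringB :: "nat \<Rightarrow> nat \<Rightarrow> nat \<Rightarrow> nat \<Rightarrow> nat \<Rightarrow> cpoly3 set poly2 set ring" where
  "ringB a b c m n = polyUV (ringR a b c) Quot relB a b c m n"

definition classB ::
  "nat \<Rightarrow> nat \<Rightarrow> nat \<Rightarrow> nat \<Rightarrow> nat \<Rightarrow> cpoly3 set poly2 \<Rightarrow> cpoly3 set poly2 set" where
  "classB a b c m n p = relB a b c m n +>\<^bsub>polyUV (ringR a b c)\<^esub> p"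

text \<open>The canonical map \<open>R \<rightarrow> B\<^sub>m\<^sub>,\<^sub>n\<close>, by which \<open>R\<close> is regarded as a subring.\<close>

definition inclR ::
  "nat \<Rightarrow> nat \<Rightarrow> nat \<Rightarrow> nat \<Rightarrow> nat \<Rightarrow> cpoly3 set \<Rightarrow> cpoly3 set poly2 set" where
  "inclR a b c m n r = classB a b c m n (constUV (ringR a b c) r)"

definition inclC ::
  "nat \<Rightarrow> nat \<Rightarrow> nat \<Rightarrow> nat \<Rightarrow> nat \<Rightarrow> complex \<Rightarrow> cpoly3 set poly2 set" where
  "inclC a b c m n k = inclR a b c m n (classR a b c (polyC k))"

definition elt_x :: "nat \<Rightarrow> nat \<Rightarrow> nat \<Rightarrow> nat \<Rightarrow> nat \<Rightarrow> cpoly3 set poly2 set" where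
  "elt_x a b c m n = inclR a b c m n (classR a b c polyX)"
definition elt_y :: "nat \<Rightarrow> nat \<Rightarrow> nat \<Rightarrow> nat \<Rightarrow> nat \<Rightarrow> cpoly3 set poly2 set" where
  "elt_y a b c m n = inclR a b c m n (classR a b c polyY)"
definition elt_u :: "nat \<Rightarrow> nat \<Rightarrow> nat \<Rightarrow> nat \<Rightarrow> nat \<Rightarrow> cpoly3 set poly2 set" where
  "elt_u a b c m n = classB a b c m n (varU (ringR a b c))"
definition elt_v :: "nat \<Rightarrow> nat \<Rightarrow> nat \<Rightarrow> nat \<Rightarrow> nat \<Rightarrow> cpoly3 set poly2 set" where
  "elt_v a b c m n = classB a b c m n (varV (ringR a b c))"


section \<open>Derivations and their automorphism groups\<close>

text \<open>Derivations of \<open>B\<close> over a subring \<open>A\<close>, i.e. derivations that vanish on \<open>A\<close>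
  (equivalently, \<open>A\<close>-linear ones).\<close>

definition derivation_over :: "'r ring \<Rightarrow> 'r set \<Rightarrow> ('r \<Rightarrow> 'r) \<Rightarrow> bool" where
  "derivation_over B A D \<longleftrightarrow>
     D \<in> carrier B \<rightarrow> carrier B \<and>
     (\<forall>f\<in>carrier B. \<forall>g\<in>carrier B. D (f \<oplus>\<^bsub>B\<^esub> g) = D f \<oplus>\<^bsub>B\<^esub> D g) \<and>
     (\<forall>f\<in>carrier B. \<forall>g\<in>carrier B.
        D (f \<otimes>\<^bsub>B\<^esub> g) = (f \<otimes>\<^bsub>B\<^esub> D g) \<oplus>\<^bsub>B\<^esub> (g \<otimes>\<^bsub>B\<^esub> D f)) \<and>
     (\<forall>s\<in>A. D s = \<zero>\<^bsub>B\<^esub>)"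

text \<open>Since \<open>B\<^sub>m\<^sub>,\<^sub>n\<close> is generated by \<open>u\<close> and \<open>v\<close> over \<open>R\<close>, the two prescribed values determine
  the derivation on the carrier; extensionality fixes it off the carrier. It exists because
  \<open>x\<^sup>m y\<^sup>n - y\<^sup>n x\<^sup>m = 0\<close>.\<close>

definition canonD ::
  "nat \<Rightarrow> nat \<Rightarrow> nat \<Rightarrow> nat \<Rightarrow> nat \<Rightarrow> cpoly3 set poly2 set \<Rightarrow> cpoly3 set poly2 set" where
  "canonD a b c m n = (let B = ringB a b c m n in
     THE D. D \<in> extensional (carrier B) \<and>
       derivation_over B (inclR a b c m n ` carrier (ringR a b c)) D \<and>
       D (elt_u a b c m n) = elt_y a b c m n [^]\<^bsub>B\<^esub> n \<and>
       D (elt_v a b c m n) = elt_x a b c m n [^]\<^bsub>B\<^esub> m)"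

text \<open>The group of \<open>\<complex>\<close>-algebra automorphisms of \<open>B\<^sub>m\<^sub>,\<^sub>n\<close> commuting with \<open>\<delta>\<close>, as a subgroup of
  the group of (extensional) bijections of the carrier.\<close>

definition AutDer ::
  "nat \<Rightarrow> nat \<Rightarrow> nat \<Rightarrow> nat \<Rightarrow> nat \<Rightarrow> (cpoly3 set poly2 set \<Rightarrow> cpoly3 set poly2 set)
    \<Rightarrow> (cpoly3 set poly2 set \<Rightarrow> cpoly3 set poly2 set) monoid" where
  "AutDer a b c m n \<delta> = (let B = ringB a b c m n in
     BijGroup (carrier B)
       \<lparr>carrier := {\<alpha> \<in> Bij (carrier B). \<alpha> \<in> ring_iso B B \<and>
          (\<forall>k. \<alpha> (inclC a b c m n k) = inclC a b c m n k) \<and>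
          (\<forall>f\<in>carrier B. \<alpha> (\<delta> f) = \<delta> (\<alpha> f))}\<rparr>)"


section \<open>Semidirect products\<close>

text \<open>\<open>G \<ltimes> N\<close> with normal factor \<open>N\<close>, for an action \<open>\<theta> : G \<rightarrow> Aut(N)\<close>.\<close>

definition semidirect ::
  "'g monoid \<Rightarrow> ('g \<Rightarrow> 'h \<Rightarrow> 'h) \<Rightarrow> 'h monoid \<Rightarrow> ('g \<times> 'h) monoid" where
  "semidirect G \<theta> N =
     \<lparr>carrier = carrier G \<times> carrier N,
      monoid.mult = (\<lambda>(g, r) (g', r'). (g \<otimes>\<^bsub>G\<^esub> g', r \<otimes>\<^bsub>N\<^esub> \<theta> g r')),
      one = (\<one>\<^bsub>G\<^esub>, \<one>\<^bsub>N\<^esub>)\<rparr>"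

end

theory Submission
  imports Defs "HOL-Number_Theory.Cong"
begin

text \<open>
  Over an algebraically closed field \<open>K\<close> containing \<open>\<complex>(s)\<close>, choose \<open>\<zeta>\<close> with
  \<open>s\<^sup>a + 1 + \<zeta>\<^sup>c = 0\<close>. Then \<open>x = s w\<^bsup>bc\<^esup>\<close>, \<open>y = w\<^bsup>ac\<^esup>\<close>, \<open>z = \<zeta> w\<^bsup>ab\<^esup>\<close> embeds \<open>R\<close> into
  \<open>K[w]\<close>, and \<open>v = V\<close>, \<open>u = (1 + y\<^sup>n V) / x\<^sup>m\<close> embeds \<open>B\<^sub>m\<^sub>,\<^sub>n\<close> into \<open>K(w)[V]\<close>, where the canonical
  derivation becomes \<open>x\<^sup>m d/dV\<close> and has kernel \<open>R\<close>.

  An automorphism \<open>\<alpha>\<close> commuting with \<open>\<delta>\<close> maps \<open>ker \<delta> = R\<close> onto itself. The images of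
  \<open>x, y, z\<close> are polynomials in \<open>w\<close> satisfying \<open>f\<^sup>a + g\<^sup>b + h\<^sup>c = 0\<close>; because \<open>s\<close> is transcendental,
  they have no common root except possibly \<open>0\<close>, so the Mason-Stothers argument together with
  \<open>1/a + 1/b + 1/c < 1\<close> forces them to be monomials. Hence \<open>\<alpha>\<close> acts on \<open>R\<close> as the substitution
  \<open>w \<mapsto> t w\<close> for some \<open>t \<in> \<complex>\<^sup>*\<close>. Comparing degrees in \<open>\<alpha> \<delta> = \<delta> \<alpha>\<close> on \<open>u\<close> and \<open>v\<close>, and using
  that \<open>x\<^sup>m, y\<^sup>n\<close> is a regular sequence in \<open>R\<close>, gives \<open>\<alpha> u = t\<^bsup>-bcm\<^esup> (u + y\<^sup>n r)\<close> and
  \<open>\<alpha> v = t\<^bsup>-acn\<^esup> (v + x\<^sup>m r)\<close> with \<open>r \<in> R\<close>. The admissible \<open>t\<close> are those with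
  \<open>t\<^bsup>bcm+acn\<^esup> h(t w) = h(w)\<close>; they form a finite, hence cyclic, subgroup of \<open>\<complex>\<^sup>*\<close>.
\<close>

text \<open>\<open>R\<close> is not a polynomial ring, so a Mason-Stothers count cannot be run in it
  directly. With weights bc, ac, ab for x, y, z the defining relation is homogeneous of degree abc,
  and \<open>w\<close> is the coordinate along a generic orbit of the corresponding action of the
  nonzero complex numbers. In \<open>K[w]\<close> degrees and roots are available, but the
  coefficients now lie in a field much larger than the complex numbers. What leads back is pairwise
  coprimality: it makes \<open>X\<close>, \<open>Y\<close>, \<open>Z\<close> the only monomials of
  their weights, so a monomial of such a degree lying in \<open>R\<close> is a complex multiple of
  the generator. It also gives the three weights greatest common divisor 1, which makes
  \<open>t\<close> unique. Algebraic closedness of \<open>K\<close> serves twice: for the root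
  \<zeta>, and for passing from the absence of common roots to coprimality. That \<open>h\<close> is
  nonzero also enters twice: it makes \<delta> and the canonical derivation have the same kernel,
  and one nonzero coefficient of \<open>h\<close> bounds the order of \<open>t\<close>. The shifts
  by \<open>r\<close> form the normal factor, on which \<open>t\<close> acts by the same twisted
  substitution that has to fix \<open>h\<close>.\<close>

lemma coprime_poly_if_no_common_root:
  fixes p q :: "'k :: {alg_closed_field, field_gcd} poly"
  assumes "\<And>x. poly p x = 0 \<Longrightarrow> poly q x \<noteq> 0"
  shows "coprime p q"
proof -
  have nz: "gcd p q \<noteq> 0"
    using assms[of 0] by auto
  have "degree (gcd p q) = 0"
  proof (rule ccontr)
    assume "degree (gcd p q) \<noteq> 0"
    then obtain x where "poly (gcd p q) x = 0"
      using alg_closed_imp_poly_has_root[of "gcd p q"] by auto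
    then have "poly p x = 0" "poly q x = 0"
      by (meson dvd_trans gcd_dvd1 gcd_dvd2 poly_eq_0_iff_dvd)+
    with assms show False by blast
  qed
  with nz have "is_unit (gcd p q)"
    using is_unit_iff_degree by blast
  then show ?thesis
    by (rule is_unit_gcd[THEN iffD1])
qed

subsection \<open>The Mason-Stothers argument\<close>

text \<open>The Wronskian is formed with \<open>w d/dw\<close> instead of \<open>d/dw\<close>: then a factor \<open>w\<^sup>e\<close> divides it to
  the full power \<open>e\<close>, so a common root at \<open>0\<close> costs nothing in the degree count.\<close>

definition euler_deriv :: "'a::idom poly \<Rightarrow> 'a poly" where
  "euler_deriv p = pCons 0 (pderiv p)"

lemma euler_deriv_altdef: "euler_deriv p = [:0, 1:] * pderiv p"
  by (simp add: euler_deriv_def)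

lemma euler_deriv_mult: "euler_deriv (p * q) = p * euler_deriv q + q * euler_deriv p"
  by (simp add: euler_deriv_altdef pderiv_mult algebra_simps)

lemma euler_deriv_add: "euler_deriv (p + q) = euler_deriv p + euler_deriv q"
  by (simp add: euler_deriv_altdef pderiv_add algebra_simps)

lemma euler_deriv_uminus: "euler_deriv (- p) = - euler_deriv p"
  by (simp add: euler_deriv_altdef pderiv_minus)

lemma degree_euler_deriv_le: "degree (euler_deriv p) \<le> degree p"
  for p :: "'a :: {idom, semiring_char_0} poly"
proof (cases "degree p = 0")
  case True
  then show ?thesis by (simp add: euler_deriv_def pderiv_eq_0_iff[THEN iffD2])
next
  case False
  then show ?thesis
    by (auto simp: euler_deriv_def degree_pCons_eq_if degree_pderiv)
qed

lemma power_pred_dvd_euler_deriv: "p ^ (n - 1) dvd euler_deriv (p ^ n)"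
proof (cases n)
  case (Suc k)
  have "p ^ k dvd [:0, 1:] * (smult (of_nat (Suc k)) (p ^ k) * pderiv p)"
    by (intro dvd_mult dvd_mult2 dvd_smult dvd_refl)
  then show ?thesis
    by (simp only: Suc euler_deriv_altdef pderiv_power_Suc diff_Suc_1)
qed simp

lemma monom_dvd_euler_deriv_mult: "monom 1 e dvd euler_deriv (monom 1 e * p)"
proof -
  have "monom 1 e dvd euler_deriv (monom (1::'a) e)"
    by (simp add: monom_1_dvd_iff' euler_deriv_def coeff_pCons coeff_pderiv split: nat.split)
  then show ?thesis
    by (simp add: euler_deriv_mult)
qed

text \<open>Since \<open>w d/dw\<close> does not raise degrees, the cofactor is a constant.
  Comparing constant terms, where the left side vanishes and \<open>F\<close> does not, makes that
  constant 0, and characteristic 0 finishes.\<close>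

lemma degree_0_if_dvd_euler_deriv:
  fixes F :: "'k::field_char_0 poly"
  assumes "F dvd euler_deriv F" "poly F 0 \<noteq> 0"
  shows "degree F = 0"
proof -
  have nz: "F \<noteq> 0" using assms by auto
  from assms obtain q where q: "euler_deriv F = F * q" by auto
  have "pderiv F = 0"
  proof (rule ccontr)
    assume "pderiv F \<noteq> 0"
    then have qnz: "q \<noteq> 0" using q by (auto simp: euler_deriv_def)
    have "degree F + degree q \<le> degree F"
      using degree_euler_deriv_le[of F] q nz qnz by (metis degree_mult_eq)
    then obtain k where k: "q = [:k:]" by (metis add_le_same_cancel1 degree_0_id le_zero_eq)
    have "coeff (euler_deriv F) 0 = 0" by (simp add: euler_deriv_def)
    then have "k = 0" using q k assms(2) by (simp add: poly_0_coeff_0)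
    with k qnz show False by simp
  qed
  then show ?thesis by (simp add: pderiv_eq_0_iff)
qed

text \<open>Because the sum is 0, the three pairs give the same Wronskian \<open>W\<close>. It is
  divisible by the pairwise coprime \<open>f ^ (a - 1)\<close>, \<open>g ^ (b - 1)\<close>,
  \<open>h ^ (c - 1)\<close> and the monomial factor, while its degree is at most the sum of any two
  of the degrees of \<open>F\<close>, \<open>G\<close>, \<open>H\<close>. With \<open>s\<close> the
  sum of the degrees of \<open>f\<close>, \<open>g\<close>, \<open>h\<close> this yields
  \<open>s \<le> s * (1/a + 1/b + 1/c)\<close>, hence \<open>s = 0\<close>. Hypothesis
  \<open>e\<close> says that at most one of the three summands vanishes at 0.\<close>

lemma mason_coprime:
  fixes f g h F G H :: "'k :: {alg_closed_field, field_char_0, field_gcd} poly"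
  assumes F: "F = monom 1 e1 * f ^ a" and G: "G = monom 1 e2 * g ^ b" and H: "H = monom 1 e3 * h ^ c"
    and sum: "F + G + H = 0"
    and f0: "poly f 0 \<noteq> 0" and g0: "poly g 0 \<noteq> 0" and h0: "poly h 0 \<noteq> 0"
    and e: "(e1 = 0 \<and> e2 = 0) \<or> (e1 = 0 \<and> e3 = 0) \<or> (e2 = 0 \<and> e3 = 0)"
    and cop: "\<And>x. poly F x = 0 \<Longrightarrow> poly G x \<noteq> 0"
    and pos: "a > 0" "b > 0" "c > 0" and lt: "1 / real a + 1 / real b + 1 / real c < 1"
  shows "degree F = 0" "degree G = 0" "degree H = 0"
proof -
  have nz: "f \<noteq> 0" "g \<noteq> 0" "h \<noteq> 0" using f0 g0 h0 by auto
  have nzF: "F \<noteq> 0" "G \<noteq> 0" "H \<noteq> 0" using nz by (simp_all add: F G H monom_eq_0_iff)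
  have H': "H = - (F + G)" using sum by (metis minus_unique)
  have pH: "poly H x = - (poly F x + poly G x)" for x by (simp add: H')
  have cFG: "coprime F G" by (rule coprime_poly_if_no_common_root) (use cop in auto)
  have cGH: "coprime G H"
    by (rule coprime_poly_if_no_common_root) (use cop pH in fastforce)
  have cHF: "coprime H F"
    by (rule coprime_poly_if_no_common_root) (use cop pH in fastforce)
  define W where "W = F * euler_deriv G - G * euler_deriv F"
  have W2: "W = G * euler_deriv H - H * euler_deriv G"
    unfolding W_def H' euler_deriv_add euler_deriv_uminus by (simp add: algebra_simps)
  have W3: "W = H * euler_deriv F - F * euler_deriv H"
    unfolding W_def H' euler_deriv_add euler_deriv_uminus by (simp add: algebra_simps)
  have "degree F = 0 \<and> degree G = 0 \<and> degree H = 0"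
  proof (cases "W = 0")
    case True
    have "F dvd G * euler_deriv F"
      using True unfolding W_def by (metis dvd_triv_left eq_iff_diff_eq_0)
    then have dF: "F dvd euler_deriv F"
      using cFG coprime_dvd_mult_right_iff by blast
    have "G dvd H * euler_deriv G"
      using True unfolding W2 by (metis dvd_triv_left eq_iff_diff_eq_0)
    then have dG: "G dvd euler_deriv G"
      using cGH coprime_dvd_mult_right_iff by blast
    have "H dvd F * euler_deriv H"
      using True unfolding W3 by (metis dvd_triv_left eq_iff_diff_eq_0)
    then have dH: "H dvd euler_deriv H"
      using cHF coprime_dvd_mult_right_iff by blast
    have v: "poly F 0 \<noteq> 0 \<longleftrightarrow> e1 = 0" "poly G 0 \<noteq> 0 \<longleftrightarrow> e2 = 0" "poly H 0 \<noteq> 0 \<longleftrightarrow> e3 = 0"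
      using f0 g0 h0 by (auto simp: F G H poly_monom)
    have hF: "e1 = 0 \<Longrightarrow> degree F = 0" using degree_0_if_dvd_euler_deriv[OF dF] v by blast
    have hG: "e2 = 0 \<Longrightarrow> degree G = 0" using degree_0_if_dvd_euler_deriv[OF dG] v by blast
    have hH: "e3 = 0 \<Longrightarrow> degree H = 0" using degree_0_if_dvd_euler_deriv[OF dH] v by blast
    have sums: "F = - (G + H)" "G = - (F + H)"
      using sum by (simp_all add: H')
    \<comment> \<open>Two of the three polynomials are nonzero at 0, hence constant; the third is
      minus their sum.\<close>
    from e show ?thesis
    proof (elim disjE conjE)
      assume "e1 = 0" "e2 = 0"
      then have "degree F = 0" "degree G = 0" using hF hG by auto
      moreover then have "degree H \<le> 0" unfolding H' degree_minus by (intro degree_add_le) auto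
      ultimately show ?thesis by auto
    next
      assume "e1 = 0" "e3 = 0"
      then have *: "degree F = 0" "degree H = 0" using hF hH by auto
      then have "degree (- (F + H)) \<le> 0" unfolding degree_minus by (intro degree_add_le) auto
      then have "degree G = 0" by (subst sums(2)) simp
      with * show ?thesis by blast
    next
      assume "e2 = 0" "e3 = 0"
      then have *: "degree G = 0" "degree H = 0" using hG hH by auto
      then have "degree (- (G + H)) \<le> 0" unfolding degree_minus by (intro degree_add_le) auto
      then have "degree F = 0" by (subst sums(1)) simp
      with * show ?thesis by blast
    qed
  next
    case False
    have fW: "f ^ (a - 1) dvd W"
    proof -
      have "f ^ (a - 1) dvd f ^ a" by (simp add: le_imp_power_dvd)
      then have "f ^ (a - 1) dvd F" "f ^ (a - 1) dvd euler_deriv F"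
        using power_pred_dvd_euler_deriv[of f a] unfolding F euler_deriv_mult by simp_all
      then show ?thesis unfolding W_def by simp
    qed
    have gW: "g ^ (b - 1) dvd W"
    proof -
      have "g ^ (b - 1) dvd g ^ b" by (simp add: le_imp_power_dvd)
      then have "g ^ (b - 1) dvd G" "g ^ (b - 1) dvd euler_deriv G"
        using power_pred_dvd_euler_deriv[of g b] unfolding G euler_deriv_mult by simp_all
      then show ?thesis unfolding W_def by simp
    qed
    have hW: "h ^ (c - 1) dvd W"
    proof -
      have "h ^ (c - 1) dvd h ^ c" by (simp add: le_imp_power_dvd)
      then have "h ^ (c - 1) dvd H" "h ^ (c - 1) dvd euler_deriv H"
        using power_pred_dvd_euler_deriv[of h c] unfolding H euler_deriv_mult by simp_all
      then show ?thesis unfolding W2 by simp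
    qed
    have "monom 1 e1 dvd W" "monom 1 e2 dvd W" "monom 1 e3 dvd W"
    proof -
      show "monom 1 e1 dvd W"
        using monom_dvd_euler_deriv_mult[of e1 "f ^ a"] unfolding W_def F by simp
      show "monom 1 e2 dvd W"
        using monom_dvd_euler_deriv_mult[of e2 "g ^ b"] unfolding W_def G by simp
      show "monom 1 e3 dvd W"
        using monom_dvd_euler_deriv_mult[of e3 "h ^ c"] unfolding W2 H by simp
    qed
    \<comment> \<open>At most one exponent is nonzero, so this monomial is one of the three just
      treated.\<close>
    then have eW: "monom 1 (e1 + e2 + e3) dvd W" using e by auto
    have rF: "poly f x = 0 \<Longrightarrow> poly F x = 0" for x using pos by (simp add: F)
    have rG: "poly g x = 0 \<Longrightarrow> poly G x = 0" for x using pos by (simp add: G)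
    have rH: "poly h x = 0 \<Longrightarrow> poly H x = 0" for x using pos by (simp add: H)
    have c1: "coprime f g" by (rule coprime_poly_if_no_common_root) (use rF rG cop in blast)
    have c2: "coprime f h"
      by (rule coprime_poly_if_no_common_root) (use rF rH pH cop in fastforce)
    have c3: "coprime g h"
      by (rule coprime_poly_if_no_common_root) (use rG rH pH cop in fastforce)
    have m: "coprime (monom 1 k) p" if "poly p 0 \<noteq> 0" for k and p :: "'k poly"
      by (rule coprime_poly_if_no_common_root) (use that in \<open>auto simp: poly_monom\<close>)
    have cc: "coprime (f ^ (a - 1)) (g ^ (b - 1))" "coprime (f ^ (a - 1)) (h ^ (c - 1))"
      "coprime (g ^ (b - 1)) (h ^ (c - 1))" "coprime (monom 1 (e1 + e2 + e3)) (f ^ (a - 1))"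
      "coprime (monom 1 (e1 + e2 + e3)) (g ^ (b - 1))" "coprime (monom 1 (e1 + e2 + e3)) (h ^ (c - 1))"
      using c1 c2 c3 f0 g0 h0 by (simp_all add: m)
    have "monom 1 (e1 + e2 + e3) * (f ^ (a - 1) * (g ^ (b - 1) * h ^ (c - 1))) dvd W"
      by (intro divides_mult) (use cc fW gW hW eW in auto)
    then have "degree (monom 1 (e1 + e2 + e3) * (f ^ (a - 1) * (g ^ (b - 1) * h ^ (c - 1)))) \<le> degree W"
      using False by (rule dvd_imp_degree_le)
    then have le: "e1 + e2 + e3 + ((a - 1) * degree f + ((b - 1) * degree g + (c - 1) * degree h)) \<le> degree W"
      using nz by (simp add: degree_mult_eq degree_power_eq degree_monom_eq monom_eq_0_iff)
    have dd: "degree (P * euler_deriv Q - Q * euler_deriv P) \<le> degree P + degree Q" for P Q :: "'k poly"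
    proof (rule degree_diff_le)
      show "degree (P * euler_deriv Q) \<le> degree P + degree Q"
        using degree_mult_le[of P "euler_deriv Q"] degree_euler_deriv_le[of Q] by linarith
      show "degree (Q * euler_deriv P) \<le> degree P + degree Q"
        using degree_mult_le[of Q "euler_deriv P"] degree_euler_deriv_le[of P] by linarith
    qed
    have dW: "degree W \<le> degree F + degree G" "degree W \<le> degree G + degree H" "degree W \<le> degree H + degree F"
      using dd[of F G] dd[of G H] dd[of H F] W_def W2 W3 by auto
    have dF: "degree F = e1 + a * degree f" "degree G = e2 + b * degree g" "degree H = e3 + c * degree h"
      using nz by (simp_all add: F G H degree_mult_eq degree_power_eq degree_monom_eq monom_eq_0_iff)
    define s where "s = degree f + degree g + degree h"
    have aa: "(k - 1) * d + d = k * d" if "k > 0" for k d :: nat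
      using that by (cases k) auto
    \<comment> \<open>Take the bound on \<open>degree W\<close> that omits one of \<open>F\<close>,
      \<open>G\<close>, \<open>H\<close>. After cancellation the exponent and the multiple of the
      degree belonging to the omitted polynomial remain on the left, and at most \<open>s\<close> on
      the right.\<close>
    have sb: "degree F \<le> s" "degree G \<le> s" "degree H \<le> s"
      using le dW dF aa[OF pos(1), of "degree f"] aa[OF pos(2), of "degree g"]
        aa[OF pos(3), of "degree h"] unfolding s_def by linarith+
    have "a * degree f \<le> s" "b * degree g \<le> s" "c * degree h \<le> s"
      using sb dF by linarith+
    then have "real (degree f) \<le> real s / a" "real (degree g) \<le> real s / b" "real (degree h) \<le> real s / c"
      using pos by (simp_all add: pos_le_divide_eq mult.commute flip: of_nat_mult)
    moreover have "real s = real (degree f) + real (degree g) + real (degree h)"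
      by (simp add: s_def)
    moreover have "real s * (1 / real a + 1 / real b + 1 / real c) = real s / a + real s / b + real s / c"
      by (simp add: distrib_left)
    ultimately have "real s \<le> real s * (1 / real a + 1 / real b + 1 / real c)"
      by linarith
    then have "s = 0"
      using lt by (metis le_less_trans mult.right_neutral mult_less_cancel_left_pos not_gr0 of_nat_0_less_iff less_irrefl)
    with sb show ?thesis by auto
  qed
  then show "degree F = 0" "degree G = 0" "degree H = 0" by auto
qed

lemma poly_order_0_factor:
  fixes f :: "'k::idom poly"
  assumes "f \<noteq> 0"
  obtains i f1 where "f = monom 1 i * f1" "poly f1 0 \<noteq> 0"
  using order_decomp[OF assms, of 0] by (auto simp: monom_altdef poly_eq_0_iff_dvd)

text \<open>The powers of \<open>w\<close> are split off from \<open>f\<close>, \<open>g\<close>,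
  \<open>h\<close>, and the smallest resulting power from the equation. The rest has no common zero:
  away from 0 by \<open>root\<close>, at 0 because one exponent has become 0. The coprime case then
  leaves only constants, and the three exponents in the equation agree.\<close>

theorem mason_monomials:
  fixes f g h :: "'k :: {alg_closed_field, field_char_0, field_gcd} poly"
  assumes nz: "f \<noteq> 0" "g \<noteq> 0" "h \<noteq> 0"
    and sum: "f ^ a + g ^ b + h ^ c = 0"
    and root: "\<And>x. poly f x = 0 \<Longrightarrow> poly g x = 0 \<Longrightarrow> poly h x = 0 \<Longrightarrow> x = 0"
    and pos: "a > 0" "b > 0" "c > 0" and lt: "1 / real a + 1 / real b + 1 / real c < 1"
  obtains i j k \<alpha> \<beta> \<gamma> where "f = monom \<alpha> i" "g = monom \<beta> j" "h = monom \<gamma> k"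
    "a * i = b * j" "a * i = c * k"
proof -
  obtain i f1 where f: "f = monom 1 i * f1" and f0: "poly f1 0 \<noteq> 0"
    using poly_order_0_factor[OF nz(1)] .
  obtain j g1 where g: "g = monom 1 j * g1" and g0: "poly g1 0 \<noteq> 0"
    using poly_order_0_factor[OF nz(2)] .
  obtain k h1 where h: "h = monom 1 k * h1" and h0: "poly h1 0 \<noteq> 0"
    using poly_order_0_factor[OF nz(3)] .
  define N where "N = min (a * i) (min (b * j) (c * k))"
  define e1 e2 e3 where "e1 = a * i - N" and "e2 = b * j - N" and "e3 = c * k - N"
  have N: "a * i = N + e1" "b * j = N + e2" "c * k = N + e3"
    unfolding N_def e1_def e2_def e3_def by auto
  have e0: "e1 = 0 \<or> e2 = 0 \<or> e3 = 0" unfolding e1_def e2_def e3_def N_def by auto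
  define F G H where "F = monom 1 e1 * f1 ^ a" and "G = monom 1 e2 * g1 ^ b" and "H = monom 1 e3 * h1 ^ c"
  have mm: "monom (1::'k) (p + q) = monom 1 p * monom 1 q" for p q by (simp add: mult_monom)
  have fF: "f ^ a = monom 1 N * F" "g ^ b = monom 1 N * G" "h ^ c = monom 1 N * H"
    using N by (simp_all add: f g h F_def G_def H_def power_mult_distrib monom_power mult.commute mm)
  have "monom 1 N * (F + G + H) = 0" using sum fF by (simp add: distrib_left)
  then have s: "F + G + H = 0" by (simp add: monom_eq_0_iff)
  then have ps: "poly F x + poly G x + poly H x = 0" for x
    by (metis poly_0 poly_add)
  have v: "poly F 0 = 0 \<longleftrightarrow> e1 > 0" "poly G 0 = 0 \<longleftrightarrow> e2 > 0" "poly H 0 = 0 \<longleftrightarrow> e3 > 0"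
    using f0 g0 h0 by (auto simp: F_def G_def H_def poly_monom)
  \<comment> \<open>If exactly one summand were nonzero at 0, the sum could not vanish
    there.\<close>
  have e: "(e1 = 0 \<and> e2 = 0) \<or> (e1 = 0 \<and> e3 = 0) \<or> (e2 = 0 \<and> e3 = 0)"
    using v e0 ps[of 0] by (metis add_0 add_0_right not_gr0)
  have r: "poly F x = 0 \<Longrightarrow> x \<noteq> 0 \<Longrightarrow> poly f x = 0" "poly G x = 0 \<Longrightarrow> x \<noteq> 0 \<Longrightarrow> poly g x = 0"
    "poly H x = 0 \<Longrightarrow> x \<noteq> 0 \<Longrightarrow> poly h x = 0" for x
    using pos by (auto simp: F_def G_def H_def f g h poly_monom)
  have cop: "poly G x \<noteq> 0" if "poly F x = 0" for x
  proof
    assume G0: "poly G x = 0"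
    then have H0: "poly H x = 0" using ps[of x] that by simp
    show False
    proof (cases "x = 0")
      case True
      with that G0 H0 v e0 show False by auto
    next
      case False
      with r that G0 H0 root show False by blast
    qed
  qed
  have d: "degree F = 0" "degree G = 0" "degree H = 0"
    using mason_coprime[OF F_def G_def H_def s f0 g0 h0 e cop pos lt] by auto
  have nz1: "f1 \<noteq> 0" "g1 \<noteq> 0" "h1 \<noteq> 0" using f0 g0 h0 by auto
  have "e1 + a * degree f1 = 0" "e2 + b * degree g1 = 0" "e3 + c * degree h1 = 0"
    using d nz1 by (simp_all add: F_def G_def H_def degree_mult_eq degree_power_eq degree_monom_eq monom_eq_0_iff)
  then have z: "e1 = 0" "e2 = 0" "e3 = 0" "degree f1 = 0" "degree g1 = 0" "degree h1 = 0"
    using pos by auto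
  then obtain \<alpha> \<beta> \<gamma> where "f1 = [:\<alpha>:]" "g1 = [:\<beta>:]" "h1 = [:\<gamma>:]"
    by (meson degree_eq_zeroE)
  then have "f = monom \<alpha> i" "g = monom \<beta> j" "h = monom \<gamma> k"
    by (simp_all add: f g h smult_monom)
  with N z show thesis by (intro that) auto
qed

subsection \<open>Presenting the quotient rings by a type class polynomial ring\<close>

lemma ring_of_type_algebra_simps [simp]:
  "carrier ring_of_type_algebra = UNIV"
  "x \<otimes>\<^bsub>ring_of_type_algebra\<^esub> y = x * y"
  "x \<oplus>\<^bsub>ring_of_type_algebra\<^esub> y = x + y"
  "\<one>\<^bsub>ring_of_type_algebra\<^esub> = 1"
  "\<zero>\<^bsub>ring_of_type_algebra\<^esub> = 0"
  by (simp_all add: ring_of_type_algebra_def)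

text \<open>Elements of the record-based quotient rings are written as images of type-class
  polynomials along such maps, so that calculations in the quotients become ordinary polynomial
  arithmetic.\<close>

locale type_ring_hom = cring S for S :: "('b, 'm) ring_scheme" (structure) +
  fixes \<kappa> :: "'a::comm_ring_1 \<Rightarrow> 'b"
  assumes hom: "\<kappa> \<in> ring_hom ring_of_type_algebra S"
begin

lemma closed [simp, intro]: "\<kappa> x \<in> carrier S"
  using ring_hom_closed[OF hom, of x] by simp

lemma hom_mult: "\<kappa> (x * y) = \<kappa> x \<otimes> \<kappa> y"
  using ring_hom_mult[OF hom, of x y] by simp

lemma hom_add: "\<kappa> (x + y) = \<kappa> x \<oplus> \<kappa> y"
  using ring_hom_add[OF hom, of x y] by simp

lemma hom_one: "\<kappa> 1 = \<one>"
  using ring_hom_one[OF hom] by simp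

lemma hom_zero: "\<kappa> 0 = \<zero>"
proof -
  have "\<kappa> 0 \<oplus> \<kappa> 0 = \<kappa> 0" using hom_add[of 0 0] by simp
  then show ?thesis by (metis closed add.r_cancel_one)
qed

lemma hom_uminus: "\<kappa> (- x) = \<ominus> \<kappa> x"
proof -
  have "\<kappa> (- x) \<oplus> \<kappa> x = \<zero>" using hom_add[of "- x" x] by (simp add: hom_zero)
  then show ?thesis by (metis closed minus_equality)
qed

lemma hom_diff: "\<kappa> (x - y) = \<kappa> x \<ominus> \<kappa> y"
  using hom_add[of x "- y"] by (simp add: hom_uminus a_minus_def)

lemma hom_power: "\<kappa> (x ^ n) = \<kappa> x [^] n"
proof (induction n)
  case 0
  then show ?case by (simp add: hom_one)
next
  case (Suc n)
  have "\<kappa> (x ^ Suc n) = \<kappa> (x ^ n * x)" by (simp add: mult.commute)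
  then show ?case by (simp add: hom_mult Suc)
qed

lemma hom_sum: "finite A \<Longrightarrow> \<kappa> (\<Sum>i\<in>A. f i) = (\<Oplus>i\<in>A. \<kappa> (f i))"
  by (induction A rule: finite_induct) (simp_all add: hom_zero hom_add)

lemma hom_eq_iff: "\<kappa> x = \<kappa> y \<longleftrightarrow> \<kappa> (x - y) = \<zero>"
  by (metis a_minus_def closed hom_diff r_right_minus_eq)

end

definition up_map :: "('a::comm_ring_1 \<Rightarrow> 'b) \<Rightarrow> 'a poly \<Rightarrow> nat \<Rightarrow> 'b" where
  "up_map \<kappa> p = (\<lambda>i. \<kappa> (Polynomial.coeff p i))"

context type_ring_hom
begin

lemma up_map_closed: "up_map \<kappa> p \<in> up S"
  unfolding up_map_def
proof (rule mem_upI)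
  show "\<exists>n. bound \<zero> n (\<lambda>i. \<kappa> (Polynomial.coeff p i))"
    by (intro exI[of _ "Polynomial.degree p"] bound.intro) (simp add: coeff_eq_0 hom_zero)
qed simp

lemma up_map_hom: "type_ring_hom (UP S) (up_map \<kappa>)"
proof -
  interpret U: UP_cring S "UP S" by unfold_locales simp
  have one: "up_map \<kappa> 1 = \<one>\<^bsub>UP S\<^esub>"
    by (auto simp: up_map_def UP_def hom_one hom_zero fun_eq_iff)
  have mult: "up_map \<kappa> (p * q) = up_map \<kappa> p \<otimes>\<^bsub>UP S\<^esub> up_map \<kappa> q" for p q
  proof -
    have "\<kappa> (Polynomial.coeff (p * q) n) =
      (\<Oplus>i\<in>{..n}. \<kappa> (Polynomial.coeff p i) \<otimes> \<kappa> (Polynomial.coeff q (n - i)))" for n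
      unfolding Polynomial.coeff_mult hom_sum[OF finite_atMost] hom_mult ..
    moreover have "up_map \<kappa> p \<otimes>\<^bsub>UP S\<^esub> up_map \<kappa> q =
      (\<lambda>n. \<Oplus>i\<in>{..n}. up_map \<kappa> p i \<otimes> up_map \<kappa> q (n - i))"
      by (simp only: UP_def monoid.simps restrict_apply' up_map_closed if_True)
    ultimately show ?thesis
      by (simp only: up_map_def)
  qed
  have add: "up_map \<kappa> (p + q) = up_map \<kappa> p \<oplus>\<^bsub>UP S\<^esub> up_map \<kappa> q" for p q
    by (simp only: UP_def ring.simps restrict_apply' up_map_closed if_True) (simp add: up_map_def hom_add)
  have "up_map \<kappa> \<in> ring_hom ring_of_type_algebra (UP S)"
    by (rule ring_hom_memI) (use up_map_closed one mult add in \<open>auto simp: UP_def\<close>)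
  then show ?thesis
    by (intro type_ring_hom.intro type_ring_hom_axioms.intro U.UP_cring)
qed

lemma up_map_surj:
  assumes "range \<kappa> = carrier S"
  shows "range (up_map \<kappa>) = carrier (UP S)"
proof
  show "range (up_map \<kappa>) \<subseteq> carrier (UP S)"
    using up_map_closed by (auto simp: UP_def)
  show "carrier (UP S) \<subseteq> range (up_map \<kappa>)"
  proof
    fix f assume "f \<in> carrier (UP S)"
    then have f: "f \<in> up S" by (simp add: UP_def)
    then obtain N where N: "bound \<zero> N f" by blast
    have "\<exists>x. \<kappa> x = f i" for i
      using mem_upD[OF f, of i] assms by (metis rangeE)
    then obtain g where g: "\<kappa> (g i) = f i" for i by metis
    define p where "p = Poly (map g [0..<Suc N])"
    have "\<kappa> (Polynomial.coeff p i) = f i" for i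
    proof (cases "i \<le> N")
      case True
      then have "Polynomial.coeff p i = g i"
        unfolding p_def coeff_Poly_eq nth_default_def by (simp del: upt_Suc)
      then show ?thesis by (simp add: g)
    next
      case False
      then have "Polynomial.coeff p i = 0"
        unfolding p_def coeff_Poly_eq nth_default_def by (simp del: upt_Suc)
      then show ?thesis using bound.bound[OF N, of i] False by (simp add: hom_zero)
    qed
    then have "up_map \<kappa> p = f" by (simp add: up_map_def)
    then show "f \<in> range (up_map \<kappa>)" by blast
  qed
qed

lemma up_map_const: "up_map \<kappa> [:x:] = up_ring.monom (UP S) (\<kappa> x) 0"
  by (auto simp: up_map_def UP_def fun_eq_iff hom_zero Polynomial.coeff_pCons split: nat.split)

lemma up_map_var: "up_map \<kappa> [:0, 1:] = up_ring.monom (UP S) \<one> 1"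
  by (auto simp: up_map_def UP_def fun_eq_iff hom_zero hom_one Polynomial.coeff_pCons split: nat.split)

lemma up_map_eq_zero_iff: "up_map \<kappa> p = \<zero>\<^bsub>UP S\<^esub> \<longleftrightarrow> (\<forall>i. \<kappa> (Polynomial.coeff p i) = \<zero>)"
  by (auto simp: up_map_def UP_def fun_eq_iff)

text \<open>As \<kappa> need not be injective, the kernel criterion only asks that \<kappa> kill
  \<open>x - q * e'\<close>. For \<open>B\<close> the map \<kappa> already reduces coefficients
  modulo \<open>pham\<close>, which is why divisibility of coefficients appears in
  \<open>liftB_eq_zero_iff\<close>.\<close>

lemma quotient_hom:
  assumes surj: "range \<kappa> = carrier S" and e: "e = \<kappa> e'"
  shows "type_ring_hom (S Quot (PIdl e)) (\<lambda>x. PIdl e +> \<kappa> x)"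
    and "range (\<lambda>x. PIdl e +> \<kappa> x) = carrier (S Quot (PIdl e))"
    and "PIdl e +> \<kappa> x = \<zero>\<^bsub>S Quot (PIdl e)\<^esub> \<longleftrightarrow> (\<exists>q. \<kappa> (x - q * e') = \<zero>)"
proof -
  interpret I: ideal "PIdl e" S
    using e by (simp add: cgenideal_ideal)
  interpret Q: cring "S Quot (PIdl e)"
    using I.quotient_is_cring cring_axioms by blast
  have "(+>) (PIdl e) \<in> ring_hom S (S Quot (PIdl e))" by (rule I.rcos_ring_hom)
  then have "(+>) (PIdl e) \<circ> \<kappa> \<in> ring_hom ring_of_type_algebra (S Quot (PIdl e))"
    using hom by (rule ring_hom_trans[rotated])
  then show h: "type_ring_hom (S Quot (PIdl e)) (\<lambda>x. PIdl e +> \<kappa> x)"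
    by (intro type_ring_hom.intro type_ring_hom_axioms.intro Q.cring_axioms) (simp add: o_def)
  show "range (\<lambda>x. PIdl e +> \<kappa> x) = carrier (S Quot (PIdl e))"
  proof -
    have "range (\<lambda>x. PIdl e +> \<kappa> x) = (\<lambda>y. PIdl e +> y) ` carrier S"
      using surj by (metis image_image)
    also have "\<dots> = carrier (S Quot (PIdl e))"
      by (auto simp: FactRing_def A_RCOSETS_def')
    finally show ?thesis .
  qed
  have "PIdl e +> \<kappa> x = \<zero>\<^bsub>S Quot (PIdl e)\<^esub> \<longleftrightarrow> PIdl e +> \<kappa> x = PIdl e"
    by (simp add: FactRing_def)
  also have "\<dots> \<longleftrightarrow> \<kappa> x \<in> PIdl e"
    using I.a_rcos_const I.a_rcos_self by auto
  also have "\<dots> \<longleftrightarrow> (\<exists>y\<in>carrier S. \<kappa> x = y \<otimes> e)"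
    unfolding cgenideal_def by blast
  also have "\<dots> \<longleftrightarrow> (\<exists>q. \<kappa> x = \<kappa> q \<otimes> e)"
    unfolding surj[symmetric] by blast
  also have "\<dots> \<longleftrightarrow> (\<exists>q. \<kappa> x = \<kappa> (q * e'))"
    by (simp add: e hom_mult)
  finally show "PIdl e +> \<kappa> x = \<zero>\<^bsub>S Quot (PIdl e)\<^esub> \<longleftrightarrow> (\<exists>q. \<kappa> (x - q * e') = \<zero>)"
    by (simp only: hom_eq_iff)
qed

end

section \<open>Polynomial representatives for the elements of \<open>R\<close> and
  \<open>B\<close>\<close>

type_synonym cpoly5 = "cpoly3 poly poly"

text \<open>The Pham-Brieskorn polynomial.\<close>

definition pham :: "nat \<Rightarrow> nat \<Rightarrow> nat \<Rightarrow> cpoly3" where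
  "pham a b c = polyX ^ a + polyY ^ b + polyZ ^ c"

text \<open>The outer variable of \<open>cpoly5\<close> is \<open>V\<close> and the next one is
  \<open>U\<close>, matching the nesting \<open>R[U][V]\<close>.\<close>

definition danielewski :: "nat \<Rightarrow> nat \<Rightarrow> cpoly5" where
  "danielewski m n = [:[:polyX ^ m:]:] * [:[:0, 1:]:] - [:[:polyY ^ n:]:] * [:0, 1:] - 1"

definition liftB :: "nat \<Rightarrow> nat \<Rightarrow> nat \<Rightarrow> nat \<Rightarrow> nat \<Rightarrow> cpoly5 \<Rightarrow> cpoly3 set poly2 set" where
  "liftB a b c m n p = classB a b c m n (up_map (up_map (classR a b c)) p)"

lemma ringR_hom: "type_ring_hom (ringR a b c) (classR a b c)"
  and classR_surj: "range (classR a b c) = carrier (ringR a b c)"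
  and classR_eq_zero_iff: "classR a b c p = \<zero>\<^bsub>ringR a b c\<^esub> \<longleftrightarrow> pham a b c dvd p"
proof -
  interpret I: type_ring_hom polyXYZ "\<lambda>x. x"
    unfolding polyXYZ_def
    by (intro type_ring_hom.intro cring_from_type_algebra type_ring_hom_axioms.intro ring_hom_memI) auto
  have "range (\<lambda>x. x) = carrier polyXYZ" by (simp add: polyXYZ_def)
  note q = I.quotient_hom[OF this refl, of "pham a b c"]
  show "type_ring_hom (ringR a b c) (classR a b c)" "range (classR a b c) = carrier (ringR a b c)"
    using q(1,2) unfolding classR_def[abs_def] ringR_def relR_def pham_def .
  have "classR a b c p = \<zero>\<^bsub>ringR a b c\<^esub> \<longleftrightarrow> (\<exists>q. p - q * pham a b c = 0)"
    using q(3)[of p] unfolding classR_def[abs_def] ringR_def relR_def pham_def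
    by (simp add: polyXYZ_def)
  also have "\<dots> \<longleftrightarrow> pham a b c dvd p"
    by (auto simp: dvd_def mult.commute)
  finally show "classR a b c p = \<zero>\<^bsub>ringR a b c\<^esub> \<longleftrightarrow> pham a b c dvd p" .
qed

context
  fixes a b c m n :: nat
begin

interpretation R: type_ring_hom "ringR a b c" "classR a b c"
  by (rule ringR_hom)

interpretation U: type_ring_hom "UP (ringR a b c)" "up_map (classR a b c)"
  by (rule R.up_map_hom)

interpretation P: type_ring_hom "polyUV (ringR a b c)" "up_map (up_map (classR a b c))"
  unfolding polyUV_def by (rule U.up_map_hom)

lemma up_map_constUV: "up_map (up_map (classR a b c)) [:[:p:]:] = constUV (ringR a b c) (classR a b c p)"
  by (simp add: constUV_def U.up_map_const R.up_map_const)

lemma up_map_varU: "up_map (up_map (classR a b c)) [:[:0, 1:]:] = varU (ringR a b c)"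
  unfolding varU_def U.up_map_const R.up_map_var ..

lemma up_map_varV: "up_map (up_map (classR a b c)) [:0, 1:] = varV (ringR a b c)"
  unfolding varV_def U.up_map_var ..

lemma relB_altdef:
  "relB a b c m n = PIdl\<^bsub>polyUV (ringR a b c)\<^esub> (up_map (up_map (classR a b c)) (danielewski m n))"
  by (simp add: relB_def Let_def danielewski_def P.hom_diff P.hom_mult P.hom_one
      up_map_constUV up_map_varU up_map_varV del: mult_pCons_left mult_pCons_right)

lemma ringB_hom: "type_ring_hom (ringB a b c m n) (liftB a b c m n)"
  and liftB_surj: "range (liftB a b c m n) = carrier (ringB a b c m n)"
  and liftB_eq_zero_iff: "liftB a b c m n p = \<zero>\<^bsub>ringB a b c m n\<^esub> \<longleftrightarrow>
    (\<exists>q. \<forall>i j. pham a b c dvd Polynomial.coeff (Polynomial.coeff (p - q * danielewski m n) i) j)"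
proof -
  have "range (up_map (up_map (classR a b c))) = carrier (polyUV (ringR a b c))"
    unfolding polyUV_def by (intro U.up_map_surj R.up_map_surj classR_surj)
  note q = P.quotient_hom[OF this refl, of "danielewski m n"]
  show "type_ring_hom (ringB a b c m n) (liftB a b c m n)"
    "range (liftB a b c m n) = carrier (ringB a b c m n)"
    using q(1,2) unfolding liftB_def[abs_def] classB_def ringB_def relB_altdef .
  have "liftB a b c m n p = \<zero>\<^bsub>ringB a b c m n\<^esub> \<longleftrightarrow>
     (\<exists>q. up_map (up_map (classR a b c)) (p - q * danielewski m n) = \<zero>\<^bsub>polyUV (ringR a b c)\<^esub>)"
    using q(3)[of p] unfolding liftB_def[abs_def] classB_def ringB_def relB_altdef .
  then show "liftB a b c m n p = \<zero>\<^bsub>ringB a b c m n\<^esub> \<longleftrightarrow>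
    (\<exists>q. \<forall>i j. pham a b c dvd Polynomial.coeff (Polynomial.coeff (p - q * danielewski m n) i) j)"
    unfolding polyUV_def U.up_map_eq_zero_iff R.up_map_eq_zero_iff classR_eq_zero_iff .
qed

lemma inclR_classR: "inclR a b c m n (classR a b c p) = liftB a b c m n [:[:p:]:]"
  unfolding inclR_def liftB_def up_map_constUV ..

lemma inclC_liftB: "inclC a b c m n k = liftB a b c m n [:[:polyC k:]:]"
  unfolding inclC_def inclR_classR ..

lemma elt_liftB:
  "elt_x a b c m n = liftB a b c m n [:[:polyX:]:]"
  "elt_y a b c m n = liftB a b c m n [:[:polyY:]:]"
  "elt_u a b c m n = liftB a b c m n [:[:0, 1:]:]"
  "elt_v a b c m n = liftB a b c m n [:0, 1:]"
  unfolding elt_x_def elt_y_def elt_u_def elt_v_def inclR_classR liftB_def up_map_varU up_map_varV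
  by (rule refl)+

end

subsection \<open>Ring maps and evaluation of polynomials\<close>

locale ring_map =
  fixes f :: "'a::comm_ring_1 \<Rightarrow> 'b::comm_ring_1"
  assumes one [simp]: "f 1 = 1" and add: "f (x + y) = f x + f y" and mult: "f (x * y) = f x * f y"
begin

lemma zero [simp]: "f 0 = 0"
  using add[of 0 0] by simp

lemma uminus: "f (- x) = - f x"
  using add[of "- x" x] by (simp add: eq_neg_iff_add_eq_0)

lemma diff: "f (x - y) = f x - f y"
  using add[of x "- y"] by (simp add: uminus)

lemma power: "f (x ^ k) = f x ^ k"
  by (induction k) (simp_all add: mult)

lemma sum: "f (sum g A) = (\<Sum>i\<in>A. f (g i))"
  by (induction A rule: infinite_finite_induct) (simp_all add: add)

lemma map_poly_pCons [simp]: "map_poly f (pCons x p) = pCons (f x) (map_poly f p)"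
  by (rule map_poly_pCons) simp

lemma coeff_map_poly [simp]: "Polynomial.coeff (map_poly f p) i = f (Polynomial.coeff p i)"
  by (rule coeff_map_poly) simp

lemma map_poly_add: "map_poly f (p + q) = map_poly f p + map_poly f q"
  by (rule poly_eqI) (simp add: add)

lemma map_poly_smult: "map_poly f (Polynomial.smult k p) = Polynomial.smult (f k) (map_poly f p)"
  by (rule poly_eqI) (simp add: mult)

lemma ring_map_map_poly: "ring_map (map_poly f)"
proof
  show "map_poly f 1 = 1"
    by (rule poly_eqI) (simp add: Polynomial.coeff_1)
  show "map_poly f (p + q) = map_poly f p + map_poly f q" for p q
    by (rule map_poly_add)
  show "map_poly f (p * q) = map_poly f p * map_poly f q" for p q
    by (induction p) (simp_all add: map_poly_add map_poly_smult)
qed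

end

lemma ring_map_comp: "ring_map f \<Longrightarrow> ring_map g \<Longrightarrow> ring_map (\<lambda>x. f (g x))"
  by (simp add: ring_map_def)

lemma ring_map_poly: "ring_map (\<lambda>p. poly p x)"
  by standard auto

lemma ring_map_const: "ring_map (\<lambda>x. [:x:])"
  by standard auto

text \<open>The universal property of a polynomial ring: the ring map given by \<open>f\<close> on
  coefficients and by \<open>x\<close> on the variable. Iterating it defines maps out of several
  variables.\<close>

definition evp :: "('a::comm_ring_1 \<Rightarrow> 'b::comm_ring_1) \<Rightarrow> 'b \<Rightarrow> 'a poly \<Rightarrow> 'b" where
  "evp f x p = poly (map_poly f p) x"

lemma ring_map_evp: "ring_map f \<Longrightarrow> ring_map (evp f x)"
  unfolding evp_def[abs_def] by (intro ring_map_comp[OF ring_map_poly] ring_map.ring_map_map_poly)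

lemma evp_pCons: "ring_map f \<Longrightarrow> evp f x (pCons k p) = f k + x * evp f x p"
  by (simp add: evp_def ring_map.map_poly_pCons)

lemma evp_0 [simp]: "evp f x 0 = 0"
  by (simp add: evp_def)

lemma evp_const: "ring_map f \<Longrightarrow> evp f x [:k:] = f k"
  by (simp add: evp_pCons)

lemma evp_var: "ring_map f \<Longrightarrow> evp f x [:0, 1:] = x"
  by (simp add: evp_pCons ring_map.zero ring_map.one)

lemma evp_monom: "ring_map f \<Longrightarrow> evp f x (Polynomial.monom k i) = f k * x ^ i"
  by (simp add: evp_def map_poly_monom ring_map.zero poly_monom)

lemma evp_sum:
  assumes "ring_map f" "Polynomial.degree p \<le> N"
  shows "evp f x p = (\<Sum>i\<le>N. f (Polynomial.coeff p i) * x ^ i)"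
proof -
  have "evp f x p = evp f x (\<Sum>i\<le>N. Polynomial.monom (Polynomial.coeff p i) i)"
    using poly_as_sum_of_monoms'[OF assms(2)] by simp
  then show ?thesis
    by (simp add: ring_map.sum[OF ring_map_evp[OF assms(1)]] evp_monom[OF assms(1)])
qed

lemma evp_closed:
  assumes f: "ring_map f" and "\<And>k. Q (f k)" "Q x"
    and "\<And>g h. Q g \<Longrightarrow> Q h \<Longrightarrow> Q (g + h)" "\<And>g h. Q g \<Longrightarrow> Q h \<Longrightarrow> Q (g * h)"
  shows "Q (evp f x p)"
proof (induction p)
  case 0
  show ?case using assms(2)[of 0] by (simp add: ring_map.zero[OF f])
next
  case (pCons k p)
  then show ?case using assms by (simp add: evp_pCons)
qed

text \<open>Cofactors chosen separately for each coefficient are assembled into one polynomial. The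
  equation is kept under \<open>f\<close> because \<open>f\<close> may have a kernel.\<close>

lemma map_poly_eq_smult:
  assumes f: "ring_map f" and "\<And>i. \<exists>q. f (Polynomial.coeff g i) = f (k * q)"
  shows "\<exists>g'. map_poly f g = map_poly f (Polynomial.smult k g')"
  using assms(2)
proof (induction g)
  case 0
  show ?case by (intro exI[of _ 0]) simp
next
  case (pCons x g)
  have "\<exists>q. f (Polynomial.coeff g i) = f (k * q)" for i
    using pCons.prems[of "Suc i"] by simp
  then obtain g' where g': "map_poly f g = map_poly f (Polynomial.smult k g')"
    using pCons.IH by blast
  obtain q where "f x = f (k * q)" using pCons.prems[of 0] by auto
  then have "map_poly f (pCons x g) = map_poly f (Polynomial.smult k (pCons q g'))"
    using g' by (simp add: ring_map.map_poly_pCons[OF f])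
  then show ?case by blast
qed

subsection \<open>A model of \<open>R\<close> inside \<open>K[w]\<close>\<close>

text \<open>Here \<kappa> embeds the complex numbers into \<open>K\<close>, \<open>transc\<close>
  says that \<open>s\<close> is transcendental over their image, and \<open>z0\<close> is the
  \<zeta> of the overview. Keeping \<open>K\<close> abstract leaves its construction to the very
  end.\<close>

locale pham_model =
  fixes a b c m n :: nat and \<kappa> :: "complex \<Rightarrow> 'k::{alg_closed_field, field_char_0, field_gcd}"
    and s z0 :: 'k
  assumes a2: "a \<ge> 2" and b2: "b \<ge> 2" and c2: "c \<ge> 2"
    and cop: "coprime a b" "coprime a c" "coprime b c"
    and lt1: "1 / real a + 1 / real b + 1 / real c < 1"
    and m0: "m > 0" and n0: "n > 0"
    and \<kappa>: "ring_map \<kappa>"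
    and transc: "evp \<kappa> s p = 0 \<Longrightarrow> p = 0"
    and z0: "s ^ a + 1 + z0 ^ c = 0"
begin

sublocale \<kappa>: ring_map \<kappa> by (rule \<kappa>)

definition x :: "'k poly" where "x = Polynomial.monom s (b * c)"
definition y :: "'k poly" where "y = Polynomial.monom 1 (a * c)"
definition z :: "'k poly" where "z = Polynomial.monom z0 (a * b)"

definition con :: "complex \<Rightarrow> 'k poly" where "con k = [:\<kappa> k:]"

definition \<psi> :: "cpoly3 \<Rightarrow> 'k poly" where "\<psi> = evp (evp (evp con x) y) z"

lemma con: "ring_map con"
  unfolding con_def[abs_def] by (rule ring_map_comp[OF ring_map_const \<kappa>])

sublocale con: ring_map con by (rule con)

lemma psi1: "ring_map (evp con x)" and psi2: "ring_map (evp (evp con x) y)"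
  by (intro ring_map_evp con)+

lemma psi: "ring_map \<psi>"
  unfolding \<psi>_def by (intro ring_map_evp con)

sublocale \<psi>: ring_map \<psi> by (rule psi)

lemma psi_gens [simp]: "\<psi> polyX = x" "\<psi> polyY = y" "\<psi> polyZ = z" "\<psi> (polyC k) = con k"
  by (simp_all add: \<psi>_def polyX_def polyY_def polyZ_def polyC_def evp_var[OF con] evp_const[OF con]
      evp_var[OF psi1] evp_const[OF psi1] evp_var[OF psi2] evp_const[OF psi2])

lemma psi_induct:
  assumes "\<And>k. Q (con k)" "Q x" "Q y" "Q z"
    and "\<And>g h. Q g \<Longrightarrow> Q h \<Longrightarrow> Q (g + h)" "\<And>g h. Q g \<Longrightarrow> Q h \<Longrightarrow> Q (g * h)"
  shows "Q (\<psi> p)"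
  unfolding \<psi>_def
  by (rule evp_closed[OF psi2], rule evp_closed[OF psi1], rule evp_closed[OF con])
    (use assms in auto)

lemma s_nz: "s \<noteq> 0"
proof
  assume "s = 0"
  then have "evp \<kappa> s [:0, 1:] = 0" by (simp add: evp_var[OF \<kappa>])
  then show False using transc by fastforce
qed

lemma z0_nz: "z0 \<noteq> 0"
proof
  assume "z0 = 0"
  then have "s ^ a + 1 = 0" using z0 c2 by (simp add: zero_power)
  then have "evp \<kappa> s (Polynomial.monom 1 a + 1) = 0"
    by (simp add: ring_map.add[OF ring_map_evp[OF \<kappa>]] ring_map.one[OF ring_map_evp[OF \<kappa>]] evp_monom[OF \<kappa>])
  then have "Polynomial.monom 1 a + 1 = (0::complex poly)" by (rule transc)
  then have "Polynomial.coeff (Polynomial.monom 1 a + 1) a = (0::complex)" by simp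
  then show False using a2 by (simp add: Polynomial.coeff_1)
qed

lemma x_nz: "x \<noteq> 0" and y_nz: "y \<noteq> 0" and z_nz: "z \<noteq> 0"
  using s_nz z0_nz by (simp_all add: x_def y_def z_def monom_eq_0_iff)

lemma xyz_relation: "x ^ a + y ^ b + z ^ c = 0"
proof -
  have "x ^ a + y ^ b + z ^ c = Polynomial.monom (s ^ a + 1 + z0 ^ c) (a * b * c)"
    by (simp add: x_def y_def z_def monom_power add_monom mult_ac)
  then show ?thesis by (simp add: z0)
qed

lemma psi_pham: "\<psi> (pham a b c) = 0"
  by (simp add: pham_def \<psi>.add \<psi>.power xyz_relation)

abbreviation cf :: "cpoly3 \<Rightarrow> nat \<Rightarrow> nat \<Rightarrow> nat \<Rightarrow> complex" where
  "cf p i j k \<equiv> Polynomial.coeff (Polynomial.coeff (Polynomial.coeff p k) j) i"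

text \<open>The power of \<open>w\<close> carried by the image of the monomial with exponents
  \<open>i\<close>, \<open>j\<close>, \<open>k\<close> in \<open>X\<close>, \<open>Y\<close>,
  \<open>Z\<close>.\<close>

definition wt :: "nat \<Rightarrow> nat \<Rightarrow> nat \<Rightarrow> nat" where
  "wt i j k = i * (b * c) + j * (a * c) + k * (a * b)"

lemma psi_sum:
  assumes "Polynomial.degree p \<le> N" "\<And>k. Polynomial.degree (Polynomial.coeff p k) \<le> N"
    "\<And>k j. Polynomial.degree (Polynomial.coeff (Polynomial.coeff p k) j) \<le> N"
  shows "\<psi> p = (\<Sum>k\<le>N. \<Sum>j\<le>N. \<Sum>i\<le>N. Polynomial.monom (\<kappa> (cf p i j k) * s ^ i * z0 ^ k) (wt i j k))"
proof -
  have *: "con k * x ^ i' * y ^ j' * z ^ k' = Polynomial.monom (\<kappa> k * s ^ i' * z0 ^ k') (wt i' j' k')" for k i' j' k'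
    unfolding x_def y_def z_def monom_power con_def
    by (simp add: mult_monom smult_monom wt_def mult_ac add_ac)
  show ?thesis
    unfolding \<psi>_def evp_sum[OF psi2 assms(1)] evp_sum[OF psi1 assms(2)] evp_sum[OF con assms(3)]
      sum_distrib_right * ..
qed

lemma degree_bound:
  fixes p :: cpoly3
  shows "\<exists>N. Polynomial.degree p \<le> N \<and> (\<forall>k. Polynomial.degree (Polynomial.coeff p k) \<le> N) \<and>
    (\<forall>k j. Polynomial.degree (Polynomial.coeff (Polynomial.coeff p k) j) \<le> N)"
proof -
  have fin: "finite (range (Polynomial.coeff q))" for q :: "'d::zero poly"
  proof -
    have "range (Polynomial.coeff q) \<subseteq> insert 0 (Polynomial.coeff q ` {..Polynomial.degree q})"
      using le_degree by blast
    then show ?thesis by (rule finite_subset) auto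
  qed
  define A where "A = {Polynomial.degree p} \<union> Polynomial.degree ` range (Polynomial.coeff p) \<union>
    (\<Union>q\<in>range (Polynomial.coeff p). Polynomial.degree ` range (Polynomial.coeff q))"
  have "finite A"
    unfolding A_def by (intro finite_UnI finite_imageI finite_UN_I fin finite.intros)
  then have *: "d \<le> Max A" if "d \<in> A" for d using that by simp
  show ?thesis
    by (intro exI[of _ "Max A"] conjI allI; rule *) (unfold A_def, blast+)
qed

lemma coeff_psi:
  "\<exists>N. (\<forall>d. Polynomial.coeff (\<psi> p) d =
      (\<Sum>k\<le>N. \<Sum>j\<le>N. \<Sum>i\<le>N. if wt i j k = d then \<kappa> (cf p i j k) * s ^ i * z0 ^ k else 0)) \<and>
    (\<forall>i j k. cf p i j k \<noteq> 0 \<longrightarrow> i \<le> N \<and> j \<le> N \<and> k \<le> N)"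
proof -
  obtain N where N: "Polynomial.degree p \<le> N" "\<And>k. Polynomial.degree (Polynomial.coeff p k) \<le> N"
    "\<And>k j. Polynomial.degree (Polynomial.coeff (Polynomial.coeff p k) j) \<le> N"
    using degree_bound[of p] by blast
  show ?thesis
  proof (intro exI[of _ N] conjI[of "\<forall>d. _ d"] allI impI)
    show "Polynomial.coeff (\<psi> p) d =
      (\<Sum>k\<le>N. \<Sum>j\<le>N. \<Sum>i\<le>N. if wt i j k = d then \<kappa> (cf p i j k) * s ^ i * z0 ^ k else 0)" for d
      unfolding psi_sum[OF N] coeff_sum by (simp only: Polynomial.coeff_monom)
    show "i \<le> N \<and> j \<le> N \<and> k \<le> N" if "cf p i j k \<noteq> 0" for i j k
    proof (intro conjI)
      show "i \<le> N" using that N(3) le_degree order_trans by blast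
      have "Polynomial.coeff (Polynomial.coeff p k) j \<noteq> 0" using that by auto
      then show "j \<le> N" using N(2) le_degree order_trans by blast
      have "Polynomial.coeff p k \<noteq> 0" using that by auto
      then show "k \<le> N" using N(1) le_degree order_trans by blast
    qed
  qed
qed

text \<open>For a weight attained by a single monomial no sum remains, so the coefficient over
  \<open>K\<close> is governed by one complex number. This is how complex scalars are recovered
  later.\<close>

lemma coeff_psi_unique:
  assumes "\<And>i j k. wt i j k = d \<Longrightarrow> i = i1 \<and> j = j1 \<and> k = k1" "wt i1 j1 k1 = d"
  shows "Polynomial.coeff (\<psi> p) d = \<kappa> (cf p i1 j1 k1) * s ^ i1 * z0 ^ k1"
proof -
  obtain N where N': "\<forall>d. Polynomial.coeff (\<psi> p) d =
      (\<Sum>k\<le>N. \<Sum>j\<le>N. \<Sum>i\<le>N. if wt i j k = d then \<kappa> (cf p i j k) * s ^ i * z0 ^ k else 0)"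
    and nz': "\<forall>i j k. cf p i j k \<noteq> 0 \<longrightarrow> i \<le> N \<and> j \<le> N \<and> k \<le> N"
    using coeff_psi[of p] by (elim exE conjE)
  note N = N'[rule_format]
  have nz: "i \<le> N \<and> j \<le> N \<and> k \<le> N" if "cf p i j k \<noteq> 0" for i j k
    using nz' that by blast
  let ?v = "\<kappa> (cf p i1 j1 k1) * s ^ i1 * z0 ^ k1"
  have iff: "wt i j k = d \<longleftrightarrow> k1 = k \<and> j1 = j \<and> i1 = i" for i j k
    using assms by blast
  have "(if wt i j k = d then \<kappa> (cf p i j k) * s ^ i * z0 ^ k else 0) =
      (if k1 = k then (if j1 = j then (if i1 = i then ?v else 0) else 0) else 0)" for i j k
    unfolding iff by simp
  then have "Polynomial.coeff (\<psi> p) d =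
      (\<Sum>k\<le>N. \<Sum>j\<le>N. \<Sum>i\<le>N. if k1 = k then (if j1 = j then (if i1 = i then ?v else 0) else 0) else 0)"
    unfolding N by simp
  also have "\<dots> = (\<Sum>k\<le>N. if k1 = k then (\<Sum>j\<le>N. \<Sum>i\<le>N. if j1 = j then (if i1 = i then ?v else 0) else 0) else 0)"
    by (rule sum.cong[OF refl]) (simp split: if_split)
  also have "\<dots> = (if k1 \<le> N then (\<Sum>j\<le>N. \<Sum>i\<le>N. if j1 = j then (if i1 = i then ?v else 0) else 0) else 0)"
    by (simp only: sum.delta' finite_atMost atMost_iff)
  also have "(\<Sum>j\<le>N. \<Sum>i\<le>N. if j1 = j then (if i1 = i then ?v else 0) else 0) =
      (\<Sum>j\<le>N. if j1 = j then (\<Sum>i\<le>N. if i1 = i then ?v else 0) else 0)"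
    by (rule sum.cong[OF refl]) (simp split: if_split)
  also have "\<dots> = (if j1 \<le> N then (\<Sum>i\<le>N. if i1 = i then ?v else 0) else 0)"
    by (simp only: sum.delta' finite_atMost atMost_iff)
  also have "(\<Sum>i\<le>N. if i1 = i then ?v else 0) = (if i1 \<le> N then ?v else 0)"
    by (simp only: sum.delta' finite_atMost atMost_iff)
  also have "(if k1 \<le> N then (if j1 \<le> N then (if i1 \<le> N then ?v else 0) else 0) else 0) = ?v"
    using nz[where i = i1 and j = j1 and k = k1] by (cases "cf p i1 j1 k1 = 0") simp_all
  finally show ?thesis .
qed

text \<open>Modulo \<open>a\<close> all terms of the weight vanish except
  \<open>i * (b * c)\<close>, and \<open>b * c\<close> is invertible; the other two cases are
  symmetric.\<close>

lemma wt_mod: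
  assumes "wt i j k = wt i' j' k'"
  shows "[i = i'] (mod a)" "[j = j'] (mod b)" "[k = k'] (mod c)"
proof -
  have *: "[u = u'] (mod q)" if "u * (p * r) + q * t = u' * (p * r) + q * t'" "coprime q p" "coprime q r"
    for u u' p q r t t' :: nat
  proof -
    have "[u * (p * r) + q * t = u' * (p * r) + q * t'] (mod q)" using that(1) by (simp add: cong_def)
    then have "[u * (p * r) = u' * (p * r)] (mod q)"
      by (simp add: cong_def)
    moreover have "coprime (p * r) q" using that by (simp add: coprime_commute)
    ultimately show ?thesis using cong_mult_rcancel_nat by blast
  qed
  show "[i = i'] (mod a)"
    by (rule *[of i b c a "j * c + k * b" i' "j' * c + k' * b"])
      (use assms cop in \<open>simp_all add: wt_def algebra_simps\<close>)
  show "[j = j'] (mod b)"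
    by (rule *[of j a c b "i * c + k * a" j' "i' * c + k' * a"])
      (use assms cop in \<open>simp_all add: wt_def algebra_simps coprime_commute\<close>)
  show "[k = k'] (mod c)"
    by (rule *[of k a b c "i * b + j * a" k' "i' * b + j' * a"])
      (use assms cop in \<open>simp_all add: wt_def algebra_simps coprime_commute\<close>)
qed

text \<open>Within one weight the congruence modulo \<open>c\<close> together with
  \<open>k < c\<close> fixes the exponent of \<open>Z\<close>, so a common power of
  \<open>z0\<close> splits off. What remains is a complex polynomial \<open>q\<close> evaluated at
  \<open>s\<close>, which is 0 by transcendence. Given the weight and the exponent of
  \<open>Z\<close>, the exponent of \<open>X\<close> determines that of \<open>Y\<close>, so
  different monomials do not mix in a coefficient of \<open>q\<close>.\<close>

lemma psi_normal_form_inj: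
  assumes "\<psi> p = 0" and deg: "\<And>k. k \<ge> c \<Longrightarrow> Polynomial.coeff p k = 0"
  shows "p = 0"
proof (rule ccontr)
  assume "p \<noteq> 0"
  then obtain k0 where "Polynomial.coeff p k0 \<noteq> 0" by (auto simp: poly_eq_iff)
  then obtain j0 where "Polynomial.coeff (Polynomial.coeff p k0) j0 \<noteq> 0" by (auto simp: poly_eq_iff)
  then obtain i0 where cnz: "cf p i0 j0 k0 \<noteq> 0" by (auto simp: poly_eq_iff)
  then have k0: "k0 < c" using deg[of k0] by (cases "k0 \<ge> c") auto
  obtain N where N': "\<forall>d. Polynomial.coeff (\<psi> p) d =
      (\<Sum>k\<le>N. \<Sum>j\<le>N. \<Sum>i\<le>N. if wt i j k = d then \<kappa> (cf p i j k) * s ^ i * z0 ^ k else 0)"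
    and nz': "\<forall>i j k. cf p i j k \<noteq> 0 \<longrightarrow> i \<le> N \<and> j \<le> N \<and> k \<le> N"
    using coeff_psi[of p] by (elim exE conjE)
  note N = N'[rule_format]
  have nz: "i \<le> N \<and> j \<le> N \<and> k \<le> N" if "cf p i j k \<noteq> 0" for i j k
    using nz' that by blast
  define d where "d = wt i0 j0 k0"
  have kk: "k = k0" if "wt i j k = d" "cf p i j k \<noteq> 0" for i j k
  proof -
    have "k < c" using that deg[of k] by (cases "k \<ge> c") auto
    moreover have "[k = k0] (mod c)" using wt_mod that d_def by blast
    ultimately show ?thesis using k0 by (simp add: cong_def)
  qed
  define q where "q = (\<Sum>j\<le>N. \<Sum>i\<le>N. if wt i j k0 = d then Polynomial.monom (cf p i j k0) i else 0)"
  have "(if wt i j k = d then \<kappa> (cf p i j k) * s ^ i * z0 ^ k else 0) =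
     (if k0 = k then (if wt i j k0 = d then \<kappa> (cf p i j k0) * s ^ i * z0 ^ k0 else 0) else 0)" for i j k
  proof (cases "k0 = k")
    case False
    then have "wt i j k = d \<Longrightarrow> cf p i j k = 0" using kk[of i j k] by blast
    with False show ?thesis by simp
  qed simp
  then have "Polynomial.coeff (\<psi> p) d = (\<Sum>k\<le>N. \<Sum>j\<le>N. \<Sum>i\<le>N.
     (if k0 = k then (if wt i j k0 = d then \<kappa> (cf p i j k0) * s ^ i * z0 ^ k0 else 0) else 0))"
    unfolding N by simp
  also have "\<dots> = (\<Sum>k\<le>N. if k0 = k then (\<Sum>j\<le>N. \<Sum>i\<le>N.
     (if wt i j k0 = d then \<kappa> (cf p i j k0) * s ^ i * z0 ^ k0 else 0)) else 0)"
    by (intro sum.cong refl) simp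
  also have "\<dots> = (\<Sum>j\<le>N. \<Sum>i\<le>N. (if wt i j k0 = d then \<kappa> (cf p i j k0) * s ^ i * z0 ^ k0 else 0))"
    using nz[OF cnz] by (simp add: sum.delta')
  also have "\<dots> = evp \<kappa> s q * z0 ^ k0"
  proof -
    have "evp \<kappa> s q = (\<Sum>j\<le>N. \<Sum>i\<le>N. if wt i j k0 = d then \<kappa> (cf p i j k0) * s ^ i else 0)"
      unfolding q_def ring_map.sum[OF ring_map_evp[OF \<kappa>]]
      by (intro sum.cong refl) (simp add: evp_monom[OF \<kappa>])
    then show ?thesis by (simp add: sum_distrib_right if_distrib[of "\<lambda>x. x * z0 ^ k0"] cong: if_cong)
  qed
  finally have "evp \<kappa> s q = 0" using assms(1) z0_nz by simp
  then have "q = 0" by (rule transc)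
  then have "0 = Polynomial.coeff q i0" by simp
  also have "\<dots> = (\<Sum>j\<le>N. \<Sum>i\<le>N. if i0 = i then (if wt i0 j k0 = d then cf p i0 j k0 else 0) else 0)"
    unfolding q_def coeff_sum by (intro sum.cong refl) auto
  also have "\<dots> = (\<Sum>j\<le>N. if wt i0 j k0 = d then cf p i0 j k0 else 0)"
    using nz[OF cnz] by (simp add: sum.delta')
  also have "\<dots> = (\<Sum>j\<le>N. if j0 = j then cf p i0 j0 k0 else 0)"
    using a2 c2 by (intro sum.cong refl) (auto simp: d_def wt_def)
  also have "\<dots> = cf p i0 j0 k0"
    using nz[OF cnz] by (simp add: sum.delta')
  finally show False using cnz by simp
qed

text \<open>In the outermost variable \<open>Z\<close> the polynomial \<open>pham\<close> is monic
  of degree \<open>c\<close>, so pseudo-division is true division with remainder.\<close>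

lemma normal_form:
  "\<exists>r. pham a b c dvd p - r \<and> (\<forall>k\<ge>c. Polynomial.coeff r k = 0)"
proof -
  define e :: "complex poly poly" where "e = [:[:0, 1:]:] ^ a + [:0, 1:] ^ b"
  have ph: "pham a b c = Polynomial.monom 1 c + [:e:]"
    unfolding pham_def polyX_def polyY_def polyZ_def e_def
    by (simp add: monom_altdef poly_const_pow pCons_one)
  have cfp: "Polynomial.coeff (pham a b c) c = 1"
    using c2 unfolding ph by (simp add: Polynomial.coeff_pCons split: nat.split)
  have degp: "Polynomial.degree (pham a b c) = c"
  proof (rule antisym)
    show "Polynomial.degree (pham a b c) \<le> c"
      unfolding ph by (intro degree_add_le) (simp_all add: degree_monom_eq)
    show "c \<le> Polynomial.degree (pham a b c)" using cfp by (intro le_degree) simp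
  qed
  have nz: "pham a b c \<noteq> 0" using cfp by auto
  obtain q r where qr: "pseudo_divmod p (pham a b c) = (q, r)" by (cases "pseudo_divmod p (pham a b c)")
  have "p = pham a b c * q + r" and d: "r = 0 \<or> Polynomial.degree r < c"
    using pseudo_divmod[OF nz qr] by (simp_all add: degp cfp)
  then have "pham a b c dvd p - r" by simp
  moreover have "Polynomial.coeff r k = 0" if "k \<ge> c" for k
    using d that by (auto intro: coeff_eq_0)
  ultimately show ?thesis by blast
qed

lemma psi_eq_zero_iff: "\<psi> p = 0 \<longleftrightarrow> pham a b c dvd p"
proof
  assume "pham a b c dvd p"
  then show "\<psi> p = 0" by (auto simp: dvd_def \<psi>.mult psi_pham)
next
  assume p: "\<psi> p = 0"
  obtain r where r: "pham a b c dvd p - r" "\<And>k. k \<ge> c \<Longrightarrow> Polynomial.coeff r k = 0"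
    using normal_form[of p] by blast
  then have "\<psi> (p - r) = 0" by (auto simp: dvd_def \<psi>.mult psi_pham)
  then have "\<psi> r = 0" using p by (simp add: \<psi>.diff)
  then have "r = 0" using r(2) by (rule psi_normal_form_inj)
  with r show "pham a b c dvd p" by simp
qed

definition R' :: "'k poly set" where "R' = range \<psi>"

lemma R'_closed [simp, intro]:
  "x \<in> R'" "y \<in> R'" "z \<in> R'" "con k \<in> R'" "0 \<in> R'" "1 \<in> R'" "\<psi> p \<in> R'"
  unfolding R'_def using psi_gens \<psi>.zero \<psi>.one by (metis rangeI)+

lemma R'_add [intro]: "f \<in> R' \<Longrightarrow> g \<in> R' \<Longrightarrow> f + g \<in> R'"
  and R'_mult [intro]: "f \<in> R' \<Longrightarrow> g \<in> R' \<Longrightarrow> f * g \<in> R'"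
  and R'_uminus [intro]: "f \<in> R' \<Longrightarrow> - f \<in> R'"
  and R'_power [intro]: "f \<in> R' \<Longrightarrow> f ^ k \<in> R'"
  unfolding R'_def by (auto simp flip: \<psi>.add \<psi>.mult \<psi>.uminus \<psi>.power)

lemma R'_induct [consumes 1, case_names con x y z add mult]:
  assumes "f \<in> R'" "\<And>k. Q (con k)" "Q x" "Q y" "Q z"
    and "\<And>g h. g \<in> R' \<Longrightarrow> h \<in> R' \<Longrightarrow> Q g \<Longrightarrow> Q h \<Longrightarrow> Q (g + h)"
      "\<And>g h. g \<in> R' \<Longrightarrow> h \<in> R' \<Longrightarrow> Q g \<Longrightarrow> Q h \<Longrightarrow> Q (g * h)"
  shows "Q f"
proof -
  obtain p where p: "f = \<psi> p" using assms(1) by (auto simp: R'_def)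
  have "\<psi> p \<in> R' \<and> Q (\<psi> p)"
    by (rule psi_induct) (use assms in auto)
  with p show ?thesis by simp
qed

text \<open>Normal forms turn the equation into an identity between polynomials, where a power of
  \<open>Y\<close> dividing \<open>polyX ^ k * p\<close> must divide \<open>p\<close>.\<close>

lemma R'_regular:
  assumes "f \<in> R'" "g \<in> R'" "x ^ k * f = y ^ l * g"
  shows "\<exists>q\<in>R'. f = y ^ l * q"
proof -
  have nf: "\<exists>r. f = \<psi> r \<and> (\<forall>k\<ge>c. Polynomial.coeff r k = 0)" if f: "f \<in> R'" for f
  proof -
    obtain p where p: "f = \<psi> p" using f by (auto simp: R'_def)
    obtain r where r: "pham a b c dvd p - r" "\<And>k. k \<ge> c \<Longrightarrow> Polynomial.coeff r k = 0"
      using normal_form[of p] by blast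
    then have "\<psi> (p - r) = 0" by (simp add: psi_eq_zero_iff)
    then show ?thesis using p r(2) by (auto simp: \<psi>.diff)
  qed
  obtain p where p: "f = \<psi> p" "\<And>k. k \<ge> c \<Longrightarrow> Polynomial.coeff p k = 0" using nf[OF assms(1)] by blast
  obtain p' where p': "g = \<psi> p'" "\<And>k. k \<ge> c \<Longrightarrow> Polynomial.coeff p' k = 0" using nf[OF assms(2)] by blast
  have X: "polyX ^ k = [:[:Polynomial.monom 1 k:]:]" and Y: "polyY ^ l = [:Polynomial.monom 1 l:]"
    by (simp_all add: polyX_def polyY_def poly_const_pow monom_altdef)
  have "\<psi> (polyX ^ k * p - polyY ^ l * p') = 0"
    using assms(3) p p' by (simp add: \<psi>.diff \<psi>.mult \<psi>.power)
  \<comment> \<open>Neither multiplier involves \<open>Z\<close>, so the difference is still in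
    normal form and injectivity applies.\<close>
  then have "polyX ^ k * p - polyY ^ l * p' = 0"
    by (rule psi_normal_form_inj) (simp add: X Y p p')
  then have eq: "polyX ^ k * p = polyY ^ l * p'" by simp
  have "Polynomial.monom 1 l dvd Polynomial.coeff p i" for i
    unfolding monom_1_dvd_iff'
  proof (intro allI impI)
    fix j assume j: "j < l"
    have "Polynomial.coeff (polyX ^ k * p) i = Polynomial.coeff (polyY ^ l * p') i" using eq by simp
    then have "Polynomial.smult (Polynomial.monom 1 k) (Polynomial.coeff p i) =
       Polynomial.monom 1 l * Polynomial.coeff p' i" by (simp add: X Y)
    then have "Polynomial.monom 1 k * Polynomial.coeff (Polynomial.coeff p i) j =
       Polynomial.coeff (Polynomial.monom 1 l * Polynomial.coeff p' i) j" by (metis Polynomial.coeff_smult)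
    also have "\<dots> = 0" using j by (simp add: coeff_monom_mult)
    finally show "Polynomial.coeff (Polynomial.coeff p i) j = 0" by (simp add: monom_eq_0_iff)
  qed
  then have "polyY ^ l dvd p" unfolding Y by (simp add: const_poly_dvd_iff)
  then obtain q where "p = polyY ^ l * q" by auto
  then have "f = y ^ l * \<psi> q" using p by (simp add: \<psi>.mult \<psi>.power)
  then show ?thesis by blast
qed

end

subsection \<open>Extending ring maps to fraction fields\<close>

lemma evp_const_eq_pcompose:
  assumes "ring_map f"
  shows "evp (\<lambda>q. [:f q:]) u t = pcompose (map_poly f t) u"
proof -
  have "ring_map (\<lambda>q. [:f q:])" by (rule ring_map_comp[OF ring_map_const assms])
  then show ?thesis
    by (induction t) (simp_all add: evp_pCons pcompose_pCons ring_map.map_poly_pCons[OF assms])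
qed

lemma evp_map_poly:
  assumes "ring_map f" "ring_map g"
  shows "evp f x (map_poly g p) = evp (\<lambda>q. f (g q)) x p"
  using assms by (simp add: evp_def map_poly_map_poly ring_map.zero o_def)

text \<open>A representative is picked by choice; the value is independent of it once
  \<open>f\<close> has trivial kernel, hence the locale that follows.\<close>

definition fract_map :: "('a::idom \<Rightarrow> 'b::idom) \<Rightarrow> 'a fract \<Rightarrow> 'b fract" where
  "fract_map f q = (let p = SOME p. snd p \<noteq> 0 \<and> q = Fract (fst p) (snd p)
     in Fract (f (fst p)) (f (snd p)))"

locale inj_ring_map = ring_map f for f :: "'a::idom \<Rightarrow> 'b::idom" +
  assumes inj_zero: "f q = 0 \<Longrightarrow> q = 0"
begin

lemma fract_map_Fract:
  assumes "b \<noteq> 0"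
  shows "fract_map f (Fract a b) = Fract (f a) (f b)"
proof -
  define p where "p = (SOME p. snd p \<noteq> 0 \<and> Fract a b = Fract (fst p) (snd p))"
  have "snd p \<noteq> 0 \<and> Fract a b = Fract (fst p) (snd p)"
    unfolding p_def by (rule someI[of _ "(a, b)"]) (use assms in simp)
  then have p: "snd p \<noteq> 0" "a * snd p = fst p * b"
    using assms by (auto simp: eq_fract)
  then have "f a * f (snd p) = f (fst p) * f b" by (simp flip: mult)
  moreover have "f (snd p) \<noteq> 0" "f b \<noteq> 0" using p assms inj_zero by auto
  ultimately have "Fract (f a) (f b) = Fract (f (fst p)) (f (snd p))"
    by (simp add: eq_fract)
  then show ?thesis by (simp add: fract_map_def p_def Let_def)
qed

lemma ring_map_fract_map: "ring_map (fract_map f)"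
proof
  have nz: "f q \<noteq> 0" if "q \<noteq> 0" for q using that inj_zero by blast
  show "fract_map f 1 = 1"
    using fract_map_Fract[of 1 1] by (simp add: fract_expand)
  show "fract_map f (p + q) = fract_map f p + fract_map f q" for p q
    by (cases p; cases q) (simp add: fract_map_Fract nz add mult)
  show "fract_map f (p * q) = fract_map f p * fract_map f q" for p q
    by (cases p; cases q) (simp add: fract_map_Fract nz mult)
qed

lemma fract_map_to_fract: "fract_map f (to_fract q) = to_fract (f q)"
  by (simp add: to_fract_def fract_map_Fract)

end

subsection \<open>A model of \<open>B\<^sub>m\<^sub>,\<^sub>n\<close> inside \<open>K(w)[V]\<close>\<close>

context pham_model
begin

definition emb :: "'k poly \<Rightarrow> 'k poly fract poly" where "emb f = [:to_fract f:]"

definition v :: "'k poly fract poly" where "v = [:0, 1:]"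
definition u :: "'k poly fract poly" where
  "u = [:1 / to_fract (x ^ m), to_fract (y ^ n) / to_fract (x ^ m):]"

lemma emb: "ring_map emb"
  by standard (simp_all add: emb_def)

sublocale emb: ring_map emb by (rule emb)

lemma emb_eq_iff [simp]: "emb f = emb g \<longleftrightarrow> f = g"
  by (simp add: emb_def)

lemma emb_eq_0_iff [simp]: "emb f = 0 \<longleftrightarrow> f = 0"
  by (simp add: emb_def)

lemma uv_relation: "emb (x ^ m) * u = 1 + emb (y ^ n) * v"
  using x_nz by (simp add: emb_def u_def v_def pCons_one[symmetric] del: pCons_one)

definition \<Theta> :: "cpoly5 \<Rightarrow> 'k poly fract poly" where
  "\<Theta> = evp (evp (\<lambda>q. emb (\<psi> q)) u) v"

text \<open>Reduction of coefficients to \<open>R\<close>, with \<open>R\<close> realised as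
  polynomials in \<open>w\<close>. The map \<Theta> factors through it, so equalities in
  \<open>R[U,V]\<close> can be stated as equalities of \<Psi>-images.\<close>

definition \<Psi> :: "cpoly5 \<Rightarrow> 'k poly poly poly" where
  "\<Psi> = map_poly (map_poly \<psi>)"

lemma emb_psi: "ring_map (\<lambda>q. emb (\<psi> q))"
  by (rule ring_map_comp[OF emb psi])

lemma theta1: "ring_map (evp (\<lambda>q. emb (\<psi> q)) u)"
  by (rule ring_map_evp[OF emb_psi])

lemma theta: "ring_map \<Theta>"
  unfolding \<Theta>_def by (rule ring_map_evp[OF theta1])

sublocale \<Theta>: ring_map \<Theta> by (rule theta)

lemma map_psi: "ring_map (map_poly \<psi>)"
  by (rule \<psi>.ring_map_map_poly)

lemma Psi: "ring_map \<Psi>"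
  unfolding \<Psi>_def by (rule ring_map.ring_map_map_poly[OF map_psi])

sublocale \<Psi>: ring_map \<Psi> by (rule Psi)

lemma Psi_pCons: "\<Psi> (pCons q p) = pCons (map_poly \<psi> q) (\<Psi> p)"
  by (simp add: \<Psi>_def ring_map.map_poly_pCons[OF map_psi])

lemma coeff_Psi: "Polynomial.coeff (Polynomial.coeff (\<Psi> p) j) i = \<psi> (Polynomial.coeff (Polynomial.coeff p j) i)"
  by (simp add: \<Psi>_def ring_map.coeff_map_poly[OF map_psi])

lemma Theta_Psi: "\<Theta> p = evp (evp emb u) v (\<Psi> p)"
proof -
  have "evp emb u (map_poly \<psi> q) = evp (\<lambda>q. emb (\<psi> q)) u q" for q
    by (rule evp_map_poly[OF emb psi])
  then show ?thesis
    unfolding \<Theta>_def \<Psi>_def by (simp add: evp_map_poly[OF ring_map_evp[OF emb] map_psi])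
qed

lemma Theta_const: "\<Theta> [:[:p:]:] = emb (\<psi> p)"
  and Theta_U: "\<Theta> [:[:0, 1:]:] = u"
  and Theta_V: "\<Theta> [:0, 1:] = v"
  by (simp_all add: \<Theta>_def evp_const[OF theta1] evp_var[OF theta1] evp_const[OF emb_psi] evp_var[OF emb_psi])

lemma Theta_danielewski: "\<Theta> (danielewski m n) = 0"
  unfolding danielewski_def \<Theta>.diff \<Theta>.mult \<Theta>.one Theta_const Theta_U Theta_V \<psi>.power psi_gens uv_relation
  by simp

text \<open>The relation \<open>X\<^sup>m U - Y\<^sup>n V - 1\<close> is linear in \<open>V\<close> with leading coefficient \<open>-Y\<^sup>n\<close>, so \<open>V\<close> can be
  eliminated after multiplication by a power of \<open>Y\<^sup>n\<close>. That power is cancelled again by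
  \<open>cancel_Y\<close>: modulo \<open>Y\<^sup>n\<close> the cofactor \<open>g\<close> is a geometric series \<open>r \<Sum> (X\<^sup>m U)\<^sup>i\<close>, which can only be
  a polynomial if \<open>Y\<^sup>n\<close> divides \<open>r\<close>.\<close>

lemma eliminate_V:
  "\<exists>k g t. [:[:polyY ^ n:]:] ^ k * p = danielewski m n * g + [:t:]"
proof (induction p)
  case 0
  show ?case by (intro exI[of _ 0]) simp
next
  case (pCons q p)
  then obtain k g t where IH: "[:[:polyY ^ n:]:] ^ k * p = danielewski m n * g + [:t:]" by blast
  define Y W V U Q T E where defs: "Y = ([:[:polyY ^ n:]:] :: cpoly5)" "W = ([:[:polyX ^ m:]:] :: cpoly5)"
    "V = ([:0, 1:] :: cpoly5)" "U = ([:[:0, 1:]:] :: cpoly5)" "Q = [:q:]" "T = [:t:]" "E = danielewski m n"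
  have E: "E = W * U - Y * V - 1" unfolding defs danielewski_def ..
  have IH': "Y ^ k * p = E * g + T" using IH by (simp add: defs)
  have "Y ^ Suc k * (Q + V * p) = Y ^ Suc k * Q + Y * V * (Y ^ k * p)"
    by (simp add: algebra_simps)
  \<comment> \<open>The relation enters here as \<open>Y * V = W * U - 1 - E\<close>, which replaces
    the factor \<open>Y * V\<close> in front of \<open>T\<close>.\<close>
  also have "\<dots> = E * (Y * V * g - T) + (Y ^ Suc k * Q + (W * U - 1) * T)"
    unfolding IH' unfolding E by (simp add: algebra_simps)
  finally have 1: "Y ^ Suc k * (Q + V * p) = E * (Y * V * g - T) + (Y ^ Suc k * Q + (W * U - 1) * T)" .
  have one: "(1::cpoly5) = [:1:]" by simp
  have "Y ^ Suc k * Q + (W * U - 1) * T = [:[:polyY ^ n:] ^ Suc k * q + ([:polyX ^ m:] * [:0, 1:] - 1) * t:]"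
    unfolding defs one by (simp only: ring_map.mult[OF ring_map_const] ring_map.power[OF ring_map_const]
        ring_map.diff[OF ring_map_const] ring_map.add[OF ring_map_const])
  moreover have "pCons q p = Q + V * p" by (simp add: defs)
  ultimately have "Y ^ Suc k * pCons q p = E * (Y * V * g - T) +
      [:[:polyY ^ n:] ^ Suc k * q + ([:polyX ^ m:] * [:0, 1:] - 1) * t:]"
    using 1 by simp
  then show ?case unfolding defs by blast
qed

lemma danielewski_pCons: "danielewski m n = [:[:- 1, polyX ^ m:], [:- (polyY ^ n):]:]"
proof -
  have 1: "(1::cpoly5) = [:[:1:]:]" by (simp add: pCons_one)
  have 2: "[:[:polyX ^ m:]:] * [:[:0, 1:]:] = ([:[:0, polyX ^ m:]:] :: cpoly5)"
    and 3: "[:[:polyY ^ n:]:] * [:0, 1:] = ([:0, [:polyY ^ n:]:] :: cpoly5)"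
    by (simp_all add: pCons_one)
  show ?thesis unfolding danielewski_def 2 3 unfolding 1 by simp
qed

lemma cancel_Y:
  assumes eq: "\<Psi> ([:[:polyY ^ n:]:] * p) = \<Psi> (danielewski m n * g + [:[:r:]:])"
  shows "\<exists>g' r'. \<Psi> p = \<Psi> (danielewski m n * g' + [:[:r':]:])"
proof -
  define G where "G j i = \<psi> (Polynomial.coeff (Polynomial.coeff g j) i)" for j i
  have G: "y ^ n * \<psi> (Polynomial.coeff (Polynomial.coeff p j) i) =
      (if i = 0 then 0 else x ^ m * G j (i - 1)) - (if j = 0 then 0 else y ^ n * G (j - 1) i) - G j i
      + (if j = 0 \<and> i = 0 then \<psi> r else 0)" for j i
  proof -
    have "\<psi> (Polynomial.coeff (Polynomial.coeff ([:[:polyY ^ n:]:] * p) j) i) =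
      \<psi> (Polynomial.coeff (Polynomial.coeff (danielewski m n * g + [:[:r:]:]) j) i)"
      unfolding coeff_Psi[symmetric] eq ..
    then show ?thesis
      unfolding danielewski_pCons G_def
      by (simp add: \<psi>.mult \<psi>.power \<psi>.add \<psi>.uminus \<psi>.diff Polynomial.coeff_pCons split: nat.splits)
  qed
  define S where "S f \<longleftrightarrow> (\<exists>q. f = y ^ n * \<psi> q)" for f
  have S_mult: "S f \<Longrightarrow> S (\<psi> q * f)" for f q
    unfolding S_def by (metis \<psi>.mult mult.left_commute)
  have S_add: "S f \<Longrightarrow> S g \<Longrightarrow> S (f + g)" for f g
    unfolding S_def by (metis \<psi>.add distrib_left)
  have S_uminus: "S f \<Longrightarrow> S (- f)" for f
    unfolding S_def by (metis \<psi>.uminus mult_minus_right)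
  have S_diff: "S f \<Longrightarrow> S g \<Longrightarrow> S (f - g)" for f g
    using S_add[of f "- g"] S_uminus[of g] by simp
  have S0: "S 0" unfolding S_def by (intro exI[of _ 0]) simp
  have S_I: "S (y ^ n * \<psi> q)" for q unfolding S_def by blast
  have S_G: "S (if j = 0 then 0 else y ^ n * G (j - 1) i)" for i j
    using S0 S_I by (simp add: G_def)
  have claim: "S (G j i - (if j = 0 then x ^ (m * i) * \<psi> r else 0))" for j i
  proof (induction i)
    case 0
    have "G j 0 - (if j = 0 then x ^ (m * 0) * \<psi> r else 0) =
      - (y ^ n * \<psi> (Polynomial.coeff (Polynomial.coeff p j) 0)) - (if j = 0 then 0 else y ^ n * G (j - 1) 0)"
      using G[of j 0] by simp
    also have "S \<dots>" by (intro S_diff S_uminus S_I S_G)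
    finally show ?case .
  next
    case (Suc i)
    have "G j (Suc i) - (if j = 0 then x ^ (m * Suc i) * \<psi> r else 0) =
      \<psi> (polyX ^ m) * (G j i - (if j = 0 then x ^ (m * i) * \<psi> r else 0))
      - (if j = 0 then 0 else y ^ n * G (j - 1) (Suc i))
      - y ^ n * \<psi> (Polynomial.coeff (Polynomial.coeff p j) (Suc i))"
    proof -
      have "G j (Suc i) = x ^ m * G j i - (if j = 0 then 0 else y ^ n * G (j - 1) (Suc i))
          - y ^ n * \<psi> (Polynomial.coeff (Polynomial.coeff p j) (Suc i))"
        using G[of j "Suc i"] by (simp add: algebra_simps)
      then show ?thesis
        by (simp add: \<psi>.power right_diff_distrib power_add mult.assoc)
    qed
    also have "S \<dots>" by (intro S_diff S_mult Suc S_I S_G)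
    finally show ?case .
  qed
  \<comment> \<open>Beyond the degree in \<open>U\<close> the coefficient of \<open>g\<close> is 0,
    so the claim says that \<open>y ^ n\<close> divides \<open>x ^ (m * N) * \<psi> r\<close>;
    regularity then removes the power of \<open>x\<close>.\<close>
  define N where "N = Suc (Polynomial.degree (Polynomial.coeff g 0))"
  have "G 0 N = 0" by (simp add: G_def N_def coeff_eq_0)
  then have "S (- (x ^ (m * N) * \<psi> r))" using claim[of 0 N] by simp
  then have "S (x ^ (m * N) * \<psi> r)" using S_uminus by fastforce
  then have "\<exists>q\<in>R'. \<psi> r = y ^ n * q"
    unfolding S_def by (elim exE) (rule R'_regular; auto)
  then have Sr: "S (\<psi> r)" unfolding S_def R'_def by auto
  have SG: "S (G j i)" for j i
  proof -
    have "S (\<psi> (polyX ^ (m * i)) * \<psi> r)" using Sr by (rule S_mult)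
    then have "S (if j = 0 then x ^ (m * i) * \<psi> r else 0)" using S0 by (simp add: \<psi>.power)
    from S_add[OF claim[of j i] this] show ?thesis by simp
  qed
  have "\<exists>g'. map_poly \<psi> (Polynomial.coeff g j) = map_poly \<psi> ([:polyY ^ n:] * g')" for j
  proof -
    have "\<exists>q. \<psi> (Polynomial.coeff (Polynomial.coeff g j) i) = \<psi> (polyY ^ n * q)" for i
      using SG[of j i] by (auto simp: S_def G_def \<psi>.mult \<psi>.power)
    from map_poly_eq_smult[OF psi this] show ?thesis by simp
  qed
  then obtain g' where "\<Psi> g = \<Psi> (Polynomial.smult [:polyY ^ n:] g')"
    using map_poly_eq_smult[OF map_psi, of g "[:polyY ^ n:]"] unfolding \<Psi>_def by blast
  then have g': "\<Psi> g = \<Psi> [:[:polyY ^ n:]:] * \<Psi> g'" by (simp flip: \<Psi>.mult)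
  obtain r' where r': "\<psi> r = y ^ n * \<psi> r'" using Sr by (auto simp: S_def)
  then have r'': "\<Psi> [:[:r:]:] = \<Psi> [:[:polyY ^ n:]:] * \<Psi> [:[:r':]:]"
    by (simp add: Psi_pCons \<psi>.power)
  have "\<Psi> [:[:polyY ^ n:]:] * \<Psi> p = \<Psi> [:[:polyY ^ n:]:] * \<Psi> (danielewski m n * g' + [:[:r':]:])"
    using eq unfolding \<Psi>.mult \<Psi>.add g' r'' by (simp only: distrib_left mult.left_commute)
  moreover have "\<Psi> [:[:polyY ^ n:]:] \<noteq> 0"
    using y_nz by (simp add: Psi_pCons \<psi>.power)
  ultimately have "\<Psi> p = \<Psi> (danielewski m n * g' + [:[:r':]:])" by simp
  then show ?thesis by blast
qed

text \<open>After multiplication by a power of \<open>y ^ n\<close>, the element \<Theta>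
  \<open>p\<close> becomes \<open>t\<close> evaluated at \<open>u\<close>. As \<open>u\<close> has
  degree 1 in \<open>V\<close>, degree 0 forces all higher coefficients of \<open>t\<close> to
  vanish in \<open>R\<close>. The powers of \<open>Y\<close> are then cancelled one by one. Both the
  faithfulness of the model and the determination of the kernel of the derivation rest on
  this.\<close>

lemma degree_Theta_0:
  assumes "Polynomial.degree (\<Theta> p) = 0"
  shows "\<exists>g r. \<Psi> p = \<Psi> (danielewski m n * g + [:[:r:]:])"
proof -
  obtain k g t where kgt: "[:[:polyY ^ n:]:] ^ k * p = danielewski m n * g + [:t:]"
    using eliminate_V by blast
  have tf: "ring_map (\<lambda>q. to_fract (\<psi> q))"
    by standard (simp_all add: \<psi>.add \<psi>.mult)
  have "\<Theta> ([:[:polyY ^ n:]:] ^ k * p) = \<Theta> [:t:]"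
    unfolding kgt by (simp add: \<Theta>.add \<Theta>.mult Theta_danielewski)
  then have "emb (y ^ n) ^ k * \<Theta> p = evp (\<lambda>q. emb (\<psi> q)) u t"
    by (simp add: \<Theta>.mult \<Theta>.power Theta_const \<psi>.power \<Theta>_def[THEN fun_cong, of "[:t:]"] evp_const[OF theta1])
  also have "\<dots> = pcompose (map_poly (\<lambda>q. to_fract (\<psi> q)) t) u"
    unfolding emb_def by (rule evp_const_eq_pcompose[OF tf])
  finally have "Polynomial.degree (pcompose (map_poly (\<lambda>q. to_fract (\<psi> q)) t) u) =
      Polynomial.degree (emb (y ^ n) ^ k * \<Theta> p)" by simp
  also have "\<dots> \<le> Polynomial.degree (emb (y ^ n) ^ k) + Polynomial.degree (\<Theta> p)"
    by (rule degree_mult_le)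
  also have "\<dots> = 0" using assms by (simp add: emb_def poly_const_pow)
  finally have "Polynomial.degree (map_poly (\<lambda>q. to_fract (\<psi> q)) t) = 0"
    using x_nz y_nz by (simp add: u_def degree_pcompose)
  then have t: "\<psi> (Polynomial.coeff t i) = 0" if "i > 0" for i
    using that by (metis coeff_eq_0 ring_map.coeff_map_poly[OF tf] to_fract_eq_0_iff)
  have "map_poly \<psi> t = map_poly \<psi> [:Polynomial.coeff t 0:]"
    by (rule poly_eqI) (simp add: t Polynomial.coeff_pCons split: nat.split)
  then have "\<Psi> [:t:] = \<Psi> [:[:Polynomial.coeff t 0:]:]"
    by (simp add: Psi_pCons)
  then have "\<exists>g r. \<Psi> ([:[:polyY ^ n:]:] ^ k * p) = \<Psi> (danielewski m n * g + [:[:r:]:])"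
    unfolding kgt \<Psi>.add by metis
  then show ?thesis
  proof (induction k)
    case 0
    then show ?case by simp
  next
    case (Suc k)
    from Suc.prems obtain g r where "\<Psi> ([:[:polyY ^ n:]:] * ([:[:polyY ^ n:]:] ^ k * p)) =
        \<Psi> (danielewski m n * g + [:[:r:]:])"
      unfolding power_Suc mult.assoc by blast
    from Suc.IH[OF cancel_Y[OF this]] show ?case .
  qed
qed

text \<open>The right-hand side is the kernel condition for \<open>liftB\<close>, so \<Theta>
  induces an injection of \<open>B\<close>. A zero image has degree 0, which leaves a constant
  \<open>r\<close> to be shown zero in \<open>R\<close>.\<close>

lemma Theta_eq_zero_iff: "\<Theta> p = 0 \<longleftrightarrow>
  (\<exists>q. \<forall>i j. pham a b c dvd Polynomial.coeff (Polynomial.coeff (p - q * danielewski m n) i) j)"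
proof -
  have Psi0: "(\<forall>i j. pham a b c dvd Polynomial.coeff (Polynomial.coeff q i) j) \<longleftrightarrow> \<Psi> q = 0" for q
  proof
    assume "\<forall>i j. pham a b c dvd Polynomial.coeff (Polynomial.coeff q i) j"
    then have "Polynomial.coeff (Polynomial.coeff (\<Psi> q) i) j = 0" for i j
      by (simp add: coeff_Psi psi_eq_zero_iff)
    then have "Polynomial.coeff (\<Psi> q) i = 0" for i by (metis leading_coeff_0_iff)
    then show "\<Psi> q = 0" by (metis leading_coeff_0_iff)
  next
    assume "\<Psi> q = 0"
    then have "\<psi> (Polynomial.coeff (Polynomial.coeff q i) j) = 0" for i j
      by (simp flip: coeff_Psi)
    then show "\<forall>i j. pham a b c dvd Polynomial.coeff (Polynomial.coeff q i) j"
      by (simp add: psi_eq_zero_iff)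
  qed
  show ?thesis
    unfolding Psi0
  proof
    assume "\<exists>q. \<Psi> (p - q * danielewski m n) = 0"
    then obtain q where "\<Psi> (p - q * danielewski m n) = 0" by blast
    then have "\<Theta> (p - q * danielewski m n) = 0" by (simp add: Theta_Psi)
    then show "\<Theta> p = 0" by (simp add: \<Theta>.diff \<Theta>.mult Theta_danielewski)
  next
    assume p: "\<Theta> p = 0"
    then obtain g r where gr: "\<Psi> p = \<Psi> (danielewski m n * g + [:[:r:]:])"
      using degree_Theta_0[of p] by auto
    then have "\<Theta> p = \<Theta> (danielewski m n * g + [:[:r:]:])" by (simp add: Theta_Psi)
    then have "\<psi> r = 0" using p by (simp add: \<Theta>.add \<Theta>.mult Theta_danielewski Theta_const)
    then have "\<Psi> [:[:r:]:] = 0" by (simp add: Psi_pCons)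
    with gr have "\<Psi> (p - g * danielewski m n) = 0"
      by (simp add: \<Psi>.diff \<Psi>.add mult.commute)
    then show "\<exists>q. \<Psi> (p - q * danielewski m n) = 0" by blast
  qed
qed

definition B' :: "'k poly fract poly set" where "B' = range \<Theta>"

lemma B'_closed [simp, intro]: "f \<in> R' \<Longrightarrow> emb f \<in> B'" "u \<in> B'" "v \<in> B'" "0 \<in> B'" "1 \<in> B'" "\<Theta> p \<in> B'"
proof -
  show "\<Theta> p \<in> B'" for p unfolding B'_def by blast
  from this[of 0] this[of 1] this[of "[:[:0, 1:]:]"] this[of "[:0, 1:]"]
  show "0 \<in> B'" "1 \<in> B'" "u \<in> B'" "v \<in> B'"
    unfolding \<Theta>.zero \<Theta>.one Theta_U Theta_V .
  show "emb f \<in> B'" if "f \<in> R'"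
    using that by (auto simp: R'_def B'_def simp flip: Theta_const)
qed

lemma B'_add [intro]: "f \<in> B' \<Longrightarrow> g \<in> B' \<Longrightarrow> f + g \<in> B'"
  and B'_mult [intro]: "f \<in> B' \<Longrightarrow> g \<in> B' \<Longrightarrow> f * g \<in> B'"
  and B'_diff [intro]: "f \<in> B' \<Longrightarrow> g \<in> B' \<Longrightarrow> f - g \<in> B'"
  unfolding B'_def by (auto simp flip: \<Theta>.add \<Theta>.mult \<Theta>.diff)

lemma B'_induct [consumes 1, case_names emb u v add mult]:
  assumes "f \<in> B'" "\<And>g. g \<in> R' \<Longrightarrow> Q (emb g)" "Q u" "Q v"
    and "\<And>g h. g \<in> B' \<Longrightarrow> h \<in> B' \<Longrightarrow> Q g \<Longrightarrow> Q h \<Longrightarrow> Q (g + h)"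
      "\<And>g h. g \<in> B' \<Longrightarrow> h \<in> B' \<Longrightarrow> Q g \<Longrightarrow> Q h \<Longrightarrow> Q (g * h)"
  shows "Q f"
proof -
  obtain p where p: "f = \<Theta> p" using assms(1) by (auto simp: B'_def)
  have "\<Theta> p \<in> B' \<and> Q (\<Theta> p)"
    unfolding \<Theta>_def
    by (rule evp_closed[OF theta1], rule evp_closed[OF emb_psi]) (use assms in auto)
  with p show ?thesis by simp
qed

lemma B'_degree_0: "f \<in> B' \<Longrightarrow> Polynomial.degree f = 0 \<Longrightarrow> \<exists>g\<in>R'. f = emb g"
proof -
  assume "f \<in> B'" "Polynomial.degree f = 0"
  then obtain p where p: "f = \<Theta> p" "Polynomial.degree (\<Theta> p) = 0" by (auto simp: B'_def)
  then obtain g r where "\<Psi> p = \<Psi> (danielewski m n * g + [:[:r:]:])" using degree_Theta_0 by blast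
  then have "\<Theta> p = \<Theta> (danielewski m n * g + [:[:r:]:])" by (simp add: Theta_Psi)
  also have "\<dots> = emb (\<psi> r)" by (simp add: \<Theta>.add \<Theta>.mult Theta_danielewski Theta_const)
  finally show ?thesis using p by auto
qed


subsection \<open>The derivation and the automorphisms on the model\<close>

definition DD :: "'k poly fract poly \<Rightarrow> 'k poly fract poly" where
  "DD f = emb (x ^ m) * pderiv f"

lemma DD_add: "DD (f + g) = DD f + DD g"
  by (simp add: DD_def pderiv_add distrib_left)

lemma DD_diff: "DD (f - g) = DD f - DD g"
  by (simp add: DD_def pderiv_diff right_diff_distrib)

lemma DD_mult: "DD (f * g) = f * DD g + g * DD f"
  by (simp add: DD_def pderiv_mult algebra_simps)

lemma DD_emb [simp]: "DD (emb f) = 0"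
  by (simp add: DD_def emb_def pderiv_pCons)

lemma DD_v: "DD v = emb (x ^ m)"
  by (simp add: DD_def v_def pderiv_pCons)

lemma DD_u: "DD u = emb (y ^ n)"
  using x_nz by (simp add: DD_def u_def emb_def pderiv_pCons)

lemma DD_closed: "f \<in> B' \<Longrightarrow> DD f \<in> B'"
  by (induction rule: B'_induct) (auto simp: DD_u DD_v DD_add DD_mult)

lemma DD_eq_0D: "f \<in> B' \<Longrightarrow> DD f = 0 \<Longrightarrow> \<exists>g\<in>R'. f = emb g"
proof (rule B'_degree_0)
  assume "DD f = 0"
  then have 0: "pderiv f = 0" using x_nz by (simp add: DD_def)
  \<comment> \<open>Characteristic 0 is passed from \<open>K\<close> through \<open>K[w]\<close> to
    the fraction field, so that a vanishing derivative kills every nonconstant coefficient.\<close>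
  have "of_nat k = (to_fract (of_nat k) :: 'k poly fract)" for k
    by (induction k) simp_all
  then have nz: "of_nat (Suc k) \<noteq> (0 :: 'k poly fract)" for k
    by (metis of_nat_poly of_nat_eq_0_iff pCons_eq_0_iff nat.distinct(1) to_fract_eq_0_iff)
  have "Polynomial.coeff f (Suc k) = 0" for k
  proof -
    have "of_nat (Suc k) * Polynomial.coeff f (Suc k) = 0"
      using 0 by (metis Polynomial.coeff_0 coeff_pderiv)
    then show ?thesis using nz[of k] by (simp only: mult_eq_0_iff simp_thms)
  qed
  then show "Polynomial.degree f = 0"
    by (metis leading_coeff_neq_0 degree_0 not0_implies_Suc)
qed

section \<open>The torus action and the automorphisms built from it\<close>

definition \<tau> :: "complex \<Rightarrow> 'k poly \<Rightarrow> 'k poly" where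
  "\<tau> t p = pcompose p [:0, \<kappa> t:]"

lemma kappa_eq_0_iff [simp]: "\<kappa> k = 0 \<longleftrightarrow> k = 0"
proof
  assume "\<kappa> k = 0"
  then have "evp \<kappa> s [:k:] = 0" by (simp add: evp_const[OF \<kappa>])
  then show "k = 0" using transc by fastforce
qed simp

lemma kappa_eq_iff [simp]: "\<kappa> k = \<kappa> l \<longleftrightarrow> k = l"
  using kappa_eq_0_iff[of "k - l"] by (simp add: \<kappa>.diff)

lemma con_eq_iff [simp]: "con k = con l \<longleftrightarrow> k = l"
  by (simp add: con_def)

lemma con_eq_0_iff [simp]: "con k = 0 \<longleftrightarrow> k = 0"
  by (simp add: con_def)

lemma coeff_tau: "Polynomial.coeff (\<tau> t p) i = \<kappa> t ^ i * Polynomial.coeff p i"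
  by (simp add: \<tau>_def coeff_pcompose_linear)

lemma tau_map: "ring_map (\<tau> t)"
  by standard (simp_all add: \<tau>_def pcompose_1 pcompose_add pcompose_mult)

lemma tau_inj: "t \<noteq> 0 \<Longrightarrow> inj_ring_map (\<tau> t)"
proof (intro inj_ring_map.intro tau_map inj_ring_map_axioms.intro)
  fix q assume "t \<noteq> 0" "\<tau> t q = 0"
  then have "Polynomial.coeff q i = 0" for i
    using coeff_tau[of t q i] by simp
  then show "q = 0" by (metis leading_coeff_0_iff)
qed

lemma tau_gens: "\<tau> t (con k) = con k" "\<tau> t x = con (t ^ (b * c)) * x"
  "\<tau> t y = con (t ^ (a * c)) * y" "\<tau> t z = con (t ^ (a * b)) * z"
  by (rule poly_eqI; simp add: coeff_tau con_def x_def y_def z_def \<kappa>.power Polynomial.coeff_pCons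
      split: nat.split)+

lemma tau_closed: "f \<in> R' \<Longrightarrow> \<tau> t f \<in> R'"
  by (induction rule: R'_induct) (auto simp: tau_gens ring_map.add[OF tau_map] ring_map.mult[OF tau_map])

lemma tau_tau: "\<tau> t (\<tau> t' f) = \<tau> (t * t') f"
  by (rule poly_eqI) (simp add: coeff_tau \<kappa>.mult power_mult_distrib mult.assoc)

lemma tau_1 [simp]: "\<tau> 1 f = f"
  by (rule poly_eqI) (simp add: coeff_tau)

text \<open>The automorphism \<open>A t r\<close> below satisfies \<open>A D = t\<^bsup>ed\<^esup> D A\<close>; hence it commutes with \<open>h D\<close> exactly
  when \<open>\<theta> t h = h\<close>.\<close>

definition ed :: nat where "ed = b * c * m + a * c * n"

text \<open>Besides fixing \<open>h\<close>, this twisted substitution describes how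
  \<open>t\<close> acts on the additive parameter \<open>r\<close> when two automorphisms are
  composed.\<close>

definition \<theta> :: "complex \<Rightarrow> 'k poly \<Rightarrow> 'k poly" where
  "\<theta> t f = con (t ^ ed) * \<tau> t f"

lemma theta_add: "\<theta> t (f + g) = \<theta> t f + \<theta> t g"
  by (simp add: \<theta>_def ring_map.add[OF tau_map] distrib_left)

lemma theta_closed: "f \<in> R' \<Longrightarrow> \<theta> t f \<in> R'"
  by (auto simp: \<theta>_def intro!: R'_mult tau_closed)

lemma theta_theta: "\<theta> t (\<theta> t' f) = \<theta> (t * t') f"
  by (simp add: \<theta>_def ring_map.mult[OF tau_map] tau_gens tau_tau power_mult_distrib con.mult mult_ac)

lemma theta_1 [simp]: "\<theta> 1 f = f"
  by (simp add: \<theta>_def)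

text \<open>For \<open>t = 1\<close> the shift is the value of the exponential of
  \<open>r * DD\<close> at \<open>v\<close>. The scalar compensates the factor that
  \<open>\<tau> t\<close> puts on \<open>y ^ n\<close>, so that \<open>y ^ n * v\<close> changes
  only by the shift and the relation between \<open>u\<close> and \<open>v\<close> survives.\<close>

definition vt :: "complex \<Rightarrow> 'k poly \<Rightarrow> 'k poly fract poly" where
  "vt t r = emb (con (inverse (t ^ (a * c * n)))) * (v + emb (x ^ m * r))"

definition ut :: "complex \<Rightarrow> 'k poly \<Rightarrow> 'k poly fract poly" where
  "ut t r = emb (con (inverse (t ^ (b * c * m)))) * (u + emb (y ^ n * r))"

text \<open>Defined on all of \<open>K(w)[V]\<close>, where the image of \<open>V\<close> can be
  prescribed freely; the value at \<open>u\<close> is then forced by the relation, and stability of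
  \<open>B'\<close> is checked afterwards.\<close>

definition A :: "complex \<Rightarrow> 'k poly \<Rightarrow> 'k poly fract poly \<Rightarrow> 'k poly fract poly" where
  "A t r = evp (\<lambda>q. [:fract_map (\<tau> t) q:]) (vt t r)"

context
  fixes t :: complex
  assumes t: "t \<noteq> 0"
begin

lemma A_coeff_map: "ring_map (\<lambda>q. [:fract_map (\<tau> t) q:])"
  by (rule ring_map_comp[OF ring_map_const inj_ring_map.ring_map_fract_map[OF tau_inj[OF t]]])

lemma A_map: "ring_map (A t r)"
  unfolding A_def by (rule ring_map_evp[OF A_coeff_map])

lemma A_emb: "A t r (emb f) = emb (\<tau> t f)"
  unfolding A_def emb_def evp_const[OF A_coeff_map] inj_ring_map.fract_map_to_fract[OF tau_inj[OF t]] ..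

lemma A_v: "A t r v = vt t r"
  unfolding A_def v_def by (rule evp_var[OF A_coeff_map])

lemma con_inverse: "con (t ^ k) * con (inverse (t ^ k)) = 1"
  using t by (simp flip: con.mult)

lemma emb_con_inverse: "emb (con (t ^ k)) * (emb (con (inverse (t ^ k))) * f) = f"
  using con_inverse[of k] by (metis emb.mult emb.one mult.assoc mult_1)

lemma tau_x_power: "\<tau> t (x ^ m) = con (t ^ (b * c * m)) * x ^ m"
  and tau_y_power: "\<tau> t (y ^ n) = con (t ^ (a * c * n)) * y ^ n"
  by (simp_all add: ring_map.power[OF tau_map] tau_gens power_mult_distrib con.power power_mult)

lemma A_u: "A t r u = ut t r"
proof -
  have "A t r (emb (x ^ m) * u) = A t r (1 + emb (y ^ n) * v)" by (simp only: uv_relation)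
  then have "emb (con (t ^ (b * c * m))) * emb (x ^ m) * A t r u = 1 + emb (con (t ^ (a * c * n))) * emb (y ^ n) * vt t r"
    by (simp only: ring_map.mult[OF A_map] ring_map.add[OF A_map] ring_map.one[OF A_map] A_emb
        tau_x_power tau_y_power A_v emb.mult)
  also have "emb (con (t ^ (a * c * n))) * emb (y ^ n) * vt t r = emb (y ^ n) * (v + emb (x ^ m * r))"
  proof -
    have "emb (con (t ^ (a * c * n))) * emb (y ^ n) * vt t r = emb (y ^ n) * (emb (con (t ^ (a * c * n))) * vt t r)"
      by (simp only: mult_ac)
    then show ?thesis unfolding vt_def emb_con_inverse .
  qed
  also have "1 + \<dots> = emb (x ^ m) * u + emb (x ^ m * y ^ n * r)"
    unfolding uv_relation by (simp add: distrib_left mult_ac emb.mult)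
  also have "\<dots> = emb (x ^ m) * (emb (con (t ^ (b * c * m))) * ut t r)"
    unfolding ut_def emb_con_inverse by (simp add: distrib_left emb.mult mult.assoc)
  finally have "emb (x ^ m) * emb (con (t ^ (b * c * m))) * A t r u =
     emb (x ^ m) * emb (con (t ^ (b * c * m))) * ut t r"
    by (simp add: mult_ac)
  then show ?thesis using x_nz t by simp
qed

lemma A_closed:
  assumes "r \<in> R'" "f \<in> B'"
  shows "A t r f \<in> B'"
  using assms(2)
proof (induction rule: B'_induct)
  case (emb g)
  then show ?case by (simp add: A_emb tau_closed)
next
  case u
  show ?case unfolding A_u ut_def using assms(1) by (auto intro!: B'_mult B'_add)
next
  case v
  show ?case unfolding A_v vt_def using assms(1) by (auto intro!: B'_mult B'_add)
qed (auto simp: ring_map.add[OF A_map] ring_map.mult[OF A_map])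

text \<open>Both sides are derivations along the ring map \<open>A t r\<close>, so generators
  decide; \<open>ed\<close> is chosen so that the scalars match at \<open>u\<close> and at
  \<open>v\<close> simultaneously.\<close>

lemma A_DD:
  assumes "f \<in> B'"
  shows "A t r (DD f) = emb (con (t ^ ed)) * DD (A t r f)"
  using assms
proof (induction rule: B'_induct)
  case (emb g)
  show ?case by (simp add: A_emb ring_map.zero[OF A_map])
next
  case u
  have "con (t ^ ed) * con (inverse (t ^ (b * c * m))) = con (t ^ (a * c * n))"
    using t by (simp add: ed_def power_add flip: con.mult)
  then have "emb (con (t ^ ed)) * emb (con (inverse (t ^ (b * c * m)))) = emb (con (t ^ (a * c * n)))"
    by (simp flip: emb.mult)
  then show ?case
    by (simp add: A_u DD_u A_emb ut_def DD_mult DD_add tau_y_power emb.mult flip: mult.assoc)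
next
  case v
  have "con (t ^ ed) * con (inverse (t ^ (a * c * n))) = con (t ^ (b * c * m))"
    using t by (simp add: ed_def power_add flip: con.mult)
  then have "emb (con (t ^ ed)) * emb (con (inverse (t ^ (a * c * n)))) = emb (con (t ^ (b * c * m)))"
    by (simp flip: emb.mult)
  then show ?case
    by (simp add: A_v DD_v A_emb vt_def DD_mult DD_add tau_x_power emb.mult flip: mult.assoc)
next
  case (add g h)
  then show ?case by (simp add: ring_map.add[OF A_map] DD_add distrib_left)
next
  case (mult g h)
  then show ?case by (simp add: ring_map.add[OF A_map] ring_map.mult[OF A_map] DD_mult algebra_simps)
qed

end

text \<open>The source of the semidirect product law. On \<open>v\<close>, the inverse scalar of
  \<open>vt\<close> times \<open>t ^ ed\<close> is exactly the factor that \<open>\<tau> t\<close>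
  puts on \<open>x ^ m\<close>, so the second shift reappears as \<open>\<theta> t r'\<close>; on
  \<open>u\<close> the roles of \<open>x\<close> and \<open>y\<close> are exchanged.\<close>

lemma A_A:
  assumes t: "t \<noteq> 0" "t' \<noteq> 0" and "f \<in> B'"
  shows "A t r (A t' r' f) = A (t * t') (r + \<theta> t r') f"
  using assms(3)
proof (induction rule: B'_induct)
  case (emb g)
  show ?case using t by (simp add: A_emb tau_tau)
next
  case u
  have "con (inverse (t ^ (b * c * m))) * (con (t ^ ed) * (y ^ n * \<tau> t r')) = con (t ^ (a * c * n)) * y ^ n * \<tau> t r'"
    using t by (simp add: ed_def power_add flip: con.mult mult.assoc)
  then have "emb (con (inverse (t ^ (b * c * m)))) * emb (y ^ n * \<theta> t r') = emb (\<tau> t (y ^ n * r'))"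
    using t by (simp add: \<theta>_def ring_map.mult[OF tau_map] tau_y_power mult_ac flip: emb.mult)
  then have "A t r (u + emb (y ^ n * r')) = emb (con (inverse (t ^ (b * c * m)))) * (u + emb (y ^ n * (r + \<theta> t r')))"
    using t by (simp add: ring_map.add[OF A_map] A_emb A_u ut_def distrib_left emb.add)
  then show ?case
    using t by (simp add: A_u ut_def ring_map.mult[OF A_map] A_emb tau_gens power_mult_distrib con.mult emb.mult mult_ac)
next
  case v
  have "con (inverse (t ^ (a * c * n))) * (con (t ^ ed) * (x ^ m * \<tau> t r')) = con (t ^ (b * c * m)) * x ^ m * \<tau> t r'"
    using t by (simp add: ed_def power_add flip: con.mult mult.assoc)
  then have "emb (con (inverse (t ^ (a * c * n)))) * emb (x ^ m * \<theta> t r') = emb (\<tau> t (x ^ m * r'))"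
    using t by (simp add: \<theta>_def ring_map.mult[OF tau_map] tau_x_power mult_ac flip: emb.mult)
  then have "A t r (v + emb (x ^ m * r')) = emb (con (inverse (t ^ (a * c * n)))) * (v + emb (x ^ m * (r + \<theta> t r')))"
    using t by (simp add: ring_map.add[OF A_map] A_emb A_v vt_def distrib_left emb.add)
  then show ?case
    using t by (simp add: A_v vt_def ring_map.mult[OF A_map] A_emb tau_gens power_mult_distrib con.mult emb.mult mult_ac)
next
  case (add g h)
  then show ?case using t by (simp add: ring_map.add[OF A_map])
next
  case (mult g h)
  then show ?case using t by (simp add: ring_map.mult[OF A_map])
qed

lemma A_1:
  assumes "f \<in> B'" shows "A 1 0 f = f"
  using assms
proof (induction rule: B'_induct)
qed (simp_all add: A_emb A_u A_v ut_def vt_def ring_map.mult[OF A_map] ring_map.add[OF A_map])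

lemma A_bij:
  assumes t: "t \<noteq> 0" and r: "r \<in> R'"
  shows "bij_betw (A t r) B' B'"
\<comment> \<open>The witness comes from the composition law: the new shift must cancel
  \<open>\<theta> (inverse t) r\<close>.\<close>
proof (rule bij_betw_byWitness[where f' = "A (inverse t) (- \<theta> (inverse t) r)"])
  have r': "- \<theta> (inverse t) r \<in> R'" using r by (intro R'_uminus theta_closed)
  have "\<theta> t (- \<theta> (inverse t) r) = - r"
    using theta_add[of t "- \<theta> (inverse t) r" "\<theta> (inverse t) r"] t
    by (simp add: theta_theta eq_neg_iff_add_eq_0) (simp add: \<theta>_def ring_map.zero[OF tau_map])
  then show "\<forall>f\<in>B'. A (inverse t) (- \<theta> (inverse t) r) (A t r f) = f"
    "\<forall>f\<in>B'. A t r (A (inverse t) (- \<theta> (inverse t) r) f) = f"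
    using t by (simp_all add: A_A A_1)
  show "A t r ` B' \<subseteq> B'" "A (inverse t) (- \<theta> (inverse t) r) ` B' \<subseteq> B'"
    using A_closed[OF t r] A_closed[OF _ r', of "inverse t"] t by auto
qed

section \<open>Recovering the torus parameter from its three weighted powers\<close>

lemma bezout:
  obtains p q l :: int where "p * int (b * c) + q * int (a * c) + l * int (a * b) = 1"
proof -
  have "coprime (int (b * c)) (int a)" using cop by (simp add: coprime_commute)
  then obtain p e where pe: "p * int (b * c) + e * int a = 1" using bezout_int[of "int (b * c)" "int a"]
    by (metis coprime_iff_gcd_eq_1)
  have "coprime (int c) (int b)" using cop by (simp add: coprime_commute)
  then obtain q l where ql: "q * int c + l * int b = 1" using bezout_int[of "int c" "int b"]
    by (metis coprime_iff_gcd_eq_1)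
  have "p * int (b * c) + e * int a * (q * int c + l * int b) = 1" using pe ql by simp
  then have "p * int (b * c) + (e * q) * int (a * c) + (e * l) * int (a * b) = 1"
    by (simp add: algebra_simps)
  then show thesis by (rule that)
qed

lemma powi_bezout:
  fixes p q l :: int and r :: complex
  assumes pql: "p * int (b * c) + q * int (a * c) + l * int (a * b) = 1" and "r \<noteq> 0"
  shows "r = (r ^ (b * c)) powi p * (r ^ (a * c)) powi q * (r ^ (a * b)) powi l"
proof -
  have "r = r powi (int (b * c) * p + int (a * c) * q + int (a * b) * l)"
    using pql by (simp only: mult.commute[of p] mult.commute[of q] mult.commute[of l] power_int_1_right)
  also have "\<dots> = r powi (int (b * c) * p) * r powi (int (a * c) * q) * r powi (int (a * b) * l)"
    using assms(2) by (simp only: power_int_add simp_thms)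
  finally show ?thesis by (simp only: power_int_mult power_int_of_nat)
qed

lemma torus_unique:
  assumes "t \<noteq> 0" "t' \<noteq> 0" "t ^ (b * c) = t' ^ (b * c)" "t ^ (a * c) = t' ^ (a * c)" "t ^ (a * b) = t' ^ (a * b)"
  shows "t = (t' :: complex)"
proof -
  obtain p q l :: int where pql: "p * int (b * c) + q * int (a * c) + l * int (a * b) = 1" by (rule bezout)
  note * = powi_bezout[OF pql]
  show ?thesis using *[OF assms(1)] *[OF assms(2)] assms(3-5) by simp
qed

text \<open>The tuples with \<open>l1 ^ a = l2 ^ b = l3 ^ c\<close> form a single one-parameter
  group because the weights have greatest common divisor 1. Taking \<open>t\<close> as the product
  with Bezout exponents, these equations turn \<open>t ^ (b * c)\<close> into powers of
  \<open>l1\<close> alone, whose total exponent is 1; the other two are similar.\<close>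

lemma torus_exists:
  fixes l1 l2 l3 :: complex
  assumes nz: "l1 \<noteq> 0" "l2 \<noteq> 0" "l3 \<noteq> 0" and eq: "l1 ^ a = l2 ^ b" "l1 ^ a = l3 ^ c"
  obtains t where "t \<noteq> 0" "l1 = t ^ (b * c)" "l2 = t ^ (a * c)" "l3 = t ^ (a * b)"
proof -
  obtain p q l :: int where pql: "p * int (b * c) + q * int (a * c) + l * int (a * b) = 1" by (rule bezout)
  define t where "t = l1 powi p * l2 powi q * l3 powi l"
  have tp: "t ^ k = (l1 ^ k) powi p * (l2 ^ k) powi q * (l3 ^ k) powi l" for k
  proof -
    have "(r powi i) ^ k = (r ^ k) powi i" for r :: complex and i
      by (simp add: power_int_def power_mult[symmetric] power_inverse mult.commute)
    then show ?thesis by (simp only: t_def power_mult_distrib)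
  qed
  note * = powi_bezout[OF pql]
  have e2: "l2 ^ (b * k) = l1 ^ (a * k)" "l3 ^ (c * k) = l1 ^ (a * k)" "l3 ^ (c * k) = l2 ^ (b * k)" for k
    using eq by (simp_all add: power_mult)
  show thesis
  proof (rule that)
    show "t \<noteq> 0" using nz by (simp add: t_def)
    show "l1 = t ^ (b * c)"
      using *[OF nz(1)] e2(1)[of c] e2(2)[of b] by (simp add: tp mult.commute)
    show "l2 = t ^ (a * c)"
      using *[OF nz(2)] e2(1)[of c] e2(3)[of a] by (simp add: tp mult.commute)
    show "l3 = t ^ (a * b)"
      using *[OF nz(3)] e2(2)[of b] e2(3)[of a] by (simp add: tp mult.commute)
  qed
qed

lemma A_params_unique:
  assumes "t \<noteq> 0" "t' \<noteq> 0" "\<And>f. f \<in> B' \<Longrightarrow> A t r f = A t' r' f"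
  shows "t = t'" "r = r'"
proof -
  have *: "\<tau> t f = \<tau> t' f" if "f \<in> R'" for f
    using assms(3)[OF B'_closed(1)[OF that]] unfolding A_emb[OF assms(1)] A_emb[OF assms(2)] emb_eq_iff .
  have "t ^ (b * c) = t' ^ (b * c)" "t ^ (a * c) = t' ^ (a * c)" "t ^ (a * b) = t' ^ (a * b)"
    using *[OF R'_closed(1)] *[OF R'_closed(2)] *[OF R'_closed(3)] x_nz y_nz z_nz
    unfolding tau_gens mult_cancel_right con_eq_iff by auto
  then show "t = t'" by (rule torus_unique[OF assms(1,2)])
  with assms have "vt t r = vt t r'"
    using assms(3)[of v] by (simp add: A_v)
  then show "r = r'" using assms(1) x_nz by (simp add: vt_def)
qed


subsection \<open>Automorphisms of \<open>R\<close>\<close>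

lemma R'_coeff_0: "f \<in> R' \<Longrightarrow> \<exists>k. Polynomial.coeff f 0 = \<kappa> k"
  by (induction rule: R'_induct)
    (use a2 b2 c2 in \<open>auto simp: con_def x_def y_def z_def coeff_mult_0 simp flip: \<kappa>.add \<kappa>.mult\<close>)

text \<open>The congruence forces the relevant exponent to be nonzero, and by size it then uses up
  the whole weight.\<close>

lemma wt_gen:
  "wt i j k = b * c \<Longrightarrow> i = 1 \<and> j = 0 \<and> k = 0"
  "wt i j k = a * c \<Longrightarrow> i = 0 \<and> j = 1 \<and> k = 0"
  "wt i j k = a * b \<Longrightarrow> i = 0 \<and> j = 0 \<and> k = 1"
proof -
  have le1: "i \<le> 1 \<and> (i = 1 \<longrightarrow> r = 0)" if "i * d + r = d" "d > 0" for i d r :: nat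
  proof (cases i)
    case (Suc l)
    then have "l * d + r = 0" using that by simp
    with Suc that show ?thesis by simp
  qed simp
  have pos: "a > 0" "b > 0" "c > 0" using a2 b2 c2 by auto
  show "i = 1 \<and> j = 0 \<and> k = 0" if w: "wt i j k = b * c"
  proof -
    have "[i = 1] (mod a)" using wt_mod(1)[of i j k 1 0 0] w by (simp add: wt_def)
    then have "i \<noteq> 0" using a2 by (intro notI) (simp add: cong_def)
    moreover have "i \<le> 1 \<and> (i = 1 \<longrightarrow> j * (a * c) + k * (a * b) = 0)"
      by (rule le1[of i "b * c"]) (use w pos in \<open>simp_all add: wt_def\<close>)
    ultimately show ?thesis using pos by (cases i) auto
  qed
  show "i = 0 \<and> j = 1 \<and> k = 0" if w: "wt i j k = a * c"
  proof -
    have "[j = 1] (mod b)" using wt_mod(2)[of i j k 0 1 0] w by (simp add: wt_def)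
    then have "j \<noteq> 0" using b2 by (intro notI) (simp add: cong_def)
    moreover have "j \<le> 1 \<and> (j = 1 \<longrightarrow> i * (b * c) + k * (a * b) = 0)"
      by (rule le1[of j "a * c"]) (use w pos in \<open>simp_all add: wt_def\<close>)
    ultimately show ?thesis using pos by (cases j) auto
  qed
  show "i = 0 \<and> j = 0 \<and> k = 1" if w: "wt i j k = a * b"
  proof -
    have "[k = 1] (mod c)" using wt_mod(3)[of i j k 0 0 1] w by (simp add: wt_def)
    then have "k \<noteq> 0" using c2 by (intro notI) (simp add: cong_def)
    moreover have "k \<le> 1 \<and> (k = 1 \<longrightarrow> i * (b * c) + j * (a * c) = 0)"
      by (rule le1[of k "a * b"]) (use w pos in \<open>simp_all add: wt_def\<close>)
    ultimately show ?thesis using pos by (cases k) auto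
  qed
qed

text \<open>The descent from \<open>K\<close> to complex scalars: in these weights a coefficient of
  an element of \<open>R'\<close> comes from one monomial only.\<close>

lemma R'_monomials:
  "Polynomial.monom \<alpha> (b * c) \<in> R' \<Longrightarrow> \<exists>k. Polynomial.monom \<alpha> (b * c) = con k * x"
  "Polynomial.monom \<alpha> (a * c) \<in> R' \<Longrightarrow> \<exists>k. Polynomial.monom \<alpha> (a * c) = con k * y"
  "Polynomial.monom \<alpha> (a * b) \<in> R' \<Longrightarrow> \<exists>k. Polynomial.monom \<alpha> (a * b) = con k * z"
proof -
  show "\<exists>k. Polynomial.monom \<alpha> (b * c) = con k * x" if "Polynomial.monom \<alpha> (b * c) \<in> R'"
  proof -
    obtain p where p: "Polynomial.monom \<alpha> (b * c) = \<psi> p" using \<open>_ \<in> R'\<close> by (auto simp: R'_def)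
    have "\<alpha> = Polynomial.coeff (\<psi> p) (b * c)" unfolding p[symmetric] by simp
    also have "\<dots> = \<kappa> (cf p 1 0 0) * s ^ 1 * z0 ^ 0"
      by (rule coeff_psi_unique) (use wt_gen(1) in \<open>auto simp: wt_def\<close>)
    finally show ?thesis by (auto simp: con_def x_def smult_monom)
  qed
  show "\<exists>k. Polynomial.monom \<alpha> (a * c) = con k * y" if "Polynomial.monom \<alpha> (a * c) \<in> R'"
  proof -
    obtain p where p: "Polynomial.monom \<alpha> (a * c) = \<psi> p" using \<open>_ \<in> R'\<close> by (auto simp: R'_def)
    have "\<alpha> = Polynomial.coeff (\<psi> p) (a * c)" unfolding p[symmetric] by simp
    also have "\<dots> = \<kappa> (cf p 0 1 0) * s ^ 0 * z0 ^ 0"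
      by (rule coeff_psi_unique) (use wt_gen(2) in \<open>auto simp: wt_def\<close>)
    finally show ?thesis by (auto simp: con_def y_def smult_monom)
  qed
  show "\<exists>k. Polynomial.monom \<alpha> (a * b) = con k * z" if "Polynomial.monom \<alpha> (a * b) \<in> R'"
  proof -
    obtain p where p: "Polynomial.monom \<alpha> (a * b) = \<psi> p" using \<open>_ \<in> R'\<close> by (auto simp: R'_def)
    have "\<alpha> = Polynomial.coeff (\<psi> p) (a * b)" unfolding p[symmetric] by simp
    also have "\<dots> = \<kappa> (cf p 0 0 1) * s ^ 0 * z0 ^ 1"
      by (rule coeff_psi_unique) (use wt_gen(3) in \<open>auto simp: wt_def\<close>)
    finally show ?thesis by (auto simp: con_def z_def smult_monom)
  qed
qed

lemma transc_binomial:
  assumes "\<kappa> k * s ^ a = \<kappa> l"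
  shows "k = 0" "l = 0"
proof -
  have "evp \<kappa> s (Polynomial.monom k a - [:l:]) = 0"
    using assms by (simp add: ring_map.diff[OF ring_map_evp[OF \<kappa>]] evp_monom[OF \<kappa>] evp_const[OF \<kappa>])
  then have 0: "Polynomial.monom k a - [:l:] = 0" by (rule transc)
  have "Polynomial.coeff (Polynomial.monom k a - [:l:]) a = 0" "Polynomial.coeff (Polynomial.monom k a - [:l:]) 0 = 0"
    unfolding 0 by simp_all
  then show "k = 0" "l = 0" using a2 by (auto simp: Polynomial.coeff_pCons split: nat.splits)
qed

text \<open>Mason-Stothers leaves the exponents \<open>b*c*e\<close>, \<open>a*c*e\<close>,
  \<open>a*b*e\<close> with an unknown common \<open>e\<close>. The image is supported on multiples
  of \<open>e\<close> and, by surjectivity, contains \<open>x\<close>, \<open>y\<close>,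
  \<open>z\<close>, so Bezout gives \<open>e = 1\<close>.\<close>

lemma automorphism_R':
  assumes closed: "\<And>f. f \<in> R' \<Longrightarrow> \<sigma> f \<in> R'"
    and add: "\<And>f g. f \<in> R' \<Longrightarrow> g \<in> R' \<Longrightarrow> \<sigma> (f + g) = \<sigma> f + \<sigma> g"
    and mult: "\<And>f g. f \<in> R' \<Longrightarrow> g \<in> R' \<Longrightarrow> \<sigma> (f * g) = \<sigma> f * \<sigma> g"
    and const: "\<And>k. \<sigma> (con k) = con k"
    and inj: "\<And>f. f \<in> R' \<Longrightarrow> \<sigma> f = 0 \<Longrightarrow> f = 0"
    and surj: "\<And>g. g \<in> R' \<Longrightarrow> \<exists>f\<in>R'. \<sigma> f = g"
  obtains t where "t \<noteq> 0" "\<And>f. f \<in> R' \<Longrightarrow> \<sigma> f = \<tau> t f"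
proof -
  have pos: "a > 0" "b > 0" "c > 0" using a2 b2 c2 by auto
  have one: "\<sigma> 1 = 1" using const[of 1] by simp
  have pow: "\<sigma> (f ^ k) = \<sigma> f ^ k" if "f \<in> R'" for f k
    using that by (induction k) (simp_all add: one mult R'_power)
  have sum: "\<sigma> x ^ a + \<sigma> y ^ b + \<sigma> z ^ c = 0"
    using xyz_relation const[of 0] by (simp add: R'_power R'_add flip: pow add)
  have nz: "\<sigma> x \<noteq> 0" "\<sigma> y \<noteq> 0" "\<sigma> z \<noteq> 0"
    using inj x_nz y_nz z_nz by blast+
  have root: "w = 0" if w: "poly (\<sigma> x) w = 0" "poly (\<sigma> y) w = 0" "poly (\<sigma> z) w = 0" for w
  proof (rule ccontr)
    assume w0: "w \<noteq> 0"
    \<comment> \<open>Evaluation of \<open>\<sigma> f\<close> at a common zero kills the generators,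
      hence has complex values. By surjectivity the values of \<open>x\<close> and \<open>y\<close>
      at \<open>w\<close> are complex too, whereas the \<open>a\<close>-th power of the former is
      \<open>s ^ a\<close> times the \<open>b\<close>-th power of the latter.\<close>
    have *: "\<exists>k. poly (\<sigma> f) w = \<kappa> k" if "f \<in> R'" for f
      using that
    proof (induction rule: R'_induct)
      case (con k)
      have "poly (\<sigma> (con k)) w = \<kappa> k" unfolding const by (simp add: con_def)
      then show ?case by blast
    next
      case (add g h)
      then obtain k l where "poly (\<sigma> g) w = \<kappa> k" "poly (\<sigma> h) w = \<kappa> l" by blast
      then have "poly (\<sigma> (g + h)) w = \<kappa> (k + l)" using add.hyps by (simp add: assms(2) \<kappa>.add)
      then show ?case by blast
    next
      case (mult g h)
      then obtain k l where "poly (\<sigma> g) w = \<kappa> k" "poly (\<sigma> h) w = \<kappa> l" by blast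
      then have "poly (\<sigma> (g * h)) w = \<kappa> (k * l)" using mult.hyps by (simp add: assms(3) \<kappa>.mult)
      then show ?case by blast
    qed (use w \<kappa>.zero in metis)+
    obtain k where "poly x w = \<kappa> k" using *[of _] surj[OF R'_closed(1)] by metis
    then have k: "s * w ^ (b * c) = \<kappa> k" by (simp add: x_def poly_monom)
    obtain l where "poly y w = \<kappa> l" using *[of _] surj[OF R'_closed(2)] by metis
    then have l: "w ^ (a * c) = \<kappa> l" by (simp add: y_def poly_monom)
    have "\<kappa> (l ^ b) * s ^ a = (s * w ^ (b * c)) ^ a"
      unfolding \<kappa>.power l[symmetric] by (simp add: power_mult_distrib mult_ac flip: power_mult)
    also have "\<dots> = \<kappa> (k ^ a)" by (simp add: k \<kappa>.power)
    finally have "l ^ b = 0" by (rule transc_binomial)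
    then have "l = 0" by simp
    then show False using l w0 by simp
  qed
  obtain i j k \<alpha> \<beta> \<gamma> where mono: "\<sigma> x = Polynomial.monom \<alpha> i" "\<sigma> y = Polynomial.monom \<beta> j"
      "\<sigma> z = Polynomial.monom \<gamma> k" and ijk: "a * i = b * j" "a * i = c * k"
    by (rule mason_monomials[OF nz sum root pos lt1]; (assumption | (rule that; assumption)))
  have "b dvd i" using ijk(1) cop by (metis coprime_commute coprime_dvd_mult_right_iff dvd_triv_left)
  moreover have "c dvd i" using ijk(2) cop by (metis coprime_commute coprime_dvd_mult_right_iff dvd_triv_left)
  ultimately have "b * c dvd i" using cop by (simp add: divides_mult)
  then obtain e where i: "i = b * c * e" by auto
  have j: "j = a * c * e" using ijk(1) pos unfolding i by (simp add: mult_ac)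
  have k: "k = a * b * e" using ijk(2) pos unfolding i by (simp add: mult_ac)
  have supp: "\<forall>d. Polynomial.coeff (\<sigma> f) d \<noteq> 0 \<longrightarrow> e dvd d" if "f \<in> R'" for f
    using that
  proof (induction rule: R'_induct)
    case (con k)
    show ?case unfolding const by (auto simp: con_def Polynomial.coeff_pCons split: nat.splits)
  next
    case (add g h)
    then show ?case by (auto simp: assms(2)) (metis add_0)
  next
    case (mult g h)
    show ?case
    proof (intro allI impI)
      fix d assume "Polynomial.coeff (\<sigma> (g * h)) d \<noteq> 0"
      then have "(\<Sum>i\<le>d. Polynomial.coeff (\<sigma> g) i * Polynomial.coeff (\<sigma> h) (d - i)) \<noteq> 0"
        using mult.hyps by (simp add: assms(3) Polynomial.coeff_mult)
      then obtain i where i: "i \<le> d" "Polynomial.coeff (\<sigma> g) i * Polynomial.coeff (\<sigma> h) (d - i) \<noteq> 0"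
        by (meson atMost_iff sum.not_neutral_contains_not_neutral)
      then have "e dvd i" "e dvd d - i" using mult.IH by auto
      then have "e dvd i + (d - i)" by (rule dvd_add)
      with i show "e dvd d" by simp
    qed
  qed (auto simp: mono i j k split: if_splits)
  have "e dvd b * c" "e dvd a * c" "e dvd a * b"
  proof -
    obtain f where "f \<in> R'" "\<sigma> f = x" using surj[OF R'_closed(1)] by blast
    then show "e dvd b * c" using supp[of f] s_nz by (auto simp: x_def)
    obtain f where "f \<in> R'" "\<sigma> f = y" using surj[OF R'_closed(2)] by blast
    then show "e dvd a * c" using supp[of f] by (auto simp: y_def)
    obtain f where "f \<in> R'" "\<sigma> f = z" using surj[OF R'_closed(3)] by blast
    then show "e dvd a * b" using supp[of f] z0_nz by (auto simp: z_def)
  qed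
  moreover obtain p q l :: int where pql: "p * int (b * c) + q * int (a * c) + l * int (a * b) = 1" by (rule bezout)
  ultimately have "int e dvd p * int (b * c) + q * int (a * c) + l * int (a * b)"
    by (intro dvd_add dvd_mult) (simp_all only: int_dvd_int_iff)
  then have e: "e = 1" unfolding pql by simp
  obtain l1 where l1: "\<sigma> x = con l1 * x"
    using R'_monomials(1)[of \<alpha>] closed[OF R'_closed(1)] unfolding mono i e by auto
  obtain l2 where l2: "\<sigma> y = con l2 * y"
    using R'_monomials(2)[of \<beta>] closed[OF R'_closed(2)] unfolding mono j e by auto
  obtain l3 where l3: "\<sigma> z = con l3 * z"
    using R'_monomials(3)[of \<gamma>] closed[OF R'_closed(3)] unfolding mono k e by auto
  have lnz: "l1 \<noteq> 0" "l2 \<noteq> 0" "l3 \<noteq> 0" using nz by (auto simp: l1 l2 l3)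
  \<comment> \<open>All three powers are monomials of degree \<open>a * b * c\<close>. Eliminating
    \<open>z0 ^ c\<close> leaves a complex binomial in \<open>s ^ a\<close>, whose two coefficients
    must vanish separately.\<close>
  have "0 = Polynomial.coeff (\<sigma> x ^ a + \<sigma> y ^ b + \<sigma> z ^ c) (a * b * c)" by (simp add: sum)
  also have "\<dots> = \<kappa> (l1 ^ a) * s ^ a + \<kappa> (l2 ^ b) + \<kappa> (l3 ^ c) * z0 ^ c"
    unfolding l1 l2 l3 unfolding con_def x_def y_def z_def
    by (simp add: smult_monom monom_power \<kappa>.power power_mult_distrib mult_ac)
  also have "z0 ^ c = - (s ^ a + 1)" using z0 by (metis add.commute minus_unique)
  finally have "\<kappa> (l1 ^ a - l3 ^ c) * s ^ a = \<kappa> (l3 ^ c - l2 ^ b)"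
    by (simp add: \<kappa>.diff algebra_simps)
  then have "l1 ^ a - l3 ^ c = 0" "l3 ^ c - l2 ^ b = 0" by (rule transc_binomial)+
  then have "l1 ^ a = l2 ^ b" "l1 ^ a = l3 ^ c" by auto
  then obtain t where t: "t \<noteq> 0" "l1 = t ^ (b * c)" "l2 = t ^ (a * c)" "l3 = t ^ (a * b)"
    using torus_exists[OF lnz] by blast
  show thesis
  proof (rule that[OF t(1)])
    show "\<sigma> f = \<tau> t f" if "f \<in> R'" for f
      using that
    proof (induction rule: R'_induct)
    qed (use t in \<open>simp_all add: const tau_gens l1 l2 l3 assms(2,3) ring_map.add[OF tau_map] ring_map.mult[OF tau_map]\<close>)
  qed
qed

subsection \<open>Automorphisms of \<open>B\<^sub>m\<^sub>,\<^sub>n\<close> commuting with the derivation\<close>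

lemma degree_tau: "t \<noteq> 0 \<Longrightarrow> Polynomial.degree (\<tau> t f) = Polynomial.degree f"
  by (simp add: \<tau>_def degree_pcompose)

lemma R'_degree_0: "f \<in> R' \<Longrightarrow> Polynomial.degree f = 0 \<Longrightarrow> \<exists>k. f = con k"
  using R'_coeff_0[of f] by (auto simp: con_def elim!: degree_eq_zeroE)

text \<open>The kernel part reduces to automorphisms of \<open>R\<close>. Regularity is used twice:
  on the derivatives of \<open>\<alpha> u\<close> and \<open>\<alpha> v\<close>, to give them a
  common factor \<open>q\<close>, and on their constant parts, to give these a common shift
  \<open>r\<close>.\<close>

theorem automorphism_B':
  assumes closed: "\<And>f. f \<in> B' \<Longrightarrow> \<alpha> f \<in> B'"
    and add: "\<And>f g. f \<in> B' \<Longrightarrow> g \<in> B' \<Longrightarrow> \<alpha> (f + g) = \<alpha> f + \<alpha> g"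
    and mult: "\<And>f g. f \<in> B' \<Longrightarrow> g \<in> B' \<Longrightarrow> \<alpha> (f * g) = \<alpha> f * \<alpha> g"
    and const: "\<And>k. \<alpha> (emb (con k)) = emb (con k)"
    and bij: "bij_betw \<alpha> B' B'"
    and h: "h \<in> R'" "h \<noteq> 0"
    and comm: "\<And>f. f \<in> B' \<Longrightarrow> \<alpha> (emb h * DD f) = emb h * DD (\<alpha> f)"
  obtains t r where "t \<noteq> 0" "r \<in> R'" "\<theta> t h = h" "\<And>f. f \<in> B' \<Longrightarrow> \<alpha> f = A t r f"
proof -
  have \<alpha>0: "\<alpha> 0 = 0" using const[of 0] by simp
  have \<alpha>1: "\<alpha> 1 = 1" using const[of 1] by simp
  have inj: "f = g" if "f \<in> B'" "g \<in> B'" "\<alpha> f = \<alpha> g" for f g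
    using that bij by (auto simp: bij_betw_def inj_on_def)
  have ker: "DD (\<alpha> f) = 0 \<longleftrightarrow> DD f = 0" if f: "f \<in> B'" for f
  proof -
    have "DD (\<alpha> f) = 0 \<longleftrightarrow> \<alpha> (emb h * DD f) = \<alpha> 0" unfolding comm[OF f] \<alpha>0 using h by simp
    also have "\<dots> \<longleftrightarrow> emb h * DD f = 0"
      using inj[of "emb h * DD f" 0] f h by (auto intro!: B'_mult DD_closed)
    finally show ?thesis using h by simp
  qed
  \<comment> \<open>The restriction of \<alpha> to the kernel, read back through \<open>emb\<close>;
    it is meaningful on \<open>R'\<close> only.\<close>
  define \<sigma> where "\<sigma> f = (SOME g. g \<in> R' \<and> \<alpha> (emb f) = emb g)" for f
  have \<sigma>: "\<sigma> f \<in> R' \<and> \<alpha> (emb f) = emb (\<sigma> f)" if "f \<in> R'" for f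
    unfolding \<sigma>_def
  proof (rule someI_ex)
    have "DD (\<alpha> (emb f)) = 0" using ker[of "emb f"] that by simp
    then show "\<exists>g. g \<in> R' \<and> \<alpha> (emb f) = emb g"
      using DD_eq_0D[of "\<alpha> (emb f)"] closed that by blast
  qed
  obtain t where t: "t \<noteq> 0" "\<And>f. f \<in> R' \<Longrightarrow> \<sigma> f = \<tau> t f"
  proof (rule automorphism_R'[of \<sigma>])
    show "\<sigma> f \<in> R'" if "f \<in> R'" for f using \<sigma>[OF that] by blast
    show "\<sigma> (f + g) = \<sigma> f + \<sigma> g" if "f \<in> R'" "g \<in> R'" for f g
    proof -
      have "emb (\<sigma> (f + g)) = \<alpha> (emb f + emb g)"
        using \<sigma>[OF R'_add[OF that]] by (simp add: emb.add)
      also have "\<dots> = emb (\<sigma> f + \<sigma> g)"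
        using \<sigma>[OF that(1)] \<sigma>[OF that(2)] that by (simp add: add emb.add)
      finally show ?thesis by simp
    qed
    show "\<sigma> (f * g) = \<sigma> f * \<sigma> g" if "f \<in> R'" "g \<in> R'" for f g
    proof -
      have "emb (\<sigma> (f * g)) = \<alpha> (emb f * emb g)"
        using \<sigma>[OF R'_mult[OF that]] by (simp add: emb.mult)
      also have "\<dots> = emb (\<sigma> f * \<sigma> g)"
        using \<sigma>[OF that(1)] \<sigma>[OF that(2)] that by (simp add: mult emb.mult)
      finally show ?thesis by simp
    qed
    show "\<sigma> (con k) = con k" for k
      using \<sigma>[of "con k"] const[of k] by simp
    show "f = 0" if "f \<in> R'" "\<sigma> f = 0" for f
    proof -
      have "\<alpha> (emb f) = \<alpha> 0" using \<sigma>[OF that(1)] that(2) \<alpha>0 by simp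
      then show ?thesis using inj[of "emb f" 0] that(1) by simp
    qed
    show "\<exists>f\<in>R'. \<sigma> f = g" if g: "g \<in> R'" for g
    proof -
      obtain f where f: "f \<in> B'" "\<alpha> f = emb g"
        using bij g B'_closed(1)[OF g] by (metis bij_betw_def imageE)
      then have "DD f = 0" using ker[of f] by simp
      then obtain f' where "f' \<in> R'" "f = emb f'" using DD_eq_0D f by blast
      then show ?thesis using \<sigma>[of f'] f by auto
    qed
  qed blast
  have \<alpha>_emb: "\<alpha> (emb f) = emb (\<tau> t f)" if "f \<in> R'" for f
    using \<sigma>[OF that] t(2)[OF that] by simp
  \<comment> \<open>Multiplied by \<open>emb h\<close>, the derivative of \<open>\<alpha> f\<close>
    is the image under \<alpha> of a kernel element, so it is itself killed by \<open>DD\<close> and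
    comes from \<open>R'\<close>.\<close>
  have D\<alpha>: "\<exists>g\<in>R'. DD (\<alpha> f) = emb g \<and> h * g = \<tau> t h * \<tau> t q" if f: "f \<in> B'" "DD f = emb q" "q \<in> R'" for f q
  proof -
    have e: "emb h * DD (\<alpha> f) = emb (\<tau> t h * \<tau> t q)"
      using comm[OF f(1)] f h \<alpha>_emb[of "h * q"]
      by (simp add: R'_mult ring_map.mult[OF tau_map] emb.mult)
    have "DD (DD (\<alpha> f)) = 0"
    proof -
      have "emb h * DD (DD (\<alpha> f)) = DD (emb h * DD (\<alpha> f))" by (simp add: DD_mult)
      also have "\<dots> = 0" unfolding e by simp
      finally show ?thesis using h by simp
    qed
    then obtain g where g: "g \<in> R'" "DD (\<alpha> f) = emb g"
      using DD_eq_0D[OF DD_closed[OF closed[OF f(1)]]] by blast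
    have "h * g = \<tau> t h * \<tau> t q" using e unfolding g(2) by (simp flip: emb.mult)
    with g show ?thesis by blast
  qed
  obtain g1 where g1: "g1 \<in> R'" "DD (\<alpha> u) = emb g1" "h * g1 = \<tau> t h * \<tau> t (y ^ n)"
    using D\<alpha>[OF B'_closed(2) DD_u] R'_power by blast
  obtain g2 where g2: "g2 \<in> R'" "DD (\<alpha> v) = emb g2" "h * g2 = \<tau> t h * \<tau> t (x ^ m)"
    using D\<alpha>[OF B'_closed(3) DD_v] R'_power by blast
  define cx cy where "cx = t ^ (b * c * m)" and "cy = t ^ (a * c * n)"
  have cnz: "cx \<noteq> 0" "cy \<noteq> 0" using t by (auto simp: cx_def cy_def)
  have \<tau>xy: "\<tau> t (x ^ m) = con cx * x ^ m" "\<tau> t (y ^ n) = con cy * y ^ n"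
    using tau_x_power[OF t(1)] tau_y_power[OF t(1)] by (simp_all add: cx_def cy_def)
  have ci: "con (inverse k) * (con k * f) = f" if "k \<noteq> 0" for k f
  proof -
    have "con (inverse k) * con k = 1" using that by (simp flip: con.mult)
    then show ?thesis by (simp flip: mult.assoc)
  qed
  have "h * (x ^ m * (con cx * g1)) = h * (y ^ n * (con cy * g2))"
  proof -
    have "h * (x ^ m * (con cx * g1)) = con cx * x ^ m * (h * g1)" by (simp add: mult_ac)
    also have "\<dots> = con cy * y ^ n * (h * g2)" unfolding g1(3) g2(3) \<tau>xy by (simp add: mult_ac)
    finally show ?thesis by (simp add: mult_ac)
  qed
  then have reg: "x ^ m * (con cx * g1) = y ^ n * (con cy * g2)" using h by simp
  then obtain q where q: "q \<in> R'" "con cx * g1 = y ^ n * q"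
    using R'_regular[of "con cx * g1" "con cy * g2" m n] g1(1) g2(1) by (auto intro: R'_mult)
  have q2: "con cy * g2 = x ^ m * q"
    using reg y_nz unfolding q(2) by (simp add: mult.left_commute)
  have "y ^ n * (h * q) = y ^ n * (con cx * con cy * \<tau> t h)"
  proof -
    have "y ^ n * (h * q) = con cx * (h * g1)" using q(2) by (simp add: mult_ac)
    then show ?thesis unfolding g1(3) \<tau>xy by (simp add: mult_ac)
  qed
  then have hq: "h * q = con (cx * cy) * \<tau> t h" using y_nz by (simp add: con.mult)
  \<comment> \<open>Since \<open>\<tau> t\<close> keeps degrees, \<open>q\<close> has degree 0, and
    a constant in \<open>R'\<close> is a complex number.\<close>
  have "Polynomial.degree (h * q) = Polynomial.degree h"
    unfolding hq con_def using cnz degree_tau[OF t(1)] by simp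
  moreover have "q \<noteq> 0"
  proof
    assume "q = 0"
    then have "\<tau> t h = 0" using hq cnz by simp
    then show False using inj_ring_map.inj_zero[OF tau_inj[OF t(1)]] h by blast
  qed
  ultimately have "Polynomial.degree q = 0" using h by (simp add: degree_mult_eq)
  then obtain k where k: "q = con k" using R'_degree_0 q(1) by blast
  have g1': "g1 = con (inverse cx * k) * y ^ n"
    using ci[OF cnz(1), of g1] unfolding q(2) k by (simp add: con.mult mult_ac)
  have g2': "g2 = con (inverse cy * k) * x ^ m"
    using ci[OF cnz(2), of g2] unfolding q2 k by (simp add: con.mult mult_ac)
  have "DD (\<alpha> u - emb (con (inverse cx * k)) * u) = 0"
    by (simp add: DD_diff DD_mult DD_u g1(2) g1' emb.mult)
  then obtain r1 where r1: "r1 \<in> R'" "\<alpha> u - emb (con (inverse cx * k)) * u = emb r1"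
    using DD_eq_0D closed by (metis B'_closed(1,2) B'_diff B'_mult R'_closed(4))
  have "DD (\<alpha> v - emb (con (inverse cy * k)) * v) = 0"
    by (simp add: DD_diff DD_mult DD_v g2(2) g2' emb.mult)
  then obtain r2 where r2: "r2 \<in> R'" "\<alpha> v - emb (con (inverse cy * k)) * v = emb r2"
    using DD_eq_0D closed by (metis B'_closed(1,3) B'_diff B'_mult R'_closed(4))
  have \<alpha>u: "\<alpha> u = emb (con (inverse cx * k)) * u + emb r1"
    and \<alpha>v: "\<alpha> v = emb (con (inverse cy * k)) * v + emb r2"
    using r1(2) r2(2) by (simp_all add: algebra_simps)
  have cx: "emb (con cx) * emb (con (inverse cx * k)) = emb (con k)"
    and cy: "emb (con cy) * emb (con (inverse cy * k)) = emb (con k)"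
    using cnz by (simp_all flip: emb.mult con.mult mult.assoc)
  have "\<alpha> (emb (x ^ m) * u) = \<alpha> (1 + emb (y ^ n) * v)" unfolding uv_relation ..
  then have "emb (con cx) * emb (x ^ m) * \<alpha> u = 1 + emb (con cy) * emb (y ^ n) * \<alpha> v"
    by (simp add: mult add \<alpha>1 \<alpha>_emb R'_power B'_mult \<tau>xy emb.mult)
  then have "emb (x ^ m) * (emb (con cx) * emb (con (inverse cx * k))) * u + emb (con cx * x ^ m * r1)
      = 1 + emb (y ^ n) * (emb (con cy) * emb (con (inverse cy * k))) * v + emb (con cy * y ^ n * r2)"
    unfolding \<alpha>u \<alpha>v by (simp add: distrib_left emb.mult mult_ac add_ac)
  then have "emb (con k) * (emb (x ^ m) * u) + emb (con cx * x ^ m * r1)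
      = 1 + emb (con k) * (emb (y ^ n) * v) + emb (con cy * y ^ n * r2)"
    unfolding cx cy by (simp add: mult_ac)
  then have "emb (con k) + emb (con cx * x ^ m * r1) = 1 + emb (con cy * y ^ n * r2)"
    unfolding uv_relation by (simp add: distrib_left)
  then have "emb (con k + con cx * x ^ m * r1) = emb (1 + con cy * y ^ n * r2)"
    by (simp add: emb.add)
  then have rel: "con k + con cx * x ^ m * r1 = 1 + con cy * y ^ n * r2" by simp
  have x0: "poly x 0 = 0" "poly y 0 = 0" using a2 b2 c2 by (simp_all add: x_def y_def poly_monom)
  \<comment> \<open>At \<open>w = 0\<close> both \<open>x\<close> and \<open>y\<close> vanish and
    only the constants survive, which pins the scalar \<open>k\<close> to 1.\<close>
  have "poly (con k + con cx * x ^ m * r1) 0 = poly (1 + con cy * y ^ n * r2) 0" unfolding rel ..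
  then have "\<kappa> k = 1" using m0 n0 x0 by (simp add: con_def zero_power)
  then have k1: "k = 1" using kappa_eq_iff[of k 1] by simp
  then have reg2: "x ^ m * (con cx * r1) = y ^ n * (con cy * r2)"
    using rel by (simp add: mult_ac)
  then obtain r where r: "r \<in> R'" "con cx * r1 = y ^ n * r"
    using R'_regular[of "con cx * r1" "con cy * r2" m n] r1(1) r2(1) by (auto intro: R'_mult)
  have r': "con cy * r2 = x ^ m * r"
    using reg2 y_nz unfolding r(2) by (simp add: mult.left_commute)
  have "r1 = con (inverse cx) * (y ^ n * r)" "r2 = con (inverse cy) * (x ^ m * r)"
    using ci[OF cnz(1), of r1] ci[OF cnz(2), of r2] by (simp_all add: r(2) r')
  then have uv: "\<alpha> u = ut t r" "\<alpha> v = vt t r"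
    unfolding \<alpha>u \<alpha>v ut_def vt_def by (simp_all add: k1 cx_def cy_def distrib_left emb.mult)
  have "\<alpha> f = A t r f" if "f \<in> B'" for f
    using that
  proof (induction rule: B'_induct)
  qed (simp_all add: \<alpha>_emb uv add mult A_emb[OF t(1)] A_u[OF t(1)] A_v[OF t(1)]
      ring_map.add[OF A_map[OF t(1)]] ring_map.mult[OF A_map[OF t(1)]])
  moreover have "\<theta> t h = h"
    using hq by (simp add: \<theta>_def ed_def power_add cx_def cy_def k k1)
  ultimately show thesis using that t(1) r(1) by blast
qed

lemma A_commutes:
  assumes t: "t \<noteq> 0" and "f \<in> B'" and h: "\<theta> t h = h"
  shows "A t r (emb h * DD f) = emb h * DD (A t r f)"
proof -
  have "emb (\<tau> t h) * emb (con (t ^ ed)) = emb h"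
    using h by (simp add: \<theta>_def mult.commute flip: emb.mult)
  then show ?thesis
    using assms by (simp add: ring_map.mult[OF A_map] A_emb A_DD flip: mult.assoc)
qed

end

subsection \<open>Finite groups of complex numbers\<close>

text \<open>Multiplication by an element permutes \<open>S\<close>; comparing the products over
  \<open>S\<close> shows that the element is a root of unity of order dividing
  \<open>card S\<close>, and counting makes \<open>S\<close> the set of all such roots.\<close>

lemma finite_complex_group_cyclic:
  fixes S :: "complex set"
  assumes fin: "finite S" and one: "1 \<in> S" and zero: "0 \<notin> S"
    and mult: "\<And>x y. x \<in> S \<Longrightarrow> y \<in> S \<Longrightarrow> x * y \<in> S"
  obtains \<omega> and N :: nat where "N > 0" "\<omega> ^ N = 1" "bij_betw (\<lambda>k. \<omega> ^ k) {..<N} S"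
proof -
  define N where "N = card S"
  have N: "N > 0" using fin one by (auto simp: N_def card_gt_0_iff)
  have "S \<subseteq> {z. z ^ N = 1}"
  proof
    fix z assume z: "z \<in> S"
    then have nz: "z \<noteq> 0" using zero by auto
    have inj: "inj_on ((*) z) S" using nz by (auto intro: inj_onI)
    have "(*) z ` S = S"
      by (rule card_subset_eq[OF fin]) (use mult z card_image[OF inj] in auto)
    then have "prod (\<lambda>x. x) S = prod (\<lambda>x. z * x) S"
      using prod.reindex[OF inj, of "\<lambda>x. x"] by (simp add: o_def)
    also have "\<dots> = z ^ N * prod (\<lambda>x. x) S" by (simp add: prod.distrib N_def)
    finally have "z ^ N = 1" using zero fin by (simp add: prod_zero_iff)
    then show "z \<in> {z. z ^ N = 1}" by simp
  qed
  moreover have "card {z::complex. z ^ N = 1} = N" using N by (rule card_roots_unity_eq)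
  ultimately have S: "S = {z. z ^ N = 1}"
    using finite_roots_unity[of N] N by (intro card_subset_eq) (simp_all add: N_def)
  define \<omega> where "\<omega> = cis (2 * pi / real N)"
  have pow: "\<omega> ^ k = cis (2 * pi * real k / real N)" for k
    unfolding \<omega>_def DeMoivre by (simp add: mult.commute)
  show thesis
  proof (rule that[OF N])
    show "\<omega> ^ N = 1" using N unfolding pow by simp
    show "bij_betw (\<lambda>k. \<omega> ^ k) {..<N} S" unfolding pow S by (rule bij_betw_roots_unity[OF N])
  qed
qed

text \<open>The parametrisation runs from the semidirect product to the automorphism group, opposite
  to the isomorphism wanted. Closure of \<open>S\<close> under multiplication is part of
  \<open>hom\<close> because \<open>inv_into\<close> undoes \<open>J\<close> only on the
  carrier.\<close>

lemma is_iso_if_inverse_hom: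
  assumes bij: "bij_betw J (carrier S) (carrier G)"
    and hom: "\<And>x y. x \<in> carrier S \<Longrightarrow> y \<in> carrier S \<Longrightarrow>
      x \<otimes>\<^bsub>S\<^esub> y \<in> carrier S \<and> J (x \<otimes>\<^bsub>S\<^esub> y) = J x \<otimes>\<^bsub>G\<^esub> J y"
  shows "G \<cong> S"
proof -
  let ?I = "inv_into (carrier S) J"
  have b: "bij_betw ?I (carrier G) (carrier S)" by (rule bij_betw_inv_into[OF bij])
  have "?I \<in> hom G S"
  proof (rule homI)
    show "?I x \<in> carrier S" if "x \<in> carrier G" for x
      using b that by (auto simp: bij_betw_def)
    show "?I (x \<otimes>\<^bsub>G\<^esub> y) = ?I x \<otimes>\<^bsub>S\<^esub> ?I y" if xy: "x \<in> carrier G" "y \<in> carrier G" for x y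
    proof -
      have c: "?I x \<in> carrier S" "?I y \<in> carrier S" using b xy by (auto simp: bij_betw_def)
      have "x \<otimes>\<^bsub>G\<^esub> y = J (?I x) \<otimes>\<^bsub>G\<^esub> J (?I y)"
        using xy by (simp add: bij_betw_inv_into_right[OF bij])
      also have "\<dots> = J (?I x \<otimes>\<^bsub>S\<^esub> ?I y)" using hom[OF c] by simp
      finally have e: "x \<otimes>\<^bsub>G\<^esub> y = J (?I x \<otimes>\<^bsub>S\<^esub> ?I y)" .
      show ?thesis
        unfolding e by (rule bij_betw_inv_into_left[OF bij]) (use hom[OF c] in blast)
    qed
  qed
  with b show ?thesis by (auto simp: is_iso_def iso_def)
qed

context pham_model
begin

abbreviation "Rr \<equiv> ringR a b c"
abbreviation "Br \<equiv> ringB a b c m n"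

sublocale Rr: type_ring_hom Rr "classR a b c"
  by (rule ringR_hom)

sublocale Br: type_ring_hom Br "liftB a b c m n"
  by (rule ringB_hom)

subsection \<open>Transfer between the quotient rings and their models\<close>

definition \<rho> :: "cpoly3 set \<Rightarrow> 'k poly" where
  "\<rho> r = \<psi> (SOME p. classR a b c p = r)"

text \<open>Any polynomial representative will do, since \<open>liftB\<close> and \<Theta> identify
  the same polynomials.\<close>

definition \<Phi> :: "cpoly3 set poly2 set \<Rightarrow> 'k poly fract poly" where
  "\<Phi> f = \<Theta> (SOME p. liftB a b c m n p = f)"

lemma classR_eq_iff: "classR a b c p = classR a b c q \<longleftrightarrow> \<psi> p = \<psi> q"
proof -
  have "classR a b c p = classR a b c q \<longleftrightarrow> \<psi> (p - q) = 0"
    unfolding psi_eq_zero_iff Rr.hom_eq_iff[of p q] by (rule classR_eq_zero_iff)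
  then show ?thesis by (simp add: \<psi>.diff)
qed

lemma liftB_eq_iff: "liftB a b c m n p = liftB a b c m n q \<longleftrightarrow> \<Theta> p = \<Theta> q"
proof -
  have "liftB a b c m n p = liftB a b c m n q \<longleftrightarrow> \<Theta> (p - q) = 0"
    unfolding Theta_eq_zero_iff Br.hom_eq_iff[of p q] by (rule liftB_eq_zero_iff)
  then show ?thesis by (simp add: \<Theta>.diff)
qed

lemma rho_classR [simp]: "\<rho> (classR a b c p) = \<psi> p"
  unfolding \<rho>_def classR_eq_iff by (rule someI[of _ p]) simp

lemma Phi_liftB [simp]: "\<Phi> (liftB a b c m n p) = \<Theta> p"
  unfolding \<Phi>_def liftB_eq_iff by (rule someI[of _ p]) simp

lemma carrier_R_E: "r \<in> carrier Rr \<Longrightarrow> (\<And>p. r = classR a b c p \<Longrightarrow> thesis) \<Longrightarrow> thesis"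
  using classR_surj[of a b c] by blast

lemma carrier_B_E: "f \<in> carrier Br \<Longrightarrow> (\<And>p. f = liftB a b c m n p \<Longrightarrow> thesis) \<Longrightarrow> thesis"
  using liftB_surj[of a b c m n] by blast

lemma rho_bij: "bij_betw \<rho> (carrier Rr) R'"
  unfolding bij_betw_def
proof
  show "inj_on \<rho> (carrier Rr)"
    by (rule inj_onI) (elim carrier_R_E, simp add: classR_eq_iff)
  show "\<rho> ` carrier Rr = R'"
    unfolding classR_surj[symmetric] image_image rho_classR R'_def ..
qed

lemma Phi_bij: "bij_betw \<Phi> (carrier Br) B'"
  unfolding bij_betw_def
proof
  show "inj_on \<Phi> (carrier Br)"
    by (rule inj_onI) (elim carrier_B_E, simp add: liftB_eq_iff)
  show "\<Phi> ` carrier Br = B'"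
    unfolding liftB_surj[symmetric] image_image Phi_liftB B'_def ..
qed

lemma rho_closed [simp]: "r \<in> carrier Rr \<Longrightarrow> \<rho> r \<in> R'"
  using rho_bij by (auto simp: bij_betw_def)

lemma Phi_closed [simp]: "f \<in> carrier Br \<Longrightarrow> \<Phi> f \<in> B'"
  using Phi_bij by (auto simp: bij_betw_def)

lemma rho_add: "r \<in> carrier Rr \<Longrightarrow> r' \<in> carrier Rr \<Longrightarrow> \<rho> (r \<oplus>\<^bsub>Rr\<^esub> r') = \<rho> r + \<rho> r'"
  by (auto elim!: carrier_R_E simp: \<psi>.add simp flip: Rr.hom_add)

lemma Phi_add: "f \<in> carrier Br \<Longrightarrow> g \<in> carrier Br \<Longrightarrow> \<Phi> (f \<oplus>\<^bsub>Br\<^esub> g) = \<Phi> f + \<Phi> g"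
  by (auto elim!: carrier_B_E simp: \<Theta>.add simp flip: Br.hom_add)

lemma Phi_mult: "f \<in> carrier Br \<Longrightarrow> g \<in> carrier Br \<Longrightarrow> \<Phi> (f \<otimes>\<^bsub>Br\<^esub> g) = \<Phi> f * \<Phi> g"
  by (auto elim!: carrier_B_E simp: \<Theta>.mult simp flip: Br.hom_mult)

lemma Phi_zero: "\<Phi> \<zero>\<^bsub>Br\<^esub> = 0"
  using Phi_liftB[of 0] by (simp add: Br.hom_zero)

lemma Phi_one: "\<Phi> \<one>\<^bsub>Br\<^esub> = 1"
  using Phi_liftB[of 1] by (simp add: Br.hom_one)

lemma Phi_eqD: "\<Phi> f = \<Phi> g \<Longrightarrow> f \<in> carrier Br \<Longrightarrow> g \<in> carrier Br \<Longrightarrow> f = g"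
  using Phi_bij by (auto simp: bij_betw_def inj_on_def)

lemma inclR_closed: "r \<in> carrier Rr \<Longrightarrow> inclR a b c m n r \<in> carrier Br"
  by (auto elim!: carrier_R_E simp: inclR_classR)

lemma Phi_inclR: "r \<in> carrier Rr \<Longrightarrow> \<Phi> (inclR a b c m n r) = emb (\<rho> r)"
  by (auto elim!: carrier_R_E simp: inclR_classR Theta_const)

lemma Phi_inclC: "\<Phi> (inclC a b c m n k) = emb (con k)"
  by (simp add: inclC_liftB Theta_const)

lemma inclC_closed: "inclC a b c m n k \<in> carrier Br"
  by (simp add: inclC_liftB)

definition rinv :: "'k poly \<Rightarrow> cpoly3 set" where "rinv = inv_into (carrier Rr) \<rho>"
definition Pinv :: "'k poly fract poly \<Rightarrow> cpoly3 set poly2 set" where "Pinv = inv_into (carrier Br) \<Phi>"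

lemma rinv: "g \<in> R' \<Longrightarrow> rinv g \<in> carrier Rr" "g \<in> R' \<Longrightarrow> \<rho> (rinv g) = g" "r \<in> carrier Rr \<Longrightarrow> rinv (\<rho> r) = r"
  using bij_betw_inv_into[OF rho_bij] bij_betw_inv_into_right[OF rho_bij] bij_betw_inv_into_left[OF rho_bij]
  by (auto simp: rinv_def bij_betw_def)

lemma Pinv: "g \<in> B' \<Longrightarrow> Pinv g \<in> carrier Br" "g \<in> B' \<Longrightarrow> \<Phi> (Pinv g) = g" "f \<in> carrier Br \<Longrightarrow> Pinv (\<Phi> f) = f"
  using bij_betw_inv_into[OF Phi_bij] bij_betw_inv_into_right[OF Phi_bij] bij_betw_inv_into_left[OF Phi_bij]
  by (auto simp: Pinv_def bij_betw_def)

lemma elt_closed: "elt_u a b c m n \<in> carrier Br" "elt_v a b c m n \<in> carrier Br"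
  "elt_y a b c m n [^]\<^bsub>Br\<^esub> n \<in> carrier Br" "elt_x a b c m n [^]\<^bsub>Br\<^esub> m \<in> carrier Br"
  by (simp_all add: elt_liftB)

lemma Phi_elt: "\<Phi> (elt_u a b c m n) = u" "\<Phi> (elt_v a b c m n) = v"
  "\<Phi> (elt_y a b c m n [^]\<^bsub>Br\<^esub> n) = emb (y ^ n)" "\<Phi> (elt_x a b c m n [^]\<^bsub>Br\<^esub> m) = emb (x ^ m)"
  unfolding elt_liftB Br.hom_power[symmetric] Phi_liftB Theta_U Theta_V \<Theta>.power Theta_const psi_gens emb.power
  by (rule refl)+

text \<open>The uniqueness half for \<open>canonD\<close>: a derivation over \<open>R\<close> is
  determined by its values at \<open>u\<close> and \<open>v\<close>, and induction over generators
  compares it with \<open>DD\<close>.\<close>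

lemma derivation_eq_DD:
  assumes D: "derivation_over Br (inclR a b c m n ` carrier Rr) D"
    and Du: "D (elt_u a b c m n) = elt_y a b c m n [^]\<^bsub>Br\<^esub> n"
    and Dv: "D (elt_v a b c m n) = elt_x a b c m n [^]\<^bsub>Br\<^esub> m"
    and f: "f \<in> carrier Br"
  shows "\<Phi> (D f) = DD (\<Phi> f)"
proof -
  have closed: "D f \<in> carrier Br" if "f \<in> carrier Br" for f
    using D that by (auto simp: derivation_over_def)
  have "\<Phi> (D (Pinv g)) = DD g" if "g \<in> B'" for g
    using that
  proof (induction rule: B'_induct)
    case (emb g)
    have "Pinv (emb g) = inclR a b c m n (rinv g)"
      by (rule Phi_eqD) (use emb in \<open>simp_all add: Pinv Phi_inclR rinv inclR_closed\<close>)
    then have "D (Pinv (emb g)) = \<zero>\<^bsub>Br\<^esub>"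
      using D emb by (simp add: derivation_over_def rinv)
    then show ?case by (simp add: Phi_zero)
  next
    case u
    have "Pinv u = elt_u a b c m n"
      by (rule Phi_eqD) (simp_all add: Pinv Phi_elt elt_closed)
    then show ?case by (simp add: Du Phi_elt DD_u)
  next
    case v
    have "Pinv v = elt_v a b c m n"
      by (rule Phi_eqD) (simp_all add: Pinv Phi_elt elt_closed)
    then show ?case by (simp add: Dv Phi_elt DD_v)
  next
    case (add g h)
    have "Pinv (g + h) = Pinv g \<oplus>\<^bsub>Br\<^esub> Pinv h"
      by (rule Phi_eqD) (use add.hyps in \<open>simp_all add: Pinv Phi_add B'_add\<close>)
    then have "D (Pinv (g + h)) = D (Pinv g) \<oplus>\<^bsub>Br\<^esub> D (Pinv h)"
      using D add.hyps by (simp add: derivation_over_def Pinv)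
    then show ?case using add by (simp add: Phi_add closed Pinv DD_add)
  next
    case (mult g h)
    have "Pinv (g * h) = Pinv g \<otimes>\<^bsub>Br\<^esub> Pinv h"
      by (rule Phi_eqD) (use mult.hyps in \<open>simp_all add: Pinv Phi_mult B'_mult\<close>)
    then have "D (Pinv (g * h)) = (Pinv g \<otimes>\<^bsub>Br\<^esub> D (Pinv h)) \<oplus>\<^bsub>Br\<^esub> (Pinv h \<otimes>\<^bsub>Br\<^esub> D (Pinv g))"
      using D mult.hyps by (simp add: derivation_over_def Pinv)
    then show ?case using mult by (simp add: Phi_add Phi_mult closed Pinv DD_mult)
  qed
  from this[OF Phi_closed[OF f]] show ?thesis using f by (simp add: Pinv)
qed

text \<open>Transporting \<open>DD\<close> back supplies existence; restriction to the carrier makes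
  the function extensional, so that the definite description really has a unique solution.\<close>

lemma canonD: "f \<in> carrier Br \<Longrightarrow> canonD a b c m n f = Pinv (DD (\<Phi> f))"
proof -
  assume f: "f \<in> carrier Br"
  define D0 where "D0 = restrict (\<lambda>f. Pinv (DD (\<Phi> f))) (carrier Br)"
  have D0: "D0 f \<in> carrier Br" "\<Phi> (D0 f) = DD (\<Phi> f)" if "f \<in> carrier Br" for f
    using that by (simp_all add: D0_def Pinv DD_closed)
  have "canonD a b c m n = D0"
    unfolding canonD_def Let_def
  proof (rule the_equality)
    have "derivation_over Br (inclR a b c m n ` carrier Rr) D0"
      unfolding derivation_over_def
    proof (intro conjI ballI Pi_I)
      fix f g assume fg: "f \<in> carrier Br" "g \<in> carrier Br"
      show "D0 f \<in> carrier Br" using D0 fg by simp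
      show "D0 (f \<oplus>\<^bsub>Br\<^esub> g) = D0 f \<oplus>\<^bsub>Br\<^esub> D0 g"
        by (rule Phi_eqD) (use fg in \<open>simp_all add: D0 Phi_add DD_add\<close>)
      show "D0 (f \<otimes>\<^bsub>Br\<^esub> g) = (f \<otimes>\<^bsub>Br\<^esub> D0 g) \<oplus>\<^bsub>Br\<^esub> (g \<otimes>\<^bsub>Br\<^esub> D0 f)"
        by (rule Phi_eqD) (use fg in \<open>simp_all add: D0 Phi_add Phi_mult DD_mult\<close>)
    next
      fix f assume "f \<in> inclR a b c m n ` carrier Rr"
      then obtain r where r: "r \<in> carrier Rr" "f = inclR a b c m n r" by blast
      show "D0 f = \<zero>\<^bsub>Br\<^esub>"
        by (rule Phi_eqD) (use r in \<open>simp_all add: D0 inclR_closed Phi_inclR Phi_zero\<close>)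
    qed
    moreover have "D0 (elt_u a b c m n) = elt_y a b c m n [^]\<^bsub>Br\<^esub> n"
      by (rule Phi_eqD) (simp_all add: D0 elt_closed Phi_elt DD_u)
    moreover have "D0 (elt_v a b c m n) = elt_x a b c m n [^]\<^bsub>Br\<^esub> m"
      by (rule Phi_eqD) (simp_all add: D0 elt_closed Phi_elt DD_v)
    ultimately show "D0 \<in> extensional (carrier Br) \<and>
       derivation_over Br (inclR a b c m n ` carrier Rr) D0 \<and>
       D0 (elt_u a b c m n) = elt_y a b c m n [^]\<^bsub>Br\<^esub> n \<and>
       D0 (elt_v a b c m n) = elt_x a b c m n [^]\<^bsub>Br\<^esub> m"
      by (simp add: D0_def)
  next
    fix D assume D: "D \<in> extensional (carrier Br) \<and>
       derivation_over Br (inclR a b c m n ` carrier Rr) D \<and>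
       D (elt_u a b c m n) = elt_y a b c m n [^]\<^bsub>Br\<^esub> n \<and>
       D (elt_v a b c m n) = elt_x a b c m n [^]\<^bsub>Br\<^esub> m"
    show "D = D0"
    proof (rule extensionalityI)
      show "D \<in> extensional (carrier Br)" using D by simp
      show "D0 \<in> extensional (carrier Br)" by (simp add: D0_def)
      show "D f = D0 f" if f: "f \<in> carrier Br" for f
      proof (rule Phi_eqD)
        show "\<Phi> (D f) = \<Phi> (D0 f)" using derivation_eq_DD[of D f] D f D0 by simp
        show "D f \<in> carrier Br" using D f by (auto simp: derivation_over_def)
        show "D0 f \<in> carrier Br" using D0 f by simp
      qed
    qed
  qed
  then show ?thesis using f by (simp add: D0_def)
qed

section \<open>Parametrising the automorphism group of \<delta>\<close>

definition JJ :: "complex \<Rightarrow> 'k poly \<Rightarrow> cpoly3 set poly2 set \<Rightarrow> cpoly3 set poly2 set" where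
  "JJ t r = restrict (\<lambda>f. Pinv (A t r (\<Phi> f))) (carrier Br)"

definition stab :: "'k poly \<Rightarrow> complex set" where
  "stab h = {t. t \<noteq> 0 \<and> \<theta> t h = h}"

lemma JJ:
  assumes "t \<noteq> 0" "r \<in> R'" "f \<in> carrier Br"
  shows "JJ t r f \<in> carrier Br" "\<Phi> (JJ t r f) = A t r (\<Phi> f)"
  using assms by (simp_all add: JJ_def Pinv A_closed)

lemma JJ_Bij: "t \<noteq> 0 \<Longrightarrow> r \<in> R' \<Longrightarrow> JJ t r \<in> Bij (carrier Br)"
proof -
  assume tr: "t \<noteq> 0" "r \<in> R'"
  have "bij_betw (Pinv \<circ> (A t r \<circ> \<Phi>)) (carrier Br) (carrier Br)"
    by (intro bij_betw_trans[OF bij_betw_trans[OF Phi_bij A_bij[OF tr]]])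
      (simp add: Pinv_def bij_betw_inv_into[OF Phi_bij])
  then have "bij_betw (JJ t r) (carrier Br) (carrier Br)"
    by (rule bij_betw_cong[THEN iffD1, rotated]) (simp add: JJ_def)
  then show ?thesis by (simp add: Bij_def JJ_def)
qed

lemma JJ_compose:
  assumes "t \<noteq> 0" "r \<in> R'" "t' \<noteq> 0" "r' \<in> R'"
  shows "compose (carrier Br) (JJ t r) (JJ t' r') = JJ (t * t') (r + \<theta> t r')"
proof (rule extensionalityI)
  show "compose (carrier Br) (JJ t r) (JJ t' r') \<in> extensional (carrier Br)" by simp
  show "JJ (t * t') (r + \<theta> t r') \<in> extensional (carrier Br)" by (simp add: JJ_def)
  have rr: "r + \<theta> t r' \<in> R'" using assms by (intro R'_add theta_closed)
  show "compose (carrier Br) (JJ t r) (JJ t' r') f = JJ (t * t') (r + \<theta> t r') f" if f: "f \<in> carrier Br" for f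
    by (rule Phi_eqD) (use assms f rr in \<open>simp_all add: compose_def JJ A_A\<close>)
qed

lemma JJ_inj:
  assumes "t \<noteq> 0" "r \<in> R'" "t' \<noteq> 0" "r' \<in> R'" "JJ t r = JJ t' r'"
  shows "t = t'" "r = r'"
proof -
  have "A t r g = A t' r' g" if "g \<in> B'" for g
    using JJ(2)[of t r "Pinv g"] JJ(2)[of t' r' "Pinv g"] that assms by (simp add: Pinv)
  then show "t = t'" "r = r'" using A_params_unique[OF assms(1,3)] by blast+
qed

context
  fixes h :: "cpoly3 set" and \<delta> :: "cpoly3 set poly2 set \<Rightarrow> cpoly3 set poly2 set"
  assumes h: "h \<in> carrier Rr" "h \<noteq> \<zero>\<^bsub>Rr\<^esub>"
    and \<delta>: "\<And>f. f \<in> carrier Br \<Longrightarrow> \<delta> f = inclR a b c m n h \<otimes>\<^bsub>Br\<^esub> canonD a b c m n f"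
begin

lemma rho_h: "\<rho> h \<in> R'" "\<rho> h \<noteq> 0"
proof -
  show "\<rho> h \<in> R'" using h by simp
  have "\<rho> \<zero>\<^bsub>Rr\<^esub> = 0" using rho_classR[of 0] by (simp add: Rr.hom_zero)
  then show "\<rho> h \<noteq> 0"
    using h rho_bij Rr.zero_closed by (metis bij_betw_def inj_onD)
qed

lemma delta: "f \<in> carrier Br \<Longrightarrow> \<delta> f \<in> carrier Br" "f \<in> carrier Br \<Longrightarrow> \<Phi> (\<delta> f) = emb (\<rho> h) * DD (\<Phi> f)"
  using h by (simp_all add: \<delta> canonD Pinv DD_closed Phi_mult Phi_inclR inclR_closed)

lemma AutDer_carrier:
  "carrier (AutDer a b c m n \<delta>) = {\<alpha> \<in> Bij (carrier Br). \<alpha> \<in> ring_iso Br Br \<and>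
     (\<forall>k. \<alpha> (inclC a b c m n k) = inclC a b c m n k) \<and> (\<forall>f\<in>carrier Br. \<alpha> (\<delta> f) = \<delta> (\<alpha> f))}"
  by (simp add: AutDer_def Let_def)

lemma JJ_AutDer:
  assumes t: "t \<in> stab (\<rho> h)" and r: "r \<in> R'"
  shows "JJ t r \<in> carrier (AutDer a b c m n \<delta>)"
proof -
  have t0: "t \<noteq> 0" and th: "\<theta> t (\<rho> h) = \<rho> h" using t by (auto simp: stab_def)
  note J = JJ[OF t0 r]
  have "JJ t r \<in> ring_iso Br Br"
  proof (rule ring_iso_memI)
    fix f g assume fg: "f \<in> carrier Br" "g \<in> carrier Br"
    show "JJ t r f \<in> carrier Br" using J fg by simp
    show "JJ t r (f \<otimes>\<^bsub>Br\<^esub> g) = JJ t r f \<otimes>\<^bsub>Br\<^esub> JJ t r g"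
      by (rule Phi_eqD) (use fg in \<open>simp_all add: J Phi_mult ring_map.mult[OF A_map[OF t0]]\<close>)
    show "JJ t r (f \<oplus>\<^bsub>Br\<^esub> g) = JJ t r f \<oplus>\<^bsub>Br\<^esub> JJ t r g"
      by (rule Phi_eqD) (use fg in \<open>simp_all add: J Phi_add ring_map.add[OF A_map[OF t0]]\<close>)
  next
    show "JJ t r \<one>\<^bsub>Br\<^esub> = \<one>\<^bsub>Br\<^esub>"
      by (rule Phi_eqD) (simp_all add: J Phi_one ring_map.one[OF A_map[OF t0]])
    show "bij_betw (JJ t r) (carrier Br) (carrier Br)"
      using JJ_Bij[OF t0 r] by (simp add: Bij_def)
  qed
  moreover have "JJ t r (inclC a b c m n k) = inclC a b c m n k" for k
    by (rule Phi_eqD) (simp_all add: J inclC_closed Phi_inclC A_emb t0 tau_gens)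
  moreover have "JJ t r (\<delta> f) = \<delta> (JJ t r f)" if "f \<in> carrier Br" for f
    by (rule Phi_eqD) (use that in \<open>simp_all add: J delta A_commutes t0 th\<close>)
  ultimately show ?thesis using JJ_Bij[OF t0 r] by (simp add: AutDer_carrier)
qed

lemma AutDer_JJ:
  assumes \<alpha>: "\<alpha> \<in> carrier (AutDer a b c m n \<delta>)"
  shows "\<exists>t\<in>stab (\<rho> h). \<exists>r\<in>R'. \<alpha> = JJ t r"
proof -
  from \<alpha> have Bij: "\<alpha> \<in> Bij (carrier Br)" and iso: "\<alpha> \<in> ring_iso Br Br"
    and const: "\<And>k. \<alpha> (inclC a b c m n k) = inclC a b c m n k"
    and comm: "\<And>f. f \<in> carrier Br \<Longrightarrow> \<alpha> (\<delta> f) = \<delta> (\<alpha> f)"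
    by (auto simp: AutDer_carrier)
  note iso = ring_iso_memE[OF iso]
  define \<alpha>' where "\<alpha>' g = \<Phi> (\<alpha> (Pinv g))" for g
  have \<alpha>': "\<alpha>' (\<Phi> f) = \<Phi> (\<alpha> f)" if "f \<in> carrier Br" for f
    using that by (simp add: \<alpha>'_def Pinv)
  have B'E: "\<exists>f\<in>carrier Br. g = \<Phi> f" if "g \<in> B'" for g
    using that Pinv(1,2) by metis
  obtain t r where tr: "t \<noteq> 0" "r \<in> R'" "\<theta> t (\<rho> h) = \<rho> h" "\<And>g. g \<in> B' \<Longrightarrow> \<alpha>' g = A t r g"
  proof (rule automorphism_B'[of \<alpha>' "\<rho> h"])
    show "\<alpha>' g \<in> B'" if "g \<in> B'" for g
      using that iso(1) by (simp add: \<alpha>'_def Pinv)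
    show "\<alpha>' (f + g) = \<alpha>' f + \<alpha>' g" if fg: "f \<in> B'" "g \<in> B'" for f g
    proof -
      from B'E[OF fg(1)] obtain f1 where f1: "f1 \<in> carrier Br" "f = \<Phi> f1" by (elim bexE)
      from B'E[OF fg(2)] obtain g1 where g1: "g1 \<in> carrier Br" "g = \<Phi> g1" by (elim bexE)
      note 1 = f1 g1
      then have "\<alpha>' (f + g) = \<alpha>' (\<Phi> (f1 \<oplus>\<^bsub>Br\<^esub> g1))" by (simp add: Phi_add)
      also have "\<dots> = \<Phi> (\<alpha> (f1 \<oplus>\<^bsub>Br\<^esub> g1))" by (rule \<alpha>') (use 1 in simp)
      also have "\<dots> = \<alpha>' f + \<alpha>' g" using 1 iso by (simp add: \<alpha>' Phi_add)
      finally show ?thesis .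
    qed
    show "\<alpha>' (f * g) = \<alpha>' f * \<alpha>' g" if fg: "f \<in> B'" "g \<in> B'" for f g
    proof -
      from B'E[OF fg(1)] obtain f1 where f1: "f1 \<in> carrier Br" "f = \<Phi> f1" by (elim bexE)
      from B'E[OF fg(2)] obtain g1 where g1: "g1 \<in> carrier Br" "g = \<Phi> g1" by (elim bexE)
      note 1 = f1 g1
      then have "\<alpha>' (f * g) = \<alpha>' (\<Phi> (f1 \<otimes>\<^bsub>Br\<^esub> g1))" by (simp add: Phi_mult)
      also have "\<dots> = \<Phi> (\<alpha> (f1 \<otimes>\<^bsub>Br\<^esub> g1))" by (rule \<alpha>') (use 1 in simp)
      also have "\<dots> = \<alpha>' f * \<alpha>' g" using 1 iso by (simp add: \<alpha>' Phi_mult)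
      finally show ?thesis .
    qed
    show "\<alpha>' (emb (con k)) = emb (con k)" for k
      using \<alpha>'[OF inclC_closed[of k]] by (simp add: const Phi_inclC)
    have "bij_betw (\<Phi> \<circ> (\<alpha> \<circ> Pinv)) B' B'"
      using Bij by (intro bij_betw_trans[OF bij_betw_trans[OF _ _] Phi_bij])
        (auto simp: Pinv_def Bij_def intro: bij_betw_inv_into[OF Phi_bij])
    then show "bij_betw \<alpha>' B' B'" by (simp add: \<alpha>'_def[abs_def] o_def)
    show "\<alpha>' (emb (\<rho> h) * DD g) = emb (\<rho> h) * DD (\<alpha>' g)" if g: "g \<in> B'" for g
    proof -
      from B'E[OF g] obtain f where f: "f \<in> carrier Br" "g = \<Phi> f" by (elim bexE)
      then have "\<alpha>' (emb (\<rho> h) * DD g) = \<alpha>' (\<Phi> (\<delta> f))" by (simp add: delta(2))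
      also have "\<dots> = \<Phi> (\<alpha> (\<delta> f))" by (rule \<alpha>') (use f in \<open>simp add: delta(1)\<close>)
      also have "\<dots> = emb (\<rho> h) * DD (\<alpha>' g)" using f iso(1) by (simp add: comm delta \<alpha>')
      finally show ?thesis .
    qed
  qed (use rho_h in auto)
  have "\<alpha> = JJ t r"
  proof (rule extensionalityI)
    show "\<alpha> \<in> extensional (carrier Br)" using Bij by (simp add: Bij_def)
    show "JJ t r \<in> extensional (carrier Br)" by (simp add: JJ_def)
    show "\<alpha> f = JJ t r f" if "f \<in> carrier Br" for f
      by (rule Phi_eqD) (use that iso(1) tr in \<open>simp_all add: JJ flip: \<alpha>'\<close>)
  qed
  with tr show ?thesis by (auto simp: stab_def)
qed

text \<open>One nonzero coefficient of \<open>h\<close>, in degree \<open>d\<close>, turns the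
  fixing condition into \<open>t ^ (ed + d) = 1\<close>, and \<open>ed\<close> is positive.\<close>

lemma stab_finite: "finite (stab (\<rho> h))"
proof -
  obtain d where d: "Polynomial.coeff (\<rho> h) d \<noteq> 0"
    using rho_h(2) by (metis leading_coeff_0_iff)
  have "stab (\<rho> h) \<subseteq> {t. t ^ (ed + d) = 1}"
  proof
    fix t assume "t \<in> stab (\<rho> h)"
    then have "Polynomial.coeff (\<theta> t (\<rho> h)) d = Polynomial.coeff (\<rho> h) d" by (simp add: stab_def)
    then have "\<kappa> (t ^ (ed + d)) * Polynomial.coeff (\<rho> h) d = Polynomial.coeff (\<rho> h) d"
      by (simp add: \<theta>_def con_def coeff_tau power_add \<kappa>.mult \<kappa>.power mult.assoc)
    then have "\<kappa> (t ^ (ed + d)) = \<kappa> 1" using d by simp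
    then show "t \<in> {t. t ^ (ed + d) = 1}" unfolding kappa_eq_iff by simp
  qed
  moreover have "ed + d > 0" using m0 a2 b2 c2 by (simp add: ed_def)
  then have "finite {t::complex. t ^ (ed + d) = 1}" by (intro finite_roots_unity) linarith
  ultimately show ?thesis by (rule finite_subset)
qed

definition act :: "complex \<Rightarrow> cpoly3 set \<Rightarrow> cpoly3 set" where
  "act t = restrict (\<lambda>r. rinv (\<theta> t (\<rho> r))) (carrier Rr)"

lemma rho_act: "r \<in> carrier Rr \<Longrightarrow> \<rho> (act t r) = \<theta> t (\<rho> r)"
  and act_closed: "r \<in> carrier Rr \<Longrightarrow> act t r \<in> carrier Rr"
  by (simp_all add: act_def rinv theta_closed)

lemma rho_eqD: "\<rho> r = \<rho> r' \<Longrightarrow> r \<in> carrier Rr \<Longrightarrow> r' \<in> carrier Rr \<Longrightarrow> r = r'"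
  using rho_bij by (auto simp: bij_betw_def inj_on_def)

lemma act_act: "r \<in> carrier Rr \<Longrightarrow> act t (act t' r) = act (t * t') r"
  by (rule rho_eqD) (simp_all add: rho_act act_closed theta_theta)

lemma act_1: "r \<in> carrier Rr \<Longrightarrow> act 1 r = r"
  by (rule rho_eqD) (simp_all add: rho_act act_closed)

lemma act_auto:
  assumes "t \<noteq> 0"
  shows "act t \<in> auto (add_monoid Rr)"
proof -
  have "bij_betw (act t) (carrier Rr) (carrier Rr)"
    by (rule bij_betw_byWitness[where f' = "act (inverse t)"])
      (use assms in \<open>auto simp: act_act act_1 act_closed\<close>)
  moreover have "act t (r \<oplus>\<^bsub>Rr\<^esub> r') = act t r \<oplus>\<^bsub>Rr\<^esub> act t r'" if "r \<in> carrier Rr" "r' \<in> carrier Rr" for r r'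
    by (rule rho_eqD) (use that in \<open>simp_all add: rho_act act_closed rho_add theta_add\<close>)
  moreover have "act t \<in> extensional (carrier Rr)" by (simp add: act_def)
  ultimately show ?thesis
    by (simp add: auto_def hom_def Bij_def act_closed)
qed

text \<open>The finite group of admissible \<open>t\<close> is replaced by the integers modulo its
  order, with \<open>j\<close> standing for the power \<open>\<omega> ^ j\<close> of a
  generator.\<close>

theorem AutDer_semidirect:
  "\<exists>(G :: int monoid) \<theta>.
     group G \<and> finite (carrier G) \<and> cyclic_group G \<and>
     \<theta> \<in> hom G (AutoGroup (add_monoid Rr)) \<and>
     AutDer a b c m n \<delta> \<cong> semidirect G \<theta> (add_monoid Rr)"
proof -
  obtain \<omega> N where N: "N > 0" and \<omega>: "\<omega> ^ N = 1" and bij: "bij_betw (\<lambda>k. \<omega> ^ k) {..<N} (stab (\<rho> h))"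
    by (rule finite_complex_group_cyclic[OF stab_finite])
      (auto simp: stab_def simp flip: theta_theta)
  define G where "G = integer_mod_group N"
  define w where "w j = \<omega> ^ nat j" for j
  have carrG: "carrier G = {0..<int N}" using N by (simp add: G_def carrier_integer_mod_group)
  have "bij_betw nat {0..<int N} {..<N}"
    by (rule bij_betw_byWitness[where f' = int]) auto
  from bij_betw_trans[OF this bij] have wbij: "bij_betw w (carrier G) (stab (\<rho> h))"
    by (simp add: carrG w_def[abs_def] o_def)
  have wst: "w j \<in> stab (\<rho> h)" "w j \<noteq> 0" if "j \<in> carrier G" for j
    using wbij that by (auto simp: bij_betw_def stab_def)
  have wmult: "w (i \<otimes>\<^bsub>G\<^esub> j) = w i * w j" if "i \<in> carrier G" "j \<in> carrier G" for i j
  proof -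
    have "w (i \<otimes>\<^bsub>G\<^esub> j) = \<omega> ^ ((nat i + nat j) mod N)"
      using that by (simp add: w_def G_def carrG[unfolded G_def] nat_mod_distrib nat_add_distrib)
    \<comment> \<open>Powers with exponent divisible by \<open>N\<close> are 1, so the multiple of
      \<open>N\<close> lost in the reduction can be put back.\<close>
    also have "\<dots> = \<omega> ^ (N * ((nat i + nat j) div N) + (nat i + nat j) mod N)"
      unfolding power_add power_mult \<omega> by simp
    also have "\<dots> = w i * w j" by (simp add: w_def power_add)
    finally show ?thesis .
  qed
  have grp: "group G" by (simp add: G_def)
  define \<phi> where "\<phi> j = act (w j)" for j
  have hom: "\<phi> \<in> hom G (AutoGroup (add_monoid Rr))"
  proof (rule homI)
    show "\<phi> j \<in> carrier (AutoGroup (add_monoid Rr))" if "j \<in> carrier G" for j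
      using act_auto wst(2)[OF that] by (simp add: AutoGroup_def \<phi>_def)
    show "\<phi> (i \<otimes>\<^bsub>G\<^esub> j) = \<phi> i \<otimes>\<^bsub>AutoGroup (add_monoid Rr)\<^esub> \<phi> j" if ij: "i \<in> carrier G" "j \<in> carrier G" for i j
    proof -
      have "\<phi> i \<in> Bij (carrier Rr)" "\<phi> j \<in> Bij (carrier Rr)"
        using act_auto wst(2) ij by (auto simp: auto_def \<phi>_def)
      then have "\<phi> i \<otimes>\<^bsub>AutoGroup (add_monoid Rr)\<^esub> \<phi> j = compose (carrier Rr) (\<phi> i) (\<phi> j)"
        by (simp add: AutoGroup_def BijGroup_def)
      also have "\<dots> = \<phi> (i \<otimes>\<^bsub>G\<^esub> j)"
      proof (rule extensionalityI)
        show "compose (carrier Rr) (\<phi> i) (\<phi> j) \<in> extensional (carrier Rr)" by simp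
        show "\<phi> (i \<otimes>\<^bsub>G\<^esub> j) \<in> extensional (carrier Rr)" by (simp add: \<phi>_def act_def)
        show "compose (carrier Rr) (\<phi> i) (\<phi> j) r = \<phi> (i \<otimes>\<^bsub>G\<^esub> j) r" if "r \<in> carrier Rr" for r
          using that ij by (simp add: compose_def \<phi>_def act_act wmult)
      qed
      finally show ?thesis ..
    qed
  qed
  define S where "S = semidirect G \<phi> (add_monoid Rr)"
  have carrS: "carrier S = carrier G \<times> carrier Rr" by (simp add: S_def semidirect_def)
  have "AutDer a b c m n \<delta> \<cong> S"
  proof (rule is_iso_if_inverse_hom)
    let ?J = "\<lambda>(j, r). JJ (w j) (\<rho> r)"
    show "bij_betw ?J (carrier S) (carrier (AutDer a b c m n \<delta>))"
      unfolding bij_betw_def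
    proof
      show "inj_on ?J (carrier S)"
      proof (rule inj_onI, clarify)
        fix i r j r' assume *: "(i, r) \<in> carrier S" "(j, r') \<in> carrier S" "JJ (w i) (\<rho> r) = JJ (w j) (\<rho> r')"
        then have c: "i \<in> carrier G" "j \<in> carrier G" "r \<in> carrier Rr" "r' \<in> carrier Rr" unfolding carrS by auto
        have "w i = w j" "\<rho> r = \<rho> r'"
          using JJ_inj[OF wst(2)[OF c(1)] rho_closed[OF c(3)] wst(2)[OF c(2)] rho_closed[OF c(4)] *(3)] by auto
        then show "i = j \<and> r = r'"
          using wbij rho_bij c by (auto simp: bij_betw_def inj_on_def)
      qed
      show "?J ` carrier S = carrier (AutDer a b c m n \<delta>)"
      proof (intro equalityI subsetI)
        fix \<alpha> assume "\<alpha> \<in> ?J ` carrier S"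
        then show "\<alpha> \<in> carrier (AutDer a b c m n \<delta>)"
          using JJ_AutDer wst by (auto simp: carrS)
      next
        fix \<alpha> assume "\<alpha> \<in> carrier (AutDer a b c m n \<delta>)"
        then obtain t g where tg: "t \<in> stab (\<rho> h)" "g \<in> R'" "\<alpha> = JJ t g" using AutDer_JJ by blast
        obtain j where j: "j \<in> carrier G" "t = w j" using tg(1) wbij by (auto simp: bij_betw_def)
        have "\<alpha> = ?J (j, rinv g)" using tg j by (simp add: rinv)
        moreover have "(j, rinv g) \<in> carrier S" using tg j by (simp add: carrS rinv)
        ultimately show "\<alpha> \<in> ?J ` carrier S" by blast
      qed
    qed
    show "p \<otimes>\<^bsub>S\<^esub> q \<in> carrier S \<and> ?J (p \<otimes>\<^bsub>S\<^esub> q) = ?J p \<otimes>\<^bsub>AutDer a b c m n \<delta>\<^esub> ?J q"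
      if pq: "p \<in> carrier S" "q \<in> carrier S" for p q
    proof -
      obtain i r j r' where p: "p = (i, r)" and q: "q = (j, r')" by (cases p; cases q)
      have c: "i \<in> carrier G" "j \<in> carrier G" "r \<in> carrier Rr" "r' \<in> carrier Rr"
        using pq by (auto simp: carrS p q)
      have m: "p \<otimes>\<^bsub>S\<^esub> q = (i \<otimes>\<^bsub>G\<^esub> j, r \<oplus>\<^bsub>Rr\<^esub> act (w i) r')"
        by (simp add: S_def semidirect_def p q \<phi>_def)
      have "?J (p \<otimes>\<^bsub>S\<^esub> q) = JJ (w i * w j) (\<rho> r + \<theta> (w i) (\<rho> r'))"
        using c by (simp add: m wmult rho_add act_closed rho_act)
      also have "\<dots> = compose (carrier Br) (JJ (w i) (\<rho> r)) (JJ (w j) (\<rho> r'))"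
        using c wst(2) by (simp add: JJ_compose)
      also have "\<dots> = ?J p \<otimes>\<^bsub>AutDer a b c m n \<delta>\<^esub> ?J q"
        using c wst(2) JJ_Bij by (simp add: AutDer_def Let_def BijGroup_def p q)
      finally show ?thesis
        using c grp act_closed by (simp add: m carrS group.subgroup_self monoid.m_closed group.is_monoid)
    qed
  qed
  moreover have "cyclic_group G"
    unfolding group.cyclic_group[OF grp]
  proof (rule bexI)
    \<comment> \<open>The reduction matters for \<open>N = 1\<close>, where the generator is
      0.\<close>
    show "1 mod int N \<in> carrier G" using N by (simp add: carrG)
    have "(1 mod int N) [^]\<^bsub>G\<^esub> k = k mod int N" for k :: int
      by (simp add: G_def int_pow_integer_mod_group mod_mult_right_eq)
    moreover have "{0..<int N} = range (\<lambda>k. k mod int N)"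
    proof (intro equalityI subsetI)
      fix k assume "k \<in> {0..<int N}"
      then have "k = k mod int N" by simp
      then show "k \<in> range (\<lambda>k. k mod int N)" by blast
    qed (use N in auto)
    ultimately show "carrier G = range (\<lambda>k::int. (1 mod int N) [^]\<^bsub>G\<^esub> k)"
      by (simp add: carrG)
  qed
  moreover have "finite (carrier G)" by (simp add: carrG)
  ultimately show ?thesis using grp hom unfolding S_def by blast
qed

end

end

section \<open>A coefficient field for the model, and the conclusion\<close>

instance alg_closure :: (field) field_gcd ..

text \<open>In an algebraic closure of the complex Laurent series let \<open>s\<close> be the series
  variable. Evaluation at \<open>s\<close> is then the embedding of polynomials into series, so
  transcendence is its injectivity, and \<open>z0\<close> is any \<open>c\<close>-th root.\<close>

lemma pham_model_exists:
  assumes "a \<ge> 2" "b \<ge> 2" "c \<ge> 2" "coprime a b" "coprime a c" "coprime b c"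
    "1 / real a + 1 / real b + 1 / real c < 1" "m > 0" "n > 0"
  shows "\<exists>(\<kappa> :: complex \<Rightarrow> complex fls alg_closure) s z0. pham_model a b c m n \<kappa> s z0"
proof -
  define \<kappa> :: "complex \<Rightarrow> complex fls alg_closure" where "\<kappa> k = to_ac (fls_const k)" for k
  define s :: "complex fls alg_closure" where "s = to_ac fls_X"
  have \<kappa>: "ring_map \<kappa>"
    by standard (simp_all add: \<kappa>_def fls_plus_const flip: to_ac_add to_ac_mult)
  have ev: "evp \<kappa> s p = to_ac (fps_to_fls (fps_of_poly p))" for p
  proof (induction p)
    case (pCons k p)
    have "evp \<kappa> s (pCons k p) = to_ac (fls_const k + fls_X * fps_to_fls (fps_of_poly p))"
      by (simp add: evp_pCons[OF \<kappa>] pCons.IH) (simp add: \<kappa>_def s_def)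
    then show ?case by (simp add: fps_of_poly_pCons fls_times_fps_to_fls mult.commute)
  qed simp
  obtain z0 where "z0 ^ c = - (s ^ a + 1)"
    using nth_root_exists[of c "- (s ^ a + 1)"] assms(3) by auto
  then have "s ^ a + 1 + z0 ^ c = 0" by simp
  moreover have "p = 0" if "evp \<kappa> s p = 0" for p
    using that by (simp add: ev fps_to_fls_eq_0_iff)
  ultimately have "pham_model a b c m n \<kappa> s z0"
    using assms \<kappa> by unfold_locales (auto simp: ring_map_def)
  then show ?thesis by blast
qed

theorem theorem7p4:
  fixes a b c m n :: nat and h :: "cpoly3 set"
    and \<delta> :: "cpoly3 set poly2 set \<Rightarrow> cpoly3 set poly2 set"
  assumes "a > 0" "b > 0" "c > 0"
    and "coprime a b" "coprime a c" "coprime b c"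
    and "1 / real a + 1 / real b + 1 / real c < 1"
    and "m \<ge> 2" "n \<ge> 2"
    and "h \<in> carrier (ringR a b c)" "h \<noteq> \<zero>\<^bsub>ringR a b c\<^esub>"
    and "\<And>f. f \<in> carrier (ringB a b c m n) \<Longrightarrow>
           \<delta> f = inclR a b c m n h \<otimes>\<^bsub>ringB a b c m n\<^esub> canonD a b c m n f"
  shows "\<exists>(G :: int monoid) \<theta>.
           group G \<and> finite (carrier G) \<and> cyclic_group G \<and>
           \<theta> \<in> hom G (AutoGroup (add_monoid (ringR a b c))) \<and>
           AutDer a b c m n \<delta> \<cong> semidirect G \<theta> (add_monoid (ringR a b c))"
proof -
  have ge2: "k \<ge> 2" if "k > 0" "1 / real k < 1" for k :: nat
    using that by (cases "k = 1") auto
  have pos: "1 / real a > 0" "1 / real b > 0" "1 / real c > 0" using assms(1-3) by simp_all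
  \<comment> \<open>Each reciprocal is below 1 because the other two are positive.\<close>
  have "a \<ge> 2" "b \<ge> 2" "c \<ge> 2"
    using assms(1-3,7) pos by (intro ge2; linarith)+
  then obtain \<kappa> :: "complex \<Rightarrow> complex fls alg_closure" and s z0 where "pham_model a b c m n \<kappa> s z0"
    using pham_model_exists[of a b c m n] assms by auto
  then interpret pham_model a b c m n \<kappa> s z0 .
  show ?thesis using assms(10-12) by (rule AutDer_semidirect)
qed

end
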